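(* Let $V\subset H\subset V^*$, the forms $b_m$ and operators $B_m$ ($m\in\mathbb{N}_0$), the constant $\alpha_0>0$ and the sequence $\kappa=(\kappa_1,\kappa_2,\ldots)$ of positive reals be as in the context; in particular $\|\kappa\|_{\ell^1(\mathbb{N})}<1$, $b_0(v,v)\ge\alpha_0\|v\|_V^2$ for all $v\in V$, and $|b_m(u,v)|\le\kappa_m\alpha_0\|u\|_V\|v\|_V$ for all $u,v\in V$, $m\ge1$. Consider the parametric eigenvalue problem $B(y)u(y)=\mu(y)u(y)$, $y\in\Gamma=[-1,1]^\infty$, where $B(y)=B_0+\sum_{m=1}^\infty y_mB_m$. Assume that $\kappa\in\ell^p(\mathbb{N})$ for some $p\in(0,1]$. Let $J\subset\mathbb{N}$ be finite and assume that the eigenspace $y\mapsto U_J(y)$ is isolated with parameter $\delta>0$ for $y\in\Gamma$, i.e. $\operatorname{dist}(\sigma_J(y),\sigma_{\mathbb{N}\setminus J}(y))\ge\delta\max\sigma_J(y)$ for all $y\in\Gamma$. Let $\varepsilon\in(0,1)$ be arbitrary and set $$\tau_m:=\frac{(1-\varepsilon)\,(1-\|\kappa\|_{\ell^1(\mathbb{N})})\,\kappa_m^{p-1}}{2\,\bigl(\sum_{n=1}^\infty\kappa_n^p\bigr)\,(1+\delta^{-1})},\qquad m\in\mathbb{N}.$$ Then $y\mapsto U_J(y)$ admits a complex-analytic extension $z\mapsto U_J(z)$ in the region $$E(\tau):=\{z\in\mathbb{C}^\infty : \operatorname{dist}(z_m,[-1,1])<\tau_m\ \text{for all } m\in\m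athbb{N}\}.$$
   Context: $\mathbb{N}=\{1,2,\ldots\}$, $\mathbb{N}_0=\mathbb{N}\cup\{0\}$. Setting. $V$ and $H$ are separable real Hilbert spaces forming a Gel'fand triple $V\subset H\subset V^*$ with dense and compact embeddings; $\langle\cdot,\cdot\rangle_{V\times V^*}$ is the duality pairing extending $(\cdot,\cdot)_H$. For $m\in\mathbb{N}_0$, $b_m:V\times V\to\mathbb{R}$ is a symmetric continuous bilinear form with associated operator $B_m\in\mathcal{L}(V,V^* )$, $b_m(u,v)=\langle v,B_mu\rangle_{V\times V^*}$. For $y\in\Gamma=[-1,1]^\infty$ put $b(y;u,v)=b_0(u,v)+\sum_{m\ge1}y_mb_m(u,v)$ and $B(y)=B_0+\sum_{m\ge1}y_mB_m$. The eigenvalue problem is: $b(y;u,v)=\mu\,(u,v)_H$ for all $v\in V$, with $u\in V\setminus\{0\}$. Its eigenvalues are enumerated increasingly, $0<\mu_1(y)\le\mu_2(y)\le\cdots$, repeated according to multiplicity, with $H$-orthonormal eigenfunctions $u_i(y)$. Eigenspaces. For $J\subset\mathbb{N}$: $\sigma_J(y)=\{\mu_i(y)\}_{i\in J}$ and $U_J(y)=\operatorname{span}\{u_i(y)\}_{i\in J}$. Complex parameters. $V$, $H$ are replaced by their complexifications, with inner products and the duality pairing extended sesquilinearly, and $B(z)=B_0+\sum_{m\ge1}z_mB_m$ for complex $z\in\mathbb{C}^\infty$ for which the series converges. If $\Omega(z)$ is a positively oriented closed curve enclosing a set $\sigma_J(z)$ of eigenvalues of $B(z)$ and no other element of its spectrum,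 the Riesz spectral projection is $P_J(z)=\frac{1}{2\pi\mathrm{i}}\int_{\Omega(z)}(\omega-B(z))^{-1}d\omega$ (up to the sign convention for the resolvent it is the projection onto the total eigenspace $U_J(z)$ for $\sigma_J(z)$). If $\sigma_J(z)$ consists of several groups of eigenvalues, the curve may be a finite union of closed curves. For $z=y\in\Gamma$ this is the $H$-orthogonal projection onto $U_J(y)$. The map $z\mapsto U_J(z)$ is called complex-analytic if $z\mapsto P_J(z)$ is, i.e. if $z\mapsto(P_J(z)v,u)_H$ is complex-analytic for all $u,v\in V$. An analytic extension of $y\mapsto U_J(y)$ to a region $E\supset\Gamma$ is such an analytic family of spectral projections $P_J(z)$ of $B(z)$, $z\in E$, agreeing on $\Gamma$ with the projections onto $U_J(y)$. A scalar function on $E(\tau)\subset\mathbb{C}^\infty$ is (jointly) complex-analytic if it is continuous for the (Hausdorff) product topology and holomorphic in any finite number of the variables $z_m$ when the remaining ones are held fixed. *)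

theory Defs
  imports "HOL-Complex_Analysis.Complex_Analysis"
begin

text \<open>
  Sequences indexed by the positive integers (the parameters, the forms \<open>b\<^sub>m\<close> with \<open>m \<ge> 1\<close>, the
  numbers \<open>\<kappa>\<^sub>m\<close>, \<open>\<tau>\<^sub>m\<close>, the eigenpairs and the index set \<open>J\<close>) are indexed by \<^typ>\<open>nat\<close> from 0
  throughout; the form \<open>b\<^sub>0\<close> is kept apart as \<open>b0\<close>.
\<close>

section \<open>Gelfand triples\<close>

definition dense_compact_embedding :: "('a::real_normed_vector \<Rightarrow> 'b::real_normed_vector) \<Rightarrow> bool" where
  "dense_compact_embedding f \<longleftrightarrow>
     bounded_linear f \<and> inj f \<and> closure (range f) = UNIV \<and>
     (\<forall>S. bounded S \<longrightarrow> compact (closure (f ` S)))"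

text \<open>The embedding of \<open>H\<close> into the dual of \<open>V\<close>: \<open>h \<mapsto> (v \<mapsto> (v, h)\<^sub>H)\<close>.\<close>

definition dual_embed :: "('v::real_inner \<Rightarrow>\<^sub>L 'h::real_inner) \<Rightarrow> 'h \<Rightarrow> ('v \<Rightarrow>\<^sub>L real)" where
  "dual_embed \<iota> h = blinfun_inner_right h o\<^sub>L \<iota>"

definition gelfand_triple :: "('v::real_inner \<Rightarrow>\<^sub>L 'h::real_inner) \<Rightarrow> bool" where
  "gelfand_triple \<iota> \<longleftrightarrow>
     dense_compact_embedding (blinfun_apply \<iota>) \<and> dense_compact_embedding (dual_embed \<iota>)"

section \<open>The real parametric eigenvalue problem\<close>

definition param_box :: "(nat \<Rightarrow> real) set" where
  "param_box = {y. \<forall>m. y m \<in> {-1..1}}"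

definition param_form ::
  "('v \<Rightarrow> 'v \<Rightarrow> real) \<Rightarrow> (nat \<Rightarrow> 'v \<Rightarrow> 'v \<Rightarrow> real) \<Rightarrow> (nat \<Rightarrow> real) \<Rightarrow> 'v \<Rightarrow> 'v \<Rightarrow> real" where
  "param_form b0 b y u v = b0 u v + (\<Sum>m. y m * b m u v)"

definition eigenspace ::
  "('v::real_inner \<Rightarrow>\<^sub>L 'h::real_inner) \<Rightarrow> ('v \<Rightarrow> 'v \<Rightarrow> real) \<Rightarrow> real \<Rightarrow> 'v set" where
  "eigenspace \<iota> a \<nu> = {u. \<forall>v. a u v = \<nu> * (\<iota> u \<bullet> \<iota> v)}"

text \<open>
  The last conjunct says that every eigenvalue \<open>\<nu>\<close> occurs, and occurs according to its multiplicity: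
  the (orthonormal, hence independent) \<open>u i\<close> with \<open>\<mu> i = \<nu>\<close> form a basis of the eigenspace, which is
  \<open>{0}\<close> if \<open>\<nu>\<close> is not an eigenvalue.
\<close>

definition eigen_enumeration ::
  "('v::real_inner \<Rightarrow>\<^sub>L 'h::real_inner) \<Rightarrow> ('v \<Rightarrow> 'v \<Rightarrow> real) \<Rightarrow> (nat \<Rightarrow> real) \<Rightarrow> (nat \<Rightarrow> 'v) \<Rightarrow> bool" where
  "eigen_enumeration \<iota> a \<mu> u \<longleftrightarrow>
     mono \<mu> \<and>
     (\<forall>i j. \<iota> (u i) \<bullet> \<iota> (u j) = (if i = j then 1 else 0)) \<and>
     (\<forall>\<nu>. eigenspace \<iota> a \<nu> = span (u ` {i. \<mu> i = \<nu>}))"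

definition isolated_with :: "((nat \<Rightarrow> real) \<Rightarrow> nat \<Rightarrow> real) \<Rightarrow> nat set \<Rightarrow> real \<Rightarrow> bool" where
  "isolated_with \<mu> J \<delta> \<longleftrightarrow>
     (\<forall>y\<in>param_box. setdist (\<mu> y ` J) (\<mu> y ` (- J)) \<ge> \<delta> * Max (\<mu> y ` J))"

section \<open>Complexification\<close>

text \<open>
  The complexification of a real space \<open>X\<close> is \<open>X \<times> X\<close>, the pair \<open>(a, b)\<close> standing for \<open>a + i b\<close>; the
  norm of the product type is the Hilbert norm of the complexification. A real linear map \<open>f\<close> extends
  complex-linearly to \<open>map_prod f f\<close>.
\<close>

definition cscale :: "complex \<Rightarrow> 'a::real_vector \<times> 'a \<Rightarrow> 'a \<times> 'a" where
  "cscale c x = (Re c *\<^sub>R fst x - Im c *\<^sub>R snd x, Re c *\<^sub>R snd x + Im c *\<^sub>R fst x)"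

text \<open>Linear in the first and antilinear in the second argument.\<close>

definition cinner :: "'a::real_inner \<times> 'a \<Rightarrow> 'a \<times> 'a \<Rightarrow> complex" where
  "cinner x y = Complex (fst x \<bullet> fst y + snd x \<bullet> snd y) (snd x \<bullet> fst y - fst x \<bullet> snd y)"

text \<open>The operator \<open>B : V \<rightarrow> V\<^sup>*\<close> of a continuous bilinear form, \<open>\<langle>v, B u\<rangle> = b(u, v)\<close>.\<close>

definition form_op ::
  "('v::real_normed_vector \<Rightarrow> 'v \<Rightarrow> real) \<Rightarrow> ('v \<Rightarrow>\<^sub>L ('v \<Rightarrow>\<^sub>L real))" where
  "form_op b = Blinfun (\<lambda>u. Blinfun (\<lambda>v. b u v))"

definition param_op ::
  "('v::real_normed_vector \<Rightarrow> 'v \<Rightarrow> real) \<Rightarrow> (nat \<Rightarrow> 'v \<Rightarrow> 'v \<Rightarrow> real) \<Rightarrow> (nat \<Rightarrow> complex) \<Rightarrow>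
   'v \<times> 'v \<Rightarrow> ('v \<Rightarrow>\<^sub>L real) \<times> ('v \<Rightarrow>\<^sub>L real)" where
  "param_op b0 b z u =
     map_prod (form_op b0) (form_op b0) u +
     (\<Sum>m. cscale (z m) (map_prod (form_op (b m)) (form_op (b m)) u))"

section \<open>Spectrum and Riesz projections\<close>

text \<open>
  Below, \<open>A\<close> is a complex-linear map from the complexification of \<open>V\<close> to that of its dual,
  i.e. an operator in the dual with domain \<open>V\<close>.
\<close>

definition shifted_op ::
  "('v::real_inner \<Rightarrow>\<^sub>L 'h::real_inner) \<Rightarrow> ('v \<times> 'v \<Rightarrow> ('v \<Rightarrow>\<^sub>L real) \<times> ('v \<Rightarrow>\<^sub>L real)) \<Rightarrow>
   complex \<Rightarrow> 'v \<times> 'v \<Rightarrow> ('v \<Rightarrow>\<^sub>L real) \<times> ('v \<Rightarrow>\<^sub>L real)" where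
  "shifted_op \<iota> A \<omega> u =
     cscale \<omega> (map_prod (\<lambda>x. dual_embed \<iota> (\<iota> x)) (\<lambda>x. dual_embed \<iota> (\<iota> x)) u) - A u"

definition spectrum ::
  "('v::real_inner \<Rightarrow>\<^sub>L 'h::real_inner) \<Rightarrow> ('v \<times> 'v \<Rightarrow> ('v \<Rightarrow>\<^sub>L real) \<times> ('v \<Rightarrow>\<^sub>L real)) \<Rightarrow> complex set" where
  "spectrum \<iota> A =
     {\<omega>. \<not> (bij (shifted_op \<iota> A \<omega>) \<and> bounded_linear (inv (shifted_op \<iota> A \<omega>)))}"

definition eigenvalues ::
  "('v::real_inner \<Rightarrow>\<^sub>L 'h::real_inner) \<Rightarrow> ('v \<times> 'v \<Rightarrow> ('v \<Rightarrow>\<^sub>L real) \<times> ('v \<Rightarrow>\<^sub>L real)) \<Rightarrow> complex set" where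
  "eigenvalues \<iota> A = {\<omega>. \<exists>u. u \<noteq> 0 \<and> shifted_op \<iota> A \<omega> u = 0}"

text \<open>The resolvent \<open>(\<omega> - A)\<^sup>-\<^sup>1\<close>, regarded as an operator in the complexification of \<open>H\<close>.\<close>

definition resolvent ::
  "('v::real_inner \<Rightarrow>\<^sub>L 'h::real_inner) \<Rightarrow> ('v \<times> 'v \<Rightarrow> ('v \<Rightarrow>\<^sub>L real) \<times> ('v \<Rightarrow>\<^sub>L real)) \<Rightarrow>
   complex \<Rightarrow> 'h \<times> 'h \<Rightarrow> 'h \<times> 'h" where
  "resolvent \<iota> A \<omega> h =
     map_prod \<iota> \<iota> (inv (shifted_op \<iota> A \<omega>) (map_prod (dual_embed \<iota>) (dual_embed \<iota>) h))"

text \<open>The vector-valued analogue of \<^const>\<open>contour_integral\<close>.\<close>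

definition vec_contour_integral ::
  "(real \<Rightarrow> complex) \<Rightarrow> (complex \<Rightarrow> 'a::real_normed_vector \<times> 'a) \<Rightarrow> 'a \<times> 'a" where
  "vec_contour_integral \<gamma> f =
     integral {0..1} (\<lambda>t. cscale (vector_derivative \<gamma> (at t within {0..1})) (f (\<gamma> t)))"

text \<open>
  \<open>\<Omega>\<close> is a finite union of positively oriented simple closed curves, none of which meets \<open>T\<close>, and \<open>S\<close>
  is the part of \<open>T\<close> that they enclose.
\<close>

definition curves_enclosing :: "(real \<Rightarrow> complex) set \<Rightarrow> complex set \<Rightarrow> complex set \<Rightarrow> bool" where
  "curves_enclosing \<Omega> T S \<longleftrightarrow>
     finite \<Omega> \<and>
     (\<forall>\<gamma>\<in>\<Omega>. valid_path \<gamma> \<and> simple_path \<gamma> \<and> pathfinish \<gamma> = pathstart \<gamma> \<and>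
        path_image \<gamma> \<inter> T = {} \<and> (\<forall>w\<in>inside (path_image \<gamma>). winding_number \<gamma> w = 1)) \<and>
     disjoint_family_on (\<lambda>\<gamma>. inside (path_image \<gamma>)) \<Omega> \<and>
     T \<inter> (\<Union>\<gamma>\<in>\<Omega>. inside (path_image \<gamma>)) = S"

definition riesz_projection ::
  "('v::real_inner \<Rightarrow>\<^sub>L 'h::real_inner) \<Rightarrow> ('v \<times> 'v \<Rightarrow> ('v \<Rightarrow>\<^sub>L real) \<times> ('v \<Rightarrow>\<^sub>L real)) \<Rightarrow>
   (real \<Rightarrow> complex) set \<Rightarrow> 'h \<times> 'h \<Rightarrow> 'h \<times> 'h" where
  "riesz_projection \<iota> A \<Omega> h =
     cscale (1 / (2 * of_real pi * \<i>)) (\<Sum>\<gamma>\<in>\<Omega>. vec_contour_integral \<gamma> (\<lambda>\<omega>. resolvent \<iota> A \<omega> h))"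

definition spectral_projection ::
  "('v::real_inner \<Rightarrow>\<^sub>L 'h::real_inner) \<Rightarrow> ('v \<times> 'v \<Rightarrow> ('v \<Rightarrow>\<^sub>L real) \<times> ('v \<Rightarrow>\<^sub>L real)) \<Rightarrow>
   ('h \<times> 'h \<Rightarrow> 'h \<times> 'h) \<Rightarrow> bool" where
  "spectral_projection \<iota> A P \<longleftrightarrow>
     (\<exists>\<Omega> S. S \<subseteq> eigenvalues \<iota> A \<and> curves_enclosing \<Omega> (spectrum \<iota> A) S \<and>
        P = riesz_projection \<iota> A \<Omega>)"

section \<open>Analytic extensions of eigenspaces\<close>

text \<open>
  Holomorphy in finitely many variables \<open>z\<^sub>m\<close>, \<open>m \<in> M\<close>, is complex (Frechet) differentiability with
  respect to these variables at every point; the slices of the regions \<open>E\<close> used here are open.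
\<close>

definition complex_analytic_seq :: "(nat \<Rightarrow> complex) set \<Rightarrow> ((nat \<Rightarrow> complex) \<Rightarrow> complex) \<Rightarrow> bool" where
  "complex_analytic_seq E f \<longleftrightarrow>
     continuous_on E f \<and>
     (\<forall>M. finite M \<longrightarrow> (\<forall>z\<in>E. \<exists>a :: nat \<Rightarrow> complex. \<forall>e>0. \<exists>d>0. \<forall>w\<in>E.
        (\<forall>m. m \<notin> M \<longrightarrow> w m = z m) \<longrightarrow> (\<forall>m\<in>M. cmod (w m - z m) < d) \<longrightarrow>
        cmod (f w - f z - (\<Sum>m\<in>M. a m * (w m - z m))) \<le> e * (\<Sum>m\<in>M. cmod (w m - z m))))"

definition orth_projection_onto :: "('h::real_inner \<times> 'h) set \<Rightarrow> ('h \<times> 'h \<Rightarrow> 'h \<times> 'h) \<Rightarrow> bool" where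
  "orth_projection_onto W P \<longleftrightarrow> (\<forall>h. P h \<in> W \<and> (\<forall>w\<in>W. cinner (h - P h) w = 0))"

text \<open>
  \<open>U y\<close> is a real subspace of \<open>V\<close>, viewed in \<open>H\<close> via \<open>\<iota>\<close>; its complexification is the product of
  its image with itself.
\<close>

definition has_analytic_extension ::
  "('v::real_inner \<Rightarrow>\<^sub>L 'h::real_inner) \<Rightarrow>
   ((nat \<Rightarrow> complex) \<Rightarrow> 'v \<times> 'v \<Rightarrow> ('v \<Rightarrow>\<^sub>L real) \<times> ('v \<Rightarrow>\<^sub>L real)) \<Rightarrow>
   ((nat \<Rightarrow> real) \<Rightarrow> 'v set) \<Rightarrow> (nat \<Rightarrow> complex) set \<Rightarrow> bool" where
  "has_analytic_extension \<iota> B U E \<longleftrightarrow>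
     (\<exists>P. (\<forall>z\<in>E. spectral_projection \<iota> (B z) (P z)) \<and>
          (\<forall>u v. complex_analytic_seq E (\<lambda>z. cinner (P z (map_prod \<iota> \<iota> v)) (map_prod \<iota> \<iota> u))) \<and>
          (\<forall>y\<in>param_box. orth_projection_onto ((\<iota> ` U y) \<times> (\<iota> ` U y)) (P (\<lambda>m. of_real (y m)))))"

definition ext_region :: "(nat \<Rightarrow> real) \<Rightarrow> (nat \<Rightarrow> complex) set" where
  "ext_region \<tau> = {z. \<forall>m. infdist (z m) (of_real ` {-1..1}) < \<tau> m}"

end

(*
  Let y be the point of the parameter box nearest to z. The choice of tau gives
  sum_m kappa_m |z_m - y_m| <= (1 - eps) eta (1 - |kappa|_1) with eta = delta / (2 (1 + delta)), so
  B(z) - B(y) is bounded by (1 - eps) eta relative to the form b(y). Testing with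
  v = sum_k sgn(w - mu_k) c_k u_k for u = sum_k c_k u_k shows that w - B(z) is bounded below, hence
  (method of continuity) invertible, as soon as |w - mu_k(y)| >= eta mu_k(y) for all k. The intervals
  [(1 - eta) mu_k, (1 + eta) mu_k] with k in J are disjoint from those with k outside J; since J and its
  complement never exchange order, every maximal run of consecutive indices in J is encircled by one
  circle with real diameter that moves continuously with y. For nearby z the circle can be kept fixed by
  Cauchy's theorem, and the resolvent identity gives a first-order expansion of the Riesz projection
  with a remainder quadratic in sum_m kappa_m |w_m - z_m|. At real points, completeness of the
  eigenvectors identifies the projection.
*)

theory Submission
  imports Defs
begin

section \<open>Perturbation of invertible and compact operators\<close>

text \<open>The assumed enumeration exhausts every eigenspace but says nothing about completeness.
  Completeness is derived by minimising Rayleigh quotients with the help of the compact embedding,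
  and it is what makes expansions in eigenvectors legitimate as test vectors. The estimates are
  relative to the eigenvalues: the perturbation is measured against the form b(y) itself, so the
  infinitely many large eigenvalues cost nothing. The gap above a run asks for (1 + eta) < (1 - eta)
  (1 + delta), that is eta < delta / (2 + delta), which the chosen eta satisfies with room for a
  circle. The power kappa_m^(p - 1) turns sum kappa_m tau_m into a multiple of sum kappa_m^p.
  Multiplication by i need not preserve the norm of pairs in the dual of V, so the constant that
  fixes the radii is obtained from the pairing with V, and operator norms serve only where constants
  do not matter. Since the contour depends on the nearest point of the box, analyticity cannot be
  read off the definition of the projection; it is checked locally with a frozen contour. The
  enclosed part of the spectrum must consist of eigenvalues, which is where the Fredholm alternative
  enters.\<close>

lemma surj_perturb:
  fixes A A' :: "'a::banach \<Rightarrow> 'b::real_normed_vector"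
  assumes A: "bounded_linear A" and A': "bounded_linear A'" and "surj A"
    and below: "\<And>x. c * norm x \<le> norm (A x)"
    and diff: "\<And>x. norm (A' x - A x) \<le> d * norm x" and "0 \<le> d" "d < c"
  shows "surj A'"
proof (unfold surj_def, rule allI)
  fix y
  interpret A: bounded_linear A by fact
  interpret A': bounded_linear A' by fact
  define f where "f x = inv A (y - (A' x - A x))" for x
  have Af: "A (f x) = y - (A' x - A x)" for x
    unfolding f_def by (rule surj_f_inv_f[OF \<open>surj A\<close>])
  have contr: "dist (f x) (f x') \<le> (d / c) * dist x x'" for x x'
  proof -
    have "A (f x - f x') = - (A' (x - x') - A (x - x'))"
      by (simp add: A.diff A'.diff Af)
    then have "c * norm (f x - f x') \<le> d * norm (x - x')"
      by (metis below diff norm_minus_cancel order_trans)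
    then show ?thesis using \<open>0 \<le> d\<close> \<open>d < c\<close> by (simp add: dist_norm field_simps)
  qed
  have "\<exists>!x. f x = x"
    by (rule banach_fix_type[where c = "d / c"]) (use contr \<open>0 \<le> d\<close> \<open>d < c\<close> in auto)
  then obtain x where "f x = x" by auto
  then have "A' x = y" using Af[of x] by simp
  then show "\<exists>x. y = A' x" by auto
qed

text \<open>The lower bound \<open>c\<close> is the same for all \<open>t\<close>, so a step in
  \<open>t\<close> of length below \<open>c / K\<close>, with \<open>K\<close> a bound of
  \<open>D\<close>, preserves surjectivity by \<open>surj_perturb\<close>. Finitely many such steps
  lead from 0 to 1.\<close>

lemma method_of_continuity:
  fixes A D :: "'a::banach \<Rightarrow> 'b::real_normed_vector"
  assumes A: "bounded_linear A" and D: "bounded_linear D" and "surj A" "0 < c"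
    and below: "\<And>t x. 0 \<le> t \<Longrightarrow> t \<le> 1 \<Longrightarrow> c * norm x \<le> norm (A x + t *\<^sub>R D x)"
  shows "surj (\<lambda>x. A x + D x)"
proof -
  interpret D: bounded_linear D by fact
  obtain K where K: "K > 0" "\<And>x. norm (D x) \<le> norm x * K" using D.pos_bounded by blast
  obtain n :: nat where n: "K / c < real n" using reals_Archimedean2 by blast
  have "0 < K / c" using K \<open>0 < c\<close> by simp
  with n have n0: "real n > 0" by linarith
  have lin: "bounded_linear (\<lambda>x. A x + t *\<^sub>R D x)" for t
    by (intro bounded_linear_add A bounded_linear_const_scaleR D)
  have "surj (\<lambda>x. A x + (real k / real n) *\<^sub>R D x)" if "k \<le> n" for k
    using that
  proof (induction k)
    case 0 then show ?case using \<open>surj A\<close> by simp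
  next
    case (Suc k)
    show ?case
    proof (rule surj_perturb[OF lin lin Suc.IH, where c = c and d = "K / real n"])
      show "c * norm x \<le> norm (A x + (real k / real n) *\<^sub>R D x)" for x
        using Suc.prems by (intro below) auto
      show "norm (A x + (real (Suc k) / real n) *\<^sub>R D x - (A x + (real k / real n) *\<^sub>R D x)) \<le> K / real n * norm x" for x
      proof -
        have "A x + (real (Suc k) / real n) *\<^sub>R D x - (A x + (real k / real n) *\<^sub>R D x)
            = (real (Suc k) / real n - real k / real n) *\<^sub>R D x"
          by (simp only: scaleR_diff_left) simp
        also have "real (Suc k) / real n - real k / real n = 1 / real n"
          by (simp add: diff_divide_distrib[symmetric])
        finally have "A x + (real (Suc k) / real n) *\<^sub>R D x - (A x + (real k / real n) *\<^sub>R D x) = (1 / real n) *\<^sub>R D x" .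
        then show ?thesis using K(2)[of x] n0 by (simp add: field_simps)
      qed
      show "0 \<le> K / real n" "K / real n < c" using K n0 n \<open>0 < c\<close> by (auto simp: field_simps)
      show "k \<le> n" using Suc.prems by simp
    qed
  qed
  from this[of n] n0 show ?thesis by simp
qed

lemma bounded_below_closed_range:
  fixes A :: "'a::banach \<Rightarrow> 'b::real_normed_vector"
  assumes "bounded_linear A" "0 < c" "\<And>x. c * norm x \<le> norm (A x)"
  shows "closed (range A)"
  using complete_isometric_image[of c UNIV A] assms
  by (auto simp: complete_UNIV intro: complete_imp_closed)

lemma bounded_below_bij:
  fixes A :: "'a::real_normed_vector \<Rightarrow> 'b::real_normed_vector"
  assumes A: "bounded_linear A" and "0 < c" and below: "\<And>x. c * norm x \<le> norm (A x)" and "surj A"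
  shows "bij A" "bounded_linear (inv A)" "norm (inv A y) \<le> norm y / c"
proof -
  interpret A: bounded_linear A by fact
  have "x = 0" if "A x = 0" for x using below[of x] that \<open>0 < c\<close> by (simp add: mult_le_0_iff)
  then have "inj A" using linear_injective_0[OF A.linear] by blast
  then show bij: "bij A" using \<open>surj A\<close> by (simp add: bij_def)
  have AI: "A (inv A y) = y" for y by (rule surj_f_inv_f[OF \<open>surj A\<close>])
  have IA: "inv A (A x) = x" for x by (rule inv_f_f[OF \<open>inj A\<close>])
  have bd: "norm (inv A y) \<le> norm y / c" for y
    using below[of "inv A y"] \<open>0 < c\<close> by (simp add: AI field_simps)
  then show "norm (inv A y) \<le> norm y / c" .
  show "bounded_linear (inv A)"
  proof (rule bounded_linear_intro[where K = "1 / c"])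
    show "inv A (x + y) = inv A x + inv A y" for x y
      by (metis A.add AI IA)
    show "inv A (r *\<^sub>R x) = r *\<^sub>R inv A x" for r x
      by (metis A.scaleR AI IA)
    show "norm (inv A x) \<le> norm x * (1 / c)" for x using bd[of x] by simp
  qed
qed

lemma bounded_inverse_below:
  fixes A :: "'a::real_normed_vector \<Rightarrow> 'b::real_normed_vector"
  assumes "bij A" "bounded_linear (inv A)"
  obtains c where "0 < c" "\<And>x. c * norm x \<le> norm (A x)"
proof -
  obtain K where K: "K > 0" "\<And>x. norm (inv A x) \<le> norm x * K"
    using bounded_linear.pos_bounded[OF assms(2)] by blast
  have "norm x \<le> norm (A x) * K" for x
    using K(2)[of "A x"] assms(1) by (simp add: bij_is_inj inv_f_f)
  then have "(1 / K) * norm x \<le> norm (A x)" for x using K(1) by (simp add: field_simps)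
  with K(1) show thesis by (intro that[of "1 / K"]) auto
qed

section \<open>Riesz theory of compact perturbations of the identity\<close>

lemma riesz_almost_orthogonal:
  fixes S :: "'a::real_normed_vector set"
  assumes "subspace S" "closed S" "subspace R" "S \<subset> R"
  obtains x where "x \<in> R" "norm x = 1" "\<And>s. s \<in> S \<Longrightarrow> 1 / 2 \<le> norm (x - s)"
proof -
  obtain r where r: "r \<in> R" "r \<notin> S" using assms by auto
  have ne: "S \<noteq> {}" using subspace_0[OF assms(1)] by auto
  define d where "d = infdist r S"
  have "d > 0" unfolding d_def using assms(2) ne r(2) infdist_pos_not_in_closed by blast
  \<comment> \<open>The distance to \<open>S\<close> need not be attained; the factor 2 allowed here
    becomes the constant 1/2 after normalising \<open>r - s0\<close>.\<close>
  have "\<exists>s\<in>S. dist r s < 2 * d"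
  proof (rule ccontr)
    assume "\<not> ?thesis"
    then have "2 * d \<le> infdist r S" using ne by (auto simp: infdist_def intro!: cINF_greatest)
    then show False using \<open>d > 0\<close> by (simp add: d_def)
  qed
  then obtain s0 where s0: "s0 \<in> S" "norm (r - s0) < 2 * d" by (auto simp: dist_norm)
  have pos: "norm (r - s0) > 0" using r(2) s0(1) by auto
  define x where "x = (1 / norm (r - s0)) *\<^sub>R (r - s0)"
  have "x \<in> R" unfolding x_def using assms r(1) s0(1)
    by (intro subspace_scale subspace_diff) auto
  moreover have "norm x = 1" using pos by (simp add: x_def)
  moreover have "1 / 2 \<le> norm (x - s)" if "s \<in> S" for s
  proof -
    have "s0 + norm (r - s0) *\<^sub>R s \<in> S" using that s0(1) assms(1) by (simp add: subspace_add subspace_scale)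
    then have "d \<le> norm (r - (s0 + norm (r - s0) *\<^sub>R s))"
      unfolding d_def using infdist_le by (metis dist_norm)
    also have "r - (s0 + norm (r - s0) *\<^sub>R s) = norm (r - s0) *\<^sub>R (x - s)"
      using pos by (simp add: x_def algebra_simps)
    finally have "d \<le> norm (r - s0) * norm (x - s)" by simp
    also have "\<dots> \<le> 2 * d * norm (x - s)" using s0(2) by (intro mult_right_mono) auto
    finally show ?thesis using \<open>d > 0\<close> by simp
  qed
  ultimately show thesis by (rule that)
qed

lemma compact_range_subseq:
  fixes K :: "'a::real_normed_vector \<Rightarrow> 'b::real_normed_vector"
  assumes "\<And>S. bounded S \<Longrightarrow> compact (closure (K ` S))" "bounded (range x)"
  obtains l r where "strict_mono (r :: nat \<Rightarrow> nat)" "(\<lambda>n. K (x (r n))) \<longlonglongrightarrow> l"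
proof -
  have "seq_compact (closure (K ` range x))"
    by (intro compact_imp_seq_compact assms)
  moreover have "\<forall>n. K (x n) \<in> closure (K ` range x)" by (intro allI subsetD[OF closure_subset]) simp
  ultimately obtain l r where "strict_mono (r :: nat \<Rightarrow> nat)" "((\<lambda>n. K (x n)) \<circ> r) \<longlonglongrightarrow> l"
    by (rule seq_compactE)
  then show thesis using that by (simp add: o_def)
qed

text \<open>Otherwise there are unit vectors with \<open>x n - K (x n)\<close> tending to 0.
  Compactness makes \<open>K (x n)\<close> converge along a subsequence, hence also
  \<open>x n\<close>, and the limit is a fixed point of \<open>K\<close> of norm 1.\<close>

lemma fredholm_bounded_below:
  fixes K :: "'a::real_normed_vector \<Rightarrow> 'a"
  assumes K: "bounded_linear K" and comp: "\<And>S. bounded S \<Longrightarrow> compact (closure (K ` S))"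
    and inj: "\<And>x. x - K x = 0 \<Longrightarrow> x = 0"
  obtains c where "0 < c" "\<And>x. c * norm x \<le> norm (x - K x)"
proof -
  interpret K: bounded_linear K by fact
  have "\<exists>c>0. \<forall>x. c * norm x \<le> norm (x - K x)"
  proof (rule ccontr)
    assume neg: "\<not> ?thesis"
    have "\<exists>x. norm x = 1 \<and> norm (x - K x) < 1 / (real n + 1)" for n
    proof -
      have "0 < 1 / (real n + 1)" by simp
      with neg obtain x where x: "norm (x - K x) < 1 / (real n + 1) * norm x"
        unfolding not_le[symmetric] by blast
      then have "x \<noteq> 0" by auto
      have "norm ((1 / norm x) *\<^sub>R x - K ((1 / norm x) *\<^sub>R x)) = norm (x - K x) / norm x"
        by (simp add: K.scaleR scaleR_diff_right[symmetric] del: scaleR_diff_right)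
      also have "\<dots> < 1 / (real n + 1)" using x \<open>x \<noteq> 0\<close> by (simp add: field_simps)
      finally show ?thesis using \<open>x \<noteq> 0\<close> by (intro exI[of _ "(1 / norm x) *\<^sub>R x"]) auto
    qed
    then obtain x where x: "\<And>n. norm (x n) = 1" "\<And>n. norm (x n - K (x n)) < 1 / (real n + 1)" by metis
    have "bounded (range x)" using x(1) by (auto simp: bounded_iff intro!: exI[of _ 1])
    then obtain l r where r: "strict_mono (r :: nat \<Rightarrow> nat)" "(\<lambda>n. K (x (r n))) \<longlonglongrightarrow> l"
      using compact_range_subseq comp by metis
    have "(\<lambda>n. x n - K (x n)) \<longlonglongrightarrow> 0"
    proof (rule Lim_null_comparison)
      show "\<forall>\<^sub>F n in sequentially. norm (x n - K (x n)) \<le> 1 / (real n + 1)"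
        by (intro always_eventually allI less_imp_le x(2))
      show "(\<lambda>n. 1 / (real n + 1)) \<longlonglongrightarrow> 0" using LIMSEQ_inverse_real_of_nat by (simp add: inverse_eq_divide add.commute)
    qed
    then have "(\<lambda>n. x (r n) - K (x (r n))) \<longlonglongrightarrow> 0"
      using LIMSEQ_subseq_LIMSEQ[OF _ r(1)] by (fastforce simp: o_def)
    from tendsto_add[OF this r(2)] have xl: "(\<lambda>n. x (r n)) \<longlonglongrightarrow> l" by simp
    then have "(\<lambda>n. K (x (r n))) \<longlonglongrightarrow> K l" by (rule K.tendsto)
    with r(2) have "l = K l" using LIMSEQ_unique by blast
    then have "l = 0" using inj by simp
    moreover have "(\<lambda>n. norm (x (r n))) \<longlonglongrightarrow> norm l" using xl by (rule tendsto_norm)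
    ultimately show False using x(1) LIMSEQ_unique[of "\<lambda>n. 1::real" 1 0] by simp
  qed
  then show thesis using that by blast
qed

text \<open>If \<open>T = I - K\<close> were injective but not onto, the ranges of its powers would strictly decrease, and unit
  vectors almost orthogonal to the next range would have \<open>K\<close>-images at mutual distance at least \<open>1/2\<close>.\<close>

lemma fredholm_alternative:
  fixes K :: "'a::banach \<Rightarrow> 'a"
  assumes K: "bounded_linear K" and comp: "\<And>S. bounded S \<Longrightarrow> compact (closure (K ` S))"
    and inj: "\<And>x. x - K x = 0 \<Longrightarrow> x = 0"
  shows "surj (\<lambda>x. x - K x)"
proof (rule ccontr)
  assume nsurj: "\<not> ?thesis"
  define T where "T x = x - K x" for x
  interpret K: bounded_linear K by fact
  have T: "bounded_linear T" unfolding T_def by (intro bounded_linear_sub bounded_linear_ident K)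
  interpret T: bounded_linear T by fact
  obtain c where c: "0 < c" "\<And>x. c * norm x \<le> norm (T x)"
    using fredholm_bounded_below[OF K comp inj] unfolding T_def by blast
  have injT: "inj T"
    using inj linear_injective_0[OF T.linear] by (simp add: T_def)
  define R where "R n = range (T ^^ n)" for n
  have lin: "bounded_linear (T ^^ n)" for n
    by (induction n) (auto simp: id_def o_def T intro: bounded_linear_compose)
  have below: "c ^ n * norm x \<le> norm ((T ^^ n) x)" for n x
  proof (induction n)
    case (Suc n)
    have "c ^ Suc n * norm x \<le> c * norm ((T ^^ n) x)" using Suc c(1) by simp
    also have "\<dots> \<le> norm (T ((T ^^ n) x))" by (rule c(2))
    finally show ?case by simp
  qed simp
  have closed: "closed (R n)" for n
    unfolding R_def by (rule bounded_below_closed_range[OF lin _ below]) (use c in simp)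
  have sub: "subspace (R n)" for n
    unfolding R_def by (rule linear_subspace_image[OF bounded_linear.linear[OF lin] subspace_UNIV])
  have RS: "R (Suc n) = T ` R n" for n unfolding R_def by (simp add: image_comp)
  have TR: "T x \<in> R (Suc n)" if "x \<in> R n" for x n using that RS by auto
  have step: "R (Suc n) \<subset> R n" for n
  proof (induction n)
    case 0
    have "range T \<noteq> UNIV" using nsurj by (simp add: T_def[abs_def])
    then show ?case by (auto simp: R_def)
  next
    case (Suc n)
    then show ?case unfolding RS[of "Suc n"] RS[of n] using injT by (simp add: image_strict_mono inj_on_subset)
  qed
  have mono: "R m \<subseteq> R n" if "n \<le> m" for m n
    using that by (induction rule: dec_induct) (use step in auto)
  have "\<exists>x. x \<in> R n \<and> norm x = 1 \<and> (\<forall>s\<in>R (Suc n). 1 / 2 \<le> norm (x - s))" for n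
    using riesz_almost_orthogonal[OF sub closed sub step] by metis
  then obtain x where x: "\<And>n. x n \<in> R n" "\<And>n. norm (x n) = 1"
    "\<And>n s. s \<in> R (Suc n) \<Longrightarrow> 1 / 2 \<le> norm (x n - s)" by metis
  have far: "1 / 2 \<le> norm (K (x n) - K (x m))" if "n < m" for n m
  proof -
    have "K (x n) - K (x m) = x n - (T (x n) + (x m - T (x m)))" by (simp add: T_def)
    moreover have "T (x n) + (x m - T (x m)) \<in> R (Suc n)"
    proof (intro subspace_add[OF sub] subspace_diff[OF sub])
      show "T (x n) \<in> R (Suc n)" using TR x(1) by blast
      show "x m \<in> R (Suc n)" using mono[of "Suc n" m] x(1)[of m] that by auto
      show "T (x m) \<in> R (Suc n)" using mono[of "Suc n" "Suc m"] TR[OF x(1)[of m]] that by auto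
    qed
    ultimately show ?thesis using x(3) by metis
  qed
  have "bounded (range x)" using x(2) by (auto simp: bounded_iff intro!: exI[of _ 1])
  then obtain l r where r: "strict_mono (r :: nat \<Rightarrow> nat)" "(\<lambda>n. K (x (r n))) \<longlonglongrightarrow> l"
    using compact_range_subseq comp by metis
  have "Cauchy (\<lambda>n. K (x (r n)))" using r(2) LIMSEQ_imp_Cauchy by blast
  then obtain N where "\<And>m n. m \<ge> N \<Longrightarrow> n \<ge> N \<Longrightarrow> norm (K (x (r m)) - K (x (r n))) < 1 / 2"
    using CauchyD[of _ "1/2"] by fastforce
  from this[of N "Suc N"] far[of "r N" "r (Suc N)"] show False
    using r(1) by (simp add: strict_mono_def)
qed

section \<open>Spectral theory of a coercive form\<close>

text \<open>The first variation at a minimum. Choosing \<open>t\<close> with denominator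
  \<open>q + 1\<close> instead of \<open>q\<close> covers the case \<open>q = 0\<close> as
  well.\<close>

lemma linear_coeff_zero_if_nonneg:
  fixes p q :: real
  assumes "\<And>t. 0 \<le> 2 * t * p + t\<^sup>2 * q" "0 \<le> q"
  shows "p = 0"
proof (rule ccontr)
  assume "p \<noteq> 0"
  have "2 * (- p / (q + 1)) * p + (- p / (q + 1))\<^sup>2 * q = - (p\<^sup>2 * (q + 2)) / (q + 1)\<^sup>2"
    using assms(2) by (simp add: power2_eq_square divide_simps) (simp add: algebra_simps)
  also have "\<dots> < 0" using assms(2) \<open>p \<noteq> 0\<close> by (intro divide_neg_pos) auto
  finally show False using assms(1)[of "- p / (q + 1)"] by simp
qed

text \<open>A single symmetric coercive form with its enumerated eigenpairs. The goal is
  completeness of the eigenvectors, in \<open>V\<close> (\<open>proj_tendsto\<close>) and in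
  \<open>H\<close> (\<open>eigenvectors_total\<close>).\<close>

locale coercive_eigensystem =
  fixes \<iota> :: "'v::{real_inner, banach} \<Rightarrow>\<^sub>L 'h::{real_inner, banach}"
    and a :: "'v \<Rightarrow> 'v \<Rightarrow> real" and \<alpha> :: real and \<mu> :: "nat \<Rightarrow> real" and u :: "nat \<Rightarrow> 'v"
  assumes embedding: "dense_compact_embedding (blinfun_apply \<iota>)"
    and bilinear: "bounded_bilinear a" and symmetric: "a v w = a w v"
    and alpha_pos: "0 < \<alpha>" and coercive: "\<alpha> * (norm v)\<^sup>2 \<le> a v v"
    and enumeration: "eigen_enumeration \<iota> a \<mu> u"
begin

sublocale a: bounded_bilinear a by (rule bilinear)

lemma mono_eigenvalues: "mono \<mu>"
  and orthonormal: "\<iota> (u i) \<bullet> \<iota> (u j) = (if i = j then 1 else 0)"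
  and eigenspace_eq: "eigenspace \<iota> a \<nu> = span (u ` {i. \<mu> i = \<nu>})"
  using enumeration by (auto simp: eigen_enumeration_def)

lemma iota_inj: "\<iota> v = 0 \<Longrightarrow> v = 0"
  using embedding unfolding dense_compact_embedding_def inj_def by (metis blinfun.zero_right)

lemma iota_compact: "bounded S \<Longrightarrow> compact (closure (\<iota> ` S))"
  using embedding by (auto simp: dense_compact_embedding_def)

lemma norm_u: "norm (\<iota> (u i)) = 1"
  by (simp add: norm_eq_sqrt_inner orthonormal)

lemma eigen_eq: "a (u i) v = \<mu> i * (\<iota> (u i) \<bullet> \<iota> v)"
proof -
  have "u i \<in> eigenspace \<iota> a (\<mu> i)" unfolding eigenspace_eq by (intro span_base) auto
  then show ?thesis by (simp add: eigenspace_def)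
qed

lemma eigen_eq': "a v (u i) = \<mu> i * (\<iota> v \<bullet> \<iota> (u i))"
  using eigen_eq[of i v] by (simp add: symmetric inner_commute)

lemma form_nonneg: "0 \<le> a v v"
  using coercive[of v] alpha_pos by (meson order_trans mult_nonneg_nonneg less_imp_le zero_le_power2)

lemma eigenvalue_pos: "0 < \<mu> i"
proof -
  have "u i \<noteq> 0" using norm_u[of i] by auto
  then have "0 < \<alpha> * (norm (u i))\<^sup>2" using alpha_pos by simp
  also have "\<dots> \<le> \<mu> i" using coercive[of "u i"] by (simp add: eigen_eq orthonormal)
  finally show ?thesis .
qed

text \<open>The \<open>H\<close>-orthogonal projection onto the first \<open>n\<close> eigenvectors.
  By the eigenvalue equation it is orthogonal for the form \<open>a\<close> too.\<close>

definition proj :: "nat \<Rightarrow> 'v \<Rightarrow> 'v" where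
  "proj n v = (\<Sum>k<n. (\<iota> v \<bullet> \<iota> (u k)) *\<^sub>R u k)"

lemma iota_combination: "\<iota> (\<Sum>k<n. c k *\<^sub>R u k) \<bullet> \<iota> (u i) = (if i < n then c i else 0)"
  by (simp add: blinfun.sum_right blinfun.scaleR_right inner_sum_left orthonormal if_distrib sum.delta cong: if_cong)

lemma form_combination:
  "a (\<Sum>k<n. c k *\<^sub>R u k) (\<Sum>k<n. d k *\<^sub>R u k) = (\<Sum>k<n. \<mu> k * (c k * d k))"
proof -
  have "a (\<Sum>k<n. c k *\<^sub>R u k) (\<Sum>k<n. d k *\<^sub>R u k) = (\<Sum>k<n. d k * (\<mu> k * (\<iota> (\<Sum>k<n. c k *\<^sub>R u k) \<bullet> \<iota> (u k))))"
    by (simp add: a.sum_right a.scaleR_right eigen_eq')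
  also have "\<dots> = (\<Sum>k<n. \<mu> k * (c k * d k))"
    by (intro sum.cong) (auto simp: iota_combination)
  finally show ?thesis .
qed

lemma inner_combination:
  "\<iota> (\<Sum>k<n. c k *\<^sub>R u k) \<bullet> \<iota> (\<Sum>k<n. d k *\<^sub>R u k) = (\<Sum>k<n. c k * d k)"
proof -
  have "\<iota> (\<Sum>k<n. c k *\<^sub>R u k) \<bullet> \<iota> (\<Sum>k<n. d k *\<^sub>R u k) = (\<Sum>k<n. d k * (\<iota> (\<Sum>k<n. c k *\<^sub>R u k) \<bullet> \<iota> (u k)))"
    by (simp add: blinfun.sum_right[of \<iota> "\<lambda>k. d k *\<^sub>R u k"] blinfun.scaleR_right inner_sum_right del: blinfun.sum_right)
  also have "\<dots> = (\<Sum>k<n. c k * d k)"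
    by (intro sum.cong) (auto simp: iota_combination)
  finally show ?thesis .
qed

section \<open>Variational characterisation of the eigenvalues\<close>

lemma proj_orth: "i < n \<Longrightarrow> \<iota> (v - proj n v) \<bullet> \<iota> (u i) = 0"
  by (simp add: blinfun.diff_right inner_diff_left proj_def iota_combination)

text \<open>The form \<open>a - m (.,.)\<close> is nonnegative on the constraint space and vanishes
  at \<open>v\<close>, so its first variation at \<open>v\<close> vanishes in all admissible
  directions. In the excluded directions \<open>u k\<close> it vanishes by the eigenvalue equation,
  so no Lagrange multipliers survive.\<close>

lemma minimizer_is_eigenvector:
  assumes orth: "\<And>k. k < n \<Longrightarrow> \<iota> v \<bullet> \<iota> (u k) = 0" and am: "a v v = m * (norm (\<iota> v))\<^sup>2"
    and min: "\<And>w. (\<And>k. k < n \<Longrightarrow> \<iota> w \<bullet> \<iota> (u k) = 0) \<Longrightarrow> m * (norm (\<iota> w))\<^sup>2 \<le> a w w"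
  shows "v \<in> eigenspace \<iota> a m"
proof -
  define q where "q x y = a x y - m * (\<iota> x \<bullet> \<iota> y)" for x y
  have qv: "q v v = 0" using am by (simp add: q_def power2_norm_eq_inner)
  have qw: "q v w = 0" if w: "\<And>k. k < n \<Longrightarrow> \<iota> w \<bullet> \<iota> (u k) = 0" for w
  proof (rule linear_coeff_zero_if_nonneg)
    have nn: "0 \<le> q x x" if "\<And>k. k < n \<Longrightarrow> \<iota> x \<bullet> \<iota> (u k) = 0" for x
      using min[OF that] by (simp add: q_def power2_norm_eq_inner)
    then show "0 \<le> q w w" using w by blast
    fix t
    have "q (v + t *\<^sub>R w) (v + t *\<^sub>R w) = q v v + 2 * t * q v w + t\<^sup>2 * q w w"
      by (simp add: q_def a.add_left a.add_right a.scaleR_left a.scaleR_right blinfun.add_right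
          blinfun.scaleR_right inner_add_left inner_add_right symmetric[of w v] inner_commute[of "\<iota> w" "\<iota> v"]
          power2_eq_square algebra_simps)
    moreover have "0 \<le> q (v + t *\<^sub>R w) (v + t *\<^sub>R w)"
      by (rule nn) (simp add: blinfun.add_right blinfun.scaleR_right inner_add_left orth w)
    ultimately show "0 \<le> 2 * t * q v w + t\<^sup>2 * q w w" by (simp add: qv)
  qed
  have qu: "q v (u k) = 0" if "k < n" for k
    using orth[OF that] by (simp add: q_def eigen_eq')
  have "q v w = 0" for w
  proof -
    have "q v (w - proj n w) = 0" by (rule qw) (rule proj_orth)
    moreover have "q v (proj n w) = 0"
    proof -
      have "q v (proj n w) = (\<Sum>k<n. (\<iota> w \<bullet> \<iota> (u k)) * q v (u k))"
        by (simp add: q_def proj_def a.sum_right a.scaleR_right blinfun.sum_right blinfun.scaleR_right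
            inner_sum_right sum_distrib_left sum_subtractf algebra_simps)
      then show ?thesis by (simp add: qu)
    qed
    moreover have "q v w = q v (w - proj n w) + q v (proj n w)"
      by (simp add: q_def a.diff_right blinfun.diff_right inner_diff_right algebra_simps)
    ultimately show ?thesis by simp
  qed
  then show ?thesis by (simp add: eigenspace_def q_def)
qed

text \<open>If the quotient fell below \<open>\<mu> n\<close> on this complement, its infimum
  \<open>m\<close> there would be attained at an eigenvector. That vector would belong to an
  eigenspace spanned by some of the \<open>u k\<close> with \<open>k < n\<close>, to all of which it
  is orthogonal.\<close>

lemma rayleigh:
  assumes orth: "\<And>k. k < n \<Longrightarrow> \<iota> v \<bullet> \<iota> (u k) = 0"
  shows "\<mu> n * (norm (\<iota> v))\<^sup>2 \<le> a v v"
proof (rule ccontr)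
  assume neg: "\<not> ?thesis"
  define W where "W = {w. (\<forall>k<n. \<iota> w \<bullet> \<iota> (u k) = 0)}"
  define Q where "Q = {a w w |w. w \<in> W \<and> norm (\<iota> w) = 1}"
  define m where "m = Inf Q"
  have subW: "w + w' \<in> W" "r *\<^sub>R w \<in> W" if "w \<in> W" "w' \<in> W" for w w' r
    using that by (auto simp: W_def blinfun.add_right blinfun.scaleR_right inner_add_left)
  have v0: "norm (\<iota> v) > 0" using neg form_nonneg[of v] by (cases "\<iota> v = 0") auto
  have scaled: "a w w / (norm (\<iota> w))\<^sup>2 \<in> Q" if "w \<in> W" "\<iota> w \<noteq> 0" for w
  proof -
    have "a ((1 / norm (\<iota> w)) *\<^sub>R w) ((1 / norm (\<iota> w)) *\<^sub>R w) = a w w / (norm (\<iota> w))\<^sup>2"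
      by (simp add: a.scaleR_left a.scaleR_right power2_eq_square)
    moreover have "(1 / norm (\<iota> w)) *\<^sub>R w \<in> W" using subW that by blast
    moreover have "norm (\<iota> ((1 / norm (\<iota> w)) *\<^sub>R w)) = 1" using that by (simp add: blinfun.scaleR_right)
    ultimately show ?thesis unfolding Q_def
      by (intro CollectI exI[of _ "(1 / norm (\<iota> w)) *\<^sub>R w"] conjI) (simp_all only:)
  qed
  have vQ: "a v v / (norm (\<iota> v))\<^sup>2 \<in> Q" using scaled[of v] orth v0 by (auto simp: W_def)
  have bdd: "bdd_below Q" unfolding Q_def using form_nonneg by (intro bdd_belowI[of _ 0]) auto
  have m_le: "m * (norm (\<iota> w))\<^sup>2 \<le> a w w" if "w \<in> W" for w
  proof (cases "\<iota> w = 0")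
    case False
    then have "m \<le> a w w / (norm (\<iota> w))\<^sup>2" unfolding m_def using scaled[OF that False] bdd by (intro cInf_lower)
    then show ?thesis using False by (simp add: field_simps)
  qed (simp add: form_nonneg)
  have "m \<le> a v v / (norm (\<iota> v))\<^sup>2" unfolding m_def using vQ bdd by (intro cInf_lower)
  also have "\<dots> < \<mu> n" using neg v0 by (simp add: field_simps)
  finally have m_lt: "m < \<mu> n" .
  have m0: "0 \<le> m" unfolding m_def using vQ form_nonneg by (intro cInf_greatest) (auto simp: Q_def)
  have "\<exists>w. w \<in> W \<and> norm (\<iota> w) = 1 \<and> a w w < m + 1 / real (Suc k)" for k
  proof -
    have "Inf Q < m + 1 / real (Suc k)" by (simp add: m_def)
    then obtain x where "x \<in> Q" "x < m + 1 / real (Suc k)" using cInf_lessD vQ by blast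
    then show ?thesis by (auto simp: Q_def)
  qed
  then obtain w where w: "\<And>k. w k \<in> W" "\<And>k. norm (\<iota> (w k)) = 1" "\<And>k. a (w k) (w k) < m + 1 / real (Suc k)"
    by metis
  have "bounded (range w)"
  proof (rule boundedI)
    fix x assume "x \<in> range w"
    then obtain k where k: "x = w k" by auto
    have "\<alpha> * (norm x)\<^sup>2 \<le> m + 1 / real (Suc k)" using coercive[of x] w(3)[of k] k by simp
    also have "\<dots> \<le> m + 1" by simp
    finally have "(norm x)\<^sup>2 \<le> (m + 1) / \<alpha>" using alpha_pos by (simp add: field_simps)
    then show "norm x \<le> sqrt ((m + 1) / \<alpha>)" by (rule real_le_rsqrt)
  qed
  then obtain h r where r: "strict_mono (r :: nat \<Rightarrow> nat)" "(\<lambda>k. \<iota> (w (r k))) \<longlonglongrightarrow> h"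
    using compact_range_subseq[of "blinfun_apply \<iota>" w] iota_compact by metis
  \<comment> \<open>The parallelogram law for both \<open>a\<close> and the inner product of
    \<open>H\<close>: a minimising sequence that is Cauchy in \<open>H\<close> is Cauchy in
    \<open>V\<close>. This replaces an argument with weak limits.\<close>
  have bound: "\<alpha> * (norm (w k - w l))\<^sup>2 \<le> 2 / real (Suc k) + 2 / real (Suc l) + m * (norm (\<iota> (w k) - \<iota> (w l)))\<^sup>2" for k l
  proof -
    have "\<alpha> * (norm (w k - w l))\<^sup>2 \<le> a (w k - w l) (w k - w l)" by (rule coercive)
    also have "\<dots> = 2 * a (w k) (w k) + 2 * a (w l) (w l) - a (w k + w l) (w k + w l)"
      by (simp add: a.add_left a.add_right a.diff_left a.diff_right)
    also have "\<dots> \<le> 2 * a (w k) (w k) + 2 * a (w l) (w l) - m * (norm (\<iota> (w k + w l)))\<^sup>2"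
      using m_le[OF subW(1)[OF w(1) w(1)]] by simp
    also have "(norm (\<iota> (w k + w l)))\<^sup>2 = 4 - (norm (\<iota> (w k) - \<iota> (w l)))\<^sup>2"
    proof -
      have "(norm (\<iota> (w k) + \<iota> (w l)))\<^sup>2 + (norm (\<iota> (w k) - \<iota> (w l)))\<^sup>2
          = 2 * (norm (\<iota> (w k)))\<^sup>2 + 2 * (norm (\<iota> (w l)))\<^sup>2"
        by (simp add: power2_norm_eq_inner inner_add_left inner_add_right inner_diff_left inner_diff_right)
      then show ?thesis using w(2) by (simp add: blinfun.add_right)
    qed
    also have "2 * a (w k) (w k) + 2 * a (w l) (w l) - m * (4 - (norm (\<iota> (w k) - \<iota> (w l)))\<^sup>2)
        = 2 * (a (w k) (w k) - m) + 2 * (a (w l) (w l) - m) + m * (norm (\<iota> (w k) - \<iota> (w l)))\<^sup>2"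
      by (simp add: algebra_simps)
    also have "\<dots> \<le> 2 * (1 / real (Suc k)) + 2 * (1 / real (Suc l)) + m * (norm (\<iota> (w k) - \<iota> (w l)))\<^sup>2"
      using w(3)[of k] w(3)[of l] by (intro add_mono) auto
    finally show ?thesis by simp
  qed
  have "Cauchy (\<lambda>k. w (r k))"
  proof (rule CauchyI)
    fix e :: real assume "e > 0"
    \<comment> \<open>One third of the target \<open>\<alpha> * e\<^sup>2\<close> for each of the
      three terms of \<open>bound\<close>.\<close>
    define f where "f = \<alpha> * e\<^sup>2 / 3"
    have "f > 0" using alpha_pos \<open>e > 0\<close> by (simp add: f_def)
    have "Cauchy (\<lambda>k. \<iota> (w (r k)))" using r(2) LIMSEQ_imp_Cauchy by blast
    moreover have "sqrt (f / (m + 1)) > 0" using \<open>f > 0\<close> m0 by simp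
    ultimately obtain N1 where N1: "\<And>k l. k \<ge> N1 \<Longrightarrow> l \<ge> N1 \<Longrightarrow> norm (\<iota> (w (r k)) - \<iota> (w (r l))) < sqrt (f / (m + 1))"
      using CauchyD by blast
    obtain N2 :: nat where N2: "2 / f < real N2" using reals_Archimedean2 by blast
    have small: "2 / real (Suc (r k)) < f" if "k \<ge> N2" for k
    proof -
      have "real N2 < real (Suc (r k))" using that strict_mono_imp_increasing[OF r(1), of k] by simp
      then have "2 / f < real (Suc (r k))" using N2 by simp
      then show ?thesis using \<open>f > 0\<close> by (simp add: field_simps)
    qed
    show "\<exists>M. \<forall>k\<ge>M. \<forall>l\<ge>M. norm (w (r k) - w (r l)) < e"
    proof (intro exI[of _ "max N1 N2"] allI impI)
      fix k l assume kl: "max N1 N2 \<le> k" "max N1 N2 \<le> l"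
      have "(norm (\<iota> (w (r k)) - \<iota> (w (r l))))\<^sup>2 \<le> (sqrt (f / (m + 1)))\<^sup>2"
        using N1[of k l] kl by (intro power_mono) auto
      also have "\<dots> = f / (m + 1)" using \<open>f > 0\<close> m0 by simp
      finally have "m * (norm (\<iota> (w (r k)) - \<iota> (w (r l))))\<^sup>2 \<le> m * (f / (m + 1))" using m0 by (rule mult_left_mono)
      also have "\<dots> \<le> f" using m0 \<open>f > 0\<close> by (simp add: field_simps)
      finally have "\<alpha> * (norm (w (r k) - w (r l)))\<^sup>2 < 3 * f"
        using bound[of "r k" "r l"] small[of k] small[of l] kl by simp
      then have "(norm (w (r k) - w (r l)))\<^sup>2 < e\<^sup>2" using alpha_pos by (simp add: f_def)
      then show "norm (w (r k) - w (r l)) < e" using \<open>e > 0\<close> by (simp add: power2_less_imp_less)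
    qed
  qed
  then obtain x where x: "(\<lambda>k. w (r k)) \<longlonglongrightarrow> x" using Cauchy_convergent convergent_def by blast
  have ix: "(\<lambda>k. \<iota> (w (r k))) \<longlonglongrightarrow> \<iota> x" using x by (rule blinfun.tendsto[OF tendsto_const])
  have nx: "norm (\<iota> x) = 1"
    using tendsto_norm[OF ix] w(2) LIMSEQ_unique[OF _ tendsto_const] by simp
  have xW: "\<iota> x \<bullet> \<iota> (u k) = 0" if "k < n" for k
    using tendsto_inner[OF ix tendsto_const[of "\<iota> (u k)"]] w(1) that LIMSEQ_unique[OF _ tendsto_const] by (simp add: W_def)
  have "(\<lambda>k. a (w (r k)) (w (r k))) \<longlonglongrightarrow> a x x" by (rule a.tendsto[OF x x])
  moreover have "(\<lambda>k. m + 1 / real (Suc (r k))) \<longlonglongrightarrow> m + 0"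
    using LIMSEQ_subseq_LIMSEQ[OF LIMSEQ_inverse_real_of_nat r(1)]
    by (intro tendsto_add tendsto_const) (simp add: o_def inverse_eq_divide)
  ultimately have "a x x \<le> m + 0"
    by (rule LIMSEQ_le) (use w(3) less_imp_le in blast)
  then have axx: "a x x = m * (norm (\<iota> x))\<^sup>2" using m_le[of x] xW nx by (simp add: W_def)
  have "x \<in> eigenspace \<iota> a m"
    by (rule minimizer_is_eigenvector[OF xW axx]) (use m_le in \<open>auto simp: W_def\<close>)
  then have xs: "x \<in> span (u ` {i. \<mu> i = m})" by (simp add: eigenspace_eq)
  \<comment> \<open>Since \<open>m\<close> lies strictly below \<open>\<mu> n\<close>, monotonicity
    confines the indices of its eigenspace to those below \<open>n\<close>.\<close>
  have low: "i < n" if "\<mu> i = m" for i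
    using m_lt that monoD[OF mono_eigenvalues, of n i] by (meson not_le order.strict_iff_not)
  have "\<iota> x \<bullet> \<iota> y = 0" if "y \<in> span (u ` {i. \<mu> i = m})" for y
    using that
  proof (induction rule: span_induct_alt)
    case (step c y z)
    then show ?case using xW low by (auto simp: blinfun.add_right blinfun.scaleR_right inner_add_right)
  qed simp
  from this[OF xs] nx show False by (simp add: power2_norm_eq_inner[symmetric])
qed

section \<open>Completeness of the eigenvectors\<close>

lemma eigenvalues_unbounded: "\<exists>n. c < \<mu> n"
proof (rule ccontr)
  assume "\<not> ?thesis"
  then have le: "\<mu> n \<le> c" for n by (simp add: not_less)
  \<comment> \<open>With bounded eigenvalues coercivity bounds the \<open>u k\<close> in
    \<open>V\<close>, so a subsequence converges in \<open>H\<close>. But orthonormal vectors stay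
    at distance \<open>sqrt 2\<close> from each other.\<close>
  have "bounded (range u)"
  proof (rule boundedI)
    fix x assume "x \<in> range u"
    then obtain k where k: "x = u k" by auto
    have "\<alpha> * (norm x)\<^sup>2 \<le> c" using coercive[of x] le[of k] k by (simp add: eigen_eq orthonormal)
    then have "(norm x)\<^sup>2 \<le> c / \<alpha>" using alpha_pos by (simp add: field_simps)
    then show "norm x \<le> sqrt (c / \<alpha>)" by (rule real_le_rsqrt)
  qed
  then obtain h r where r: "strict_mono (r :: nat \<Rightarrow> nat)" "(\<lambda>k. \<iota> (u (r k))) \<longlonglongrightarrow> h"
    using compact_range_subseq[of "blinfun_apply \<iota>" u] iota_compact by metis
  have "Cauchy (\<lambda>k. \<iota> (u (r k)))" using r(2) LIMSEQ_imp_Cauchy by blast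
  then obtain N where "\<And>k l. k \<ge> N \<Longrightarrow> l \<ge> N \<Longrightarrow> norm (\<iota> (u (r k)) - \<iota> (u (r l))) < 1"
    by (force dest!: CauchyD[of _ 1])
  from this[of N "Suc N"] have "norm (\<iota> (u (r N)) - \<iota> (u (r (Suc N)))) < 1" by simp
  then have "(norm (\<iota> (u (r N)) - \<iota> (u (r (Suc N)))))\<^sup>2 < 1" by (simp add: power_less_one_iff)
  moreover have "r N \<noteq> r (Suc N)" using r(1) by (simp add: strict_mono_eq)
  ultimately show False
    by (simp add: power2_norm_eq_inner inner_diff_left inner_diff_right orthonormal)
qed

lemma eigenvalues_at_top: "filterlim \<mu> at_top sequentially"
proof (unfold filterlim_at_top eventually_sequentially, intro allI)
  fix c
  obtain n where "c < \<mu> n" using eigenvalues_unbounded by blast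
  then show "\<exists>N. \<forall>k\<ge>N. c \<le> \<mu> k" using monoD[OF mono_eigenvalues] by (meson less_imp_le order_trans)
qed

text \<open>Pythagoras for the form \<open>a\<close>: \<open>proj k v - proj n v\<close> and
  \<open>v - proj k v\<close> are \<open>a\<close>-orthogonal.\<close>

lemma form_remainder:
  assumes "n \<le> k"
  shows "a (proj k v - proj n v) (proj k v - proj n v) = a (v - proj n v) (v - proj n v) - a (v - proj k v) (v - proj k v)"
proof -
  define c where "c i = \<iota> v \<bullet> \<iota> (u i)" for i
  have P: "a (proj i v) w = (\<Sum>l<i. \<mu> l * c l * (\<iota> (u l) \<bullet> \<iota> w))" for i w
    by (simp add: proj_def c_def a.sum_left a.scaleR_left eigen_eq algebra_simps)
  have iP: "\<iota> (u l) \<bullet> \<iota> (proj i v) = (if l < i then c l else 0)" for i l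
    using iota_combination[of c i l] by (simp add: proj_def c_def inner_commute)
  have iv: "\<iota> (u l) \<bullet> \<iota> v = c l" for l by (simp add: c_def inner_commute)
  have nk: "{..<k} \<inter> {l. l < n} = {..<n}" using assms by auto
  have e1: "a (proj n v) (proj k v) = a (proj n v) v"
    unfolding P using assms by (intro sum.cong) (auto simp: iP iv)
  have e2: "a (proj i v) (proj i v) = a (proj i v) v" for i
    unfolding P by (intro sum.cong) (auto simp: iP iv)
  show ?thesis using e1 e2[of n] e2[of k]
    by (simp add: a.diff_left a.diff_right symmetric[of v "proj n v"] symmetric[of v "proj k v"] symmetric[of "proj k v" "proj n v"])
qed

text \<open>The energies \<open>e n\<close> of the remainders decrease, so by
  \<open>form_remainder\<close> the projections are Cauchy in \<open>V\<close>. The limit is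
  \<open>v\<close> because \<open>rayleigh\<close> bounds the squared \<open>H\<close>-norm of the
  remainder by \<open>e 0 / \<mu> n\<close>, which tends to 0.\<close>

lemma proj_tendsto: "(\<lambda>n. proj n v) \<longlonglongrightarrow> v"
proof -
  define e where "e n = a (v - proj n v) (v - proj n v)" for n
  have step: "e k \<le> e n" if "n \<le> k" for n k
    using form_remainder[OF that, of v] form_nonneg[of "proj k v - proj n v"] by (simp add: e_def)
  have "decseq e" using step by (simp add: decseq_def)
  moreover have "0 \<le> e n" for n by (simp add: e_def form_nonneg)
  ultimately have "convergent e" by (metis decseq_convergent convergentI)
  then have "Cauchy e" by (rule convergent_Cauchy)
  have "Cauchy (\<lambda>n. proj n v)"
  proof (rule CauchyI)
    fix \<epsilon> :: real assume "\<epsilon> > 0"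
    then have "\<alpha> * \<epsilon>\<^sup>2 > 0" using alpha_pos by simp
    then obtain M where M: "\<And>k n. k \<ge> M \<Longrightarrow> n \<ge> M \<Longrightarrow> norm (e k - e n) < \<alpha> * \<epsilon>\<^sup>2"
      using CauchyD[OF \<open>Cauchy e\<close>] by blast
    have near: "norm (proj k v - proj n v) < \<epsilon>" if "M \<le> n" "n \<le> k" for k n
    proof -
      have "\<alpha> * (norm (proj k v - proj n v))\<^sup>2 \<le> e n - e k"
        using coercive[of "proj k v - proj n v"] form_remainder[OF \<open>n \<le> k\<close>, of v] by (simp add: e_def)
      also have "\<dots> < \<alpha> * \<epsilon>\<^sup>2" using M[of n k] that by (auto simp: abs_less_iff)
      finally have "(norm (proj k v - proj n v))\<^sup>2 < \<epsilon>\<^sup>2" using alpha_pos by simp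
      then show ?thesis using \<open>\<epsilon> > 0\<close> by (simp add: power2_less_imp_less)
    qed
    show "\<exists>M. \<forall>k\<ge>M. \<forall>n\<ge>M. norm (proj k v - proj n v) < \<epsilon>"
      using near by (metis nle_le norm_minus_commute)
  qed
  then obtain x where x: "(\<lambda>n. proj n v) \<longlonglongrightarrow> x" using Cauchy_convergent convergent_def by blast
  have bd: "(norm (\<iota> (v - proj n v)))\<^sup>2 \<le> e 0 / \<mu> n" for n
  proof -
    have "\<mu> n * (norm (\<iota> (v - proj n v)))\<^sup>2 \<le> e n" unfolding e_def by (rule rayleigh) (rule proj_orth)
    also have "\<dots> \<le> e 0" by (rule step) simp
    finally show ?thesis using eigenvalue_pos[of n] by (simp add: field_simps)
  qed
  have "(\<lambda>n. (norm (\<iota> (v - proj n v)))\<^sup>2) \<longlonglongrightarrow> 0"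
  proof (rule real_tendsto_sandwich[of "\<lambda>_. 0" _ _ "\<lambda>n. e 0 / \<mu> n"])
    show "(\<lambda>n. e 0 / \<mu> n) \<longlonglongrightarrow> 0"
      by (rule real_tendsto_divide_at_top[OF tendsto_const eigenvalues_at_top])
  qed (use bd in auto)
  moreover have "(\<lambda>n. (norm (\<iota> (v - proj n v)))\<^sup>2) \<longlonglongrightarrow> (norm (\<iota> (v - x)))\<^sup>2"
    by (intro tendsto_power tendsto_norm blinfun.tendsto tendsto_diff tendsto_const x)
  ultimately have "(norm (\<iota> (v - x)))\<^sup>2 = 0" by (rule LIMSEQ_unique[symmetric])
  then have "v = x" using iota_inj[of "v - x"] by simp
  with x show ?thesis by simp
qed

lemma eigenvectors_total:
  assumes "\<And>k. h \<bullet> \<iota> (u k) = 0"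
  shows "h = 0"
proof -
  have "h \<bullet> \<iota> v = 0" for v
  proof -
    have "(\<lambda>n. h \<bullet> \<iota> (proj n v)) \<longlonglongrightarrow> h \<bullet> \<iota> v"
      by (intro tendsto_inner tendsto_const blinfun.tendsto proj_tendsto)
    moreover have "h \<bullet> \<iota> (proj n v) = 0" for n
      by (simp add: proj_def blinfun.sum_right blinfun.scaleR_right inner_sum_right assms)
    ultimately show ?thesis using LIMSEQ_unique[OF _ tendsto_const] by simp
  qed
  then have "range \<iota> \<subseteq> {x. h \<bullet> x = 0}" by auto
  then have "closure (range \<iota>) \<subseteq> {x. h \<bullet> x = 0}" by (rule closure_minimal) (rule closed_hyperplane)
  moreover have "closure (range \<iota>) = UNIV" using embedding by (simp add: dense_compact_embedding_def)
  ultimately have "h \<bullet> h = 0" by blast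
  then show ?thesis by simp
qed

end

text \<open>The dimension count behind the min-max principle: the \<open>i + 1\<close> vectors
  \<open>u 0, ..., u i\<close> span a nonzero vector orthogonal to the first \<open>i\<close>
  vectors \<open>u'\<close>. There \<open>rayleigh\<close> bounds \<open>a'\<close> from below,
  while the expansion in the \<open>u k\<close> bounds \<open>a\<close> from above.\<close>

lemma eigenvalue_perturbation:
  fixes \<iota> :: "'v::{real_inner, banach} \<Rightarrow>\<^sub>L 'h::{real_inner, banach}"
  assumes "coercive_eigensystem \<iota> a \<alpha> \<mu> u" "coercive_eigensystem \<iota> a' \<alpha>' \<mu>' u'"
    and le: "\<And>v. a' v v \<le> c * a v v" and "0 \<le> c"
  shows "\<mu>' i \<le> c * \<mu> i"
proof -
  interpret A: coercive_eigensystem \<iota> a \<alpha> \<mu> u by fact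
  interpret A': coercive_eigensystem \<iota> a' \<alpha>' \<mu>' u' by fact
  define f where "f x = (\<Sum>k<i. (\<iota> x \<bullet> \<iota> (u' k)) *\<^sub>R u' k)" for x
  have "linear f" unfolding f_def
    by (intro linearI) (simp_all add: blinfun.add_right blinfun.scaleR_right inner_add_left scaleR_add_left sum.distrib scaleR_sum_right)
  define g where "g c = (\<Sum>k<Suc i. c k *\<^sub>R u k)" for c :: "nat \<Rightarrow> real"
  \<comment> \<open>The kernel vector comes from a linear dependence of the images
    \<open>f (u k)\<close>. A dependence of a set does not see repetitions, so two equal images are
    treated separately.\<close>
  obtain d where d: "f (g d) = 0" "\<exists>k\<le>i. d k \<noteq> 0"
  proof (cases "inj_on (\<lambda>k. f (u k)) {..i}")
    case False
    then obtain k l where kl: "k \<le> i" "l \<le> i" "k \<noteq> l" "f (u k) = f (u l)" by (auto simp: inj_on_def)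
    define d where "d j = (if j = k then 1 else if j = l then - 1 else (0::real))" for j
    have "(\<Sum>j<Suc i. d j *\<^sub>R u j) = (\<Sum>j\<in>{k, l}. d j *\<^sub>R u j)"
      using kl by (intro sum.mono_neutral_right) (auto simp: d_def)
    also have "\<dots> = u k - u l" using kl(3) by (simp add: d_def)
    finally have "f (g d) = 0" using kl(4) by (simp add: g_def linear_diff[OF \<open>linear f\<close>])
    moreover have "d k \<noteq> 0" by (simp add: d_def)
    ultimately show thesis using that kl(1) by blast
  next
    case True
    have "dependent ((\<lambda>k. f (u k)) ` {..i})"
    proof (rule ccontr)
      assume "independent ((\<lambda>k. f (u k)) ` {..i})"
      moreover have "(\<lambda>k. f (u k)) ` {..i} \<subseteq> span (u' ` {..<i})"
        unfolding f_def by (intro image_subsetI span_sum span_scale span_base) auto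
      ultimately have "card ((\<lambda>k. f (u k)) ` {..i}) \<le> card (u' ` {..<i})"
        using independent_span_bound[of "u' ` {..<i}"] by auto
      also have "\<dots> \<le> i" using card_image_le[of "{..<i}" u'] by simp
      finally show False using card_image[OF True] by simp
    qed
    then obtain c where c: "\<exists>v\<in>(\<lambda>k. f (u k)) ` {..i}. c v \<noteq> 0"
      "(\<Sum>v\<in>(\<lambda>k. f (u k)) ` {..i}. c v *\<^sub>R v) = 0"
      using dependent_finite[of "(\<lambda>k. f (u k)) ` {..i}"] by auto
    have "f (g (\<lambda>k. c (f (u k)))) = (\<Sum>k<Suc i. c (f (u k)) *\<^sub>R f (u k))"
      by (simp only: g_def linear_sum[OF \<open>linear f\<close>] linear_scale[OF \<open>linear f\<close>])
    also have "\<dots> = 0" using c(2) sum.reindex[OF True, of "\<lambda>v. c v *\<^sub>R v"] by (simp add: o_def lessThan_Suc_atMost)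
    finally show thesis using that[of "\<lambda>k. c (f (u k))"] c(1) by auto
  qed
  have orth: "\<iota> (g d) \<bullet> \<iota> (u' k) = 0" if "k < i" for k
    using A'.iota_combination[of "\<lambda>k. \<iota> (g d) \<bullet> \<iota> (u' k)" i k] d(1) that by (simp add: f_def)
  have ig: "(norm (\<iota> (g d)))\<^sup>2 = (\<Sum>k<Suc i. d k * d k)"
    unfolding g_def power2_norm_eq_inner by (rule A.inner_combination)
  have ag: "a (g d) (g d) = (\<Sum>k<Suc i. \<mu> k * (d k * d k))"
    unfolding g_def by (rule A.form_combination)
  have "a (g d) (g d) \<le> \<mu> i * (norm (\<iota> (g d)))\<^sup>2"
    unfolding ag ig sum_distrib_left
    by (intro sum_mono mult_right_mono monoD[OF A.mono_eigenvalues]) auto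
  then have "\<mu>' i * (norm (\<iota> (g d)))\<^sup>2 \<le> c * (\<mu> i * (norm (\<iota> (g d)))\<^sup>2)"
    using A'.rayleigh[of i "g d", OF orth] le[of "g d"] \<open>0 \<le> c\<close> by (meson mult_left_mono order_trans)
  moreover have "0 < (norm (\<iota> (g d)))\<^sup>2"
  proof -
    obtain k where "k < Suc i" "d k \<noteq> 0" using d(2) by (auto simp: less_Suc_eq_le)
    then show ?thesis unfolding ig
      by (intro sum_pos2[of _ k]) (auto simp: zero_less_mult_iff)
  qed
  ultimately show ?thesis by (simp add: mult.assoc[symmetric])
qed

section \<open>Complexified operators of an affine family of forms\<close>

lemma cscale_bounded_linear: "bounded_linear (cscale c :: 'a::real_normed_vector \<times> 'a \<Rightarrow> _)"
  unfolding cscale_def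
  by (intro bounded_linear_Pair bounded_linear_sub bounded_linear_add bounded_linear_const_scaleR
      bounded_linear_fst bounded_linear_snd)

lemma cscale_add_right: "cscale c (x + y) = cscale c x + cscale c y"
  by (simp add: cscale_def algebra_simps)

lemma cscale_diff_right: "cscale c (x - y) = cscale c x - cscale c y"
  by (simp add: cscale_def algebra_simps)

lemma cscale_scaleR_right: "cscale c (r *\<^sub>R x) = r *\<^sub>R cscale c x"
  by (simp add: cscale_def algebra_simps)

lemma cscale_cscale: "cscale c (cscale d x) = cscale (c * d) x"
  by (simp add: cscale_def algebra_simps)

lemma cscale_one [simp]: "cscale 1 x = x"
  by (simp add: cscale_def)

lemma cscale_zero_left [simp]: "cscale 0 x = 0"
  by (simp add: cscale_def zero_prod_def)

lemma cscale_diff_left: "cscale (c - d) x = cscale c x - cscale d x"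
  by (simp add: cscale_def algebra_simps)

lemma cscale_of_real: "cscale (of_real r) x = r *\<^sub>R x"
  by (simp add: cscale_def scaleR_prod_def)

lemma norm_cscale:
  fixes x :: "'a::real_inner \<times> 'a"
  shows "norm (cscale c x) = cmod c * norm x"
proof -
  have "(norm (cscale c x))\<^sup>2 = (cmod c * norm x)\<^sup>2"
    by (simp add: power_mult_distrib cmod_power2 power2_norm_eq_inner cscale_def inner_prod_def
        inner_add_left inner_add_right inner_diff_left inner_diff_right inner_commute[of "snd x" "fst x"])
       (simp add: power2_eq_square algebra_simps)
  then show ?thesis by simp
qed

text \<open>The exact rule \<open>norm_cscale\<close> rests on an inner product. The dual of
  \<open>V\<close> carries only its operator norm here, and mixing the two components is estimated
  with a factor 2.\<close>

lemma norm_cscale_le: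
  fixes x :: "'a::real_normed_vector \<times> 'a"
  shows "norm (cscale c x) \<le> 2 * cmod c * norm x"
proof -
  have e: "cscale c x = Re c *\<^sub>R x + Im c *\<^sub>R (- snd x, fst x)"
    by (cases x) (simp add: cscale_def)
  have "norm (- snd x, fst x) = norm x" by (cases x) (simp add: norm_Pair add.commute)
  then have "norm (cscale c x) \<le> \<bar>Re c\<bar> * norm x + \<bar>Im c\<bar> * norm x"
    unfolding e by (metis norm_triangle_ineq norm_scaleR)
  also have "\<dots> \<le> cmod c * norm x + cmod c * norm x"
    by (intro add_mono mult_right_mono abs_Re_le_cmod abs_Im_le_cmod) auto
  finally show ?thesis by simp
qed

lemma cscale_map_prod:
  assumes "linear f"
  shows "cscale c (map_prod f f x) = map_prod f f (cscale c x)"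
  by (simp add: cscale_def linear_add[OF assms] linear_diff[OF assms] linear_scale[OF assms])

lemma cinner_bounded_linear_left: "bounded_linear (\<lambda>x. cinner x y)"
proof -
  have e: "cinner x y = of_real (fst x \<bullet> fst y + snd x \<bullet> snd y) + \<i> * of_real (snd x \<bullet> fst y - fst x \<bullet> snd y)" for x
    by (simp add: cinner_def complex_eq_iff)
  show ?thesis unfolding e
    by (intro bounded_linear_add bounded_linear_const_mult bounded_linear_compose[OF bounded_linear_of_real]
        bounded_linear_sub bounded_linear_inner_left_comp bounded_linear_fst bounded_linear_snd)
qed

lemma cinner_cscale_left: "cinner (cscale c x) y = c * cinner x y"
  by (simp add: cinner_def cscale_def complex_eq_iff inner_add_left inner_diff_left algebra_simps)

text \<open>The real part of the sesquilinear pairing. It loses nothing: replacing the test vector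
  by \<open>i\<close> times itself recovers the imaginary part.\<close>

definition dual_pairing :: "('v::real_normed_vector \<Rightarrow>\<^sub>L real) \<times> ('v \<Rightarrow>\<^sub>L real) \<Rightarrow> 'v \<times> 'v \<Rightarrow> real" where
  "dual_pairing f v = fst f (fst v) + snd f (snd v)"

lemma dual_pairing_bounded_linear: "bounded_linear (\<lambda>f. dual_pairing f v)"
  unfolding dual_pairing_def
  by (intro bounded_linear_add blinfun.bounded_linear_left[THEN bounded_linear_compose] bounded_linear_fst bounded_linear_snd)

lemma pair_cauchy_schwarz:
  "norm (fst x) * norm (fst y) + norm (snd x) * norm (snd y) \<le> norm x * norm y"
proof -
  have "(norm (fst x), norm (snd x)) \<bullet> (norm (fst y), norm (snd y))
      \<le> norm (norm (fst x), norm (snd x)) * norm (norm (fst y), norm (snd y))"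
    by (rule norm_cauchy_schwarz)
  then show ?thesis by (simp add: norm_Pair norm_prod_def)
qed

lemma dual_pairing_le: "\<bar>dual_pairing f v\<bar> \<le> norm f * norm v"
proof -
  have "\<bar>dual_pairing f v\<bar> \<le> \<bar>fst f (fst v)\<bar> + \<bar>snd f (snd v)\<bar>" by (simp add: dual_pairing_def)
  also have "\<dots> \<le> norm (fst f) * norm (fst v) + norm (snd f) * norm (snd v)"
    using norm_blinfun[of "fst f" "fst v"] norm_blinfun[of "snd f" "snd v"] by simp
  also have "\<dots> \<le> norm f * norm v" by (rule pair_cauchy_schwarz)
  finally show ?thesis .
qed

lemma form_op_apply:
  assumes "bounded_bilinear b"
  shows "form_op b v w = b v w" "bounded_linear (form_op b)"
proof -
  interpret bounded_bilinear b by fact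
  have e: "form_op b = Blinfun (\<lambda>u. Blinfun (b u))" by (simp add: form_op_def)
  have inner: "blinfun_apply (Blinfun (b v)) = b v" for v
    by (rule bounded_linear_Blinfun_apply[OF bounded_linear_right])
  have "bounded_linear (\<lambda>u. Blinfun (b u))"
  proof -
    obtain K where K: "\<And>x y. norm (b x y) \<le> norm x * norm y * K" "0 \<le> K" using nonneg_bounded by blast
    show ?thesis
    proof (rule bounded_linear_intro[where K = K])
      show "norm (Blinfun (b x)) \<le> norm x * K" for x
      proof (rule norm_blinfun_bound)
        show "norm (Blinfun (b x) y) \<le> norm x * K * norm y" for y
          using K(1)[of x y] by (simp add: inner mult_ac)
      qed (use K in simp)
    qed (auto intro!: blinfun_eqI simp: inner blinfun.add_left blinfun.scaleR_left add_left scaleR_left)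
  qed
  then have o: "blinfun_apply (form_op b) = (\<lambda>u. Blinfun (b u))"
    unfolding e by (rule bounded_linear_Blinfun_apply)
  show "form_op b v w = b v w" by (simp add: o inner)
  show "bounded_linear (form_op b)" by (rule blinfun.bounded_linear_right)
qed

lemma bounded_linear_map_prod:
  assumes "bounded_linear f" "bounded_linear g"
  shows "bounded_linear (map_prod f g)"
proof -
  have "map_prod f g = (\<lambda>x. (f (fst x), g (snd x)))" by auto
  then show ?thesis
    by (simp add: bounded_linear_Pair bounded_linear_compose[OF assms(1)] bounded_linear_compose[OF assms(2)]
        bounded_linear_fst bounded_linear_snd)
qed

lemma dual_embed_apply [simp]: "dual_embed \<iota> h v = h \<bullet> \<iota> v"
  by (simp add: dual_embed_def)

lemma dual_embed_bounded_linear: "bounded_linear (dual_embed \<iota>)"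
proof (rule bounded_linear_intro[where K = "norm \<iota>"])
  show "norm (dual_embed \<iota> h) \<le> norm h * norm \<iota>" for h
  proof (rule norm_blinfun_bound)
    fix v
    have "norm (h \<bullet> \<iota> v) \<le> norm h * norm (\<iota> v)" using Cauchy_Schwarz_ineq2[of h "\<iota> v"] by simp
    also have "\<dots> \<le> norm h * (norm \<iota> * norm v)" by (intro mult_left_mono norm_blinfun) auto
    finally show "norm (dual_embed \<iota> h v) \<le> norm h * norm \<iota> * norm v" by (simp add: mult_ac)
  qed simp
qed (auto intro!: blinfun_eqI simp: blinfun.add_left blinfun.scaleR_left inner_add_left)

locale affine_form =
  fixes \<iota> :: "'v::{real_inner, banach} \<Rightarrow>\<^sub>L 'h::{real_inner, banach}"
    and b0 :: "'v \<Rightarrow> 'v \<Rightarrow> real" and b :: "nat \<Rightarrow> 'v \<Rightarrow> 'v \<Rightarrow> real"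
    and \<alpha>\<^sub>0 :: real and \<kappa> :: "nat \<Rightarrow> real"
  assumes gelfand: "gelfand_triple \<iota>"
    and b0_bilinear: "bounded_bilinear b0" and b0_symmetric: "b0 v w = b0 w v"
    and b_bilinear: "bounded_bilinear (b m)" and b_symmetric: "b m v w = b m w v"
    and alpha0_pos: "0 < \<alpha>\<^sub>0" and b0_coercive: "\<alpha>\<^sub>0 * (norm v)\<^sup>2 \<le> b0 v v"
    and kappa_pos: "0 < \<kappa> m" and kappa_summable: "summable \<kappa>" and kappa_less: "(\<Sum>m. \<kappa> m) < 1"
    and b_bound: "\<bar>b m v w\<bar> \<le> \<kappa> m * \<alpha>\<^sub>0 * norm v * norm w"
begin

section \<open>Weighted control of the perturbation series\<close>

definition K where "K = (\<Sum>m. \<kappa> m)"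
text \<open>A coercivity constant valid for all real parameters in the box
  (\<open>param_form_coercive\<close>).\<close>

definition \<alpha> where "\<alpha> = \<alpha>\<^sub>0 * (1 - K)"

lemma K_bounds: "0 \<le> K" "K < 1"
  unfolding K_def using suminf_nonneg[OF kappa_summable less_imp_le[OF kappa_pos]] kappa_less by auto

lemma alpha_pos: "0 < \<alpha>"
  using K_bounds alpha0_pos by (simp add: \<alpha>_def)

text \<open>The weighted l1 space of parameters on which the operator series converges absolutely.
  The summability is kept as a separate predicate because the infinite sum in \<open>weight\<close>
  means nothing without it.\<close>

definition admissible :: "(nat \<Rightarrow> complex) \<Rightarrow> bool" where
  "admissible w \<longleftrightarrow> summable (\<lambda>m. \<kappa> m * cmod (w m))"

definition weight :: "(nat \<Rightarrow> complex) \<Rightarrow> real" where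
  "weight w = (\<Sum>m. \<kappa> m * cmod (w m))"

definition pert :: "(nat \<Rightarrow> complex) \<Rightarrow> 'v \<times> 'v \<Rightarrow> ('v \<Rightarrow>\<^sub>L real) \<times> ('v \<Rightarrow>\<^sub>L real)" where
  "pert w x = (\<Sum>m. cscale (w m) (map_prod (form_op (b m)) (form_op (b m)) x))"

lemma weight_nonneg: "admissible w \<Longrightarrow> 0 \<le> weight w"
  unfolding weight_def admissible_def using kappa_pos by (intro suminf_nonneg) (auto simp: less_imp_le)

lemma admissible_diff: "admissible z \<Longrightarrow> admissible w \<Longrightarrow> admissible (\<lambda>m. z m - w m)"
  unfolding admissible_def
proof (rule summable_comparison_test)
  assume "summable (\<lambda>m. \<kappa> m * cmod (z m))" "summable (\<lambda>m. \<kappa> m * cmod (w m))"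
  then show "summable (\<lambda>m. \<kappa> m * cmod (z m) + \<kappa> m * cmod (w m))" by (rule summable_add)
  have "norm (\<kappa> m * cmod (z m - w m)) \<le> \<kappa> m * cmod (z m) + \<kappa> m * cmod (w m)" for m
    using mult_left_mono[OF norm_triangle_ineq4[of "z m" "w m"], of "\<kappa> m"] kappa_pos[of m] by (simp add: distrib_left abs_mult)
  then show "\<exists>N. \<forall>m\<ge>N. norm (\<kappa> m * cmod (z m - w m)) \<le> \<kappa> m * cmod (z m) + \<kappa> m * cmod (w m)" by blast
qed

lemma admissible_scale: "admissible w \<Longrightarrow> admissible (\<lambda>m. c * w m)"
  unfolding admissible_def using summable_mult[of "\<lambda>m. \<kappa> m * cmod (w m)" "cmod c"]
  by (simp add: norm_mult mult_ac)

lemma weight_triangle: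
  assumes "admissible (\<lambda>m. z m - x m)" "admissible (\<lambda>m. x m - y m)"
  shows "weight (\<lambda>m. z m - y m) \<le> weight (\<lambda>m. z m - x m) + weight (\<lambda>m. x m - y m)"
proof -
  have "admissible (\<lambda>m. (z m - x m) - - 1 * (x m - y m))"
    by (intro admissible_diff assms(1) admissible_scale[OF assms(2)])
  then have "admissible (\<lambda>m. z m - y m)" by simp
  have "cmod (z m - y m) \<le> cmod (z m - x m) + cmod (x m - y m)" for m
    by (rule norm_diff_triangle_le) auto
  then have "\<kappa> m * cmod (z m - y m) \<le> \<kappa> m * cmod (z m - x m) + \<kappa> m * cmod (x m - y m)" for m
    unfolding distrib_left[symmetric] by (intro mult_left_mono less_imp_le[OF kappa_pos])
  with \<open>admissible (\<lambda>m. z m - y m)\<close> show ?thesis using assms unfolding weight_def admissible_def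
    by (subst suminf_add) (auto intro!: suminf_le summable_add)
qed

text \<open>The scalar is moved onto \<open>x\<close>, where the pair norm is a Hilbert norm and
  scaling costs exactly \<open>cmod c\<close>. This exact constant enters the radii through
  \<open>S_lower_bound\<close>; the factor 2 of \<open>pert_norm_le\<close> enters only local
  estimates.\<close>

lemma form_op_pair_le:
  "\<bar>dual_pairing (cscale c (map_prod (form_op (b m)) (form_op (b m)) x)) v\<bar>
     \<le> \<alpha>\<^sub>0 * (\<kappa> m * cmod c) * norm x * norm v"
proof -
  define x' where "x' = cscale c x"
  have "\<bar>dual_pairing (cscale c (map_prod (form_op (b m)) (form_op (b m)) x)) v\<bar>
      = \<bar>b m (fst x') (fst v) + b m (snd x') (snd v)\<bar>"
    by (simp add: cscale_map_prod[OF bounded_linear.linear[OF blinfun.bounded_linear_right]] x'_def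
        dual_pairing_def form_op_apply(1)[OF b_bilinear])
  also have "\<dots> \<le> \<kappa> m * \<alpha>\<^sub>0 * (norm (fst x') * norm (fst v)) + \<kappa> m * \<alpha>\<^sub>0 * (norm (snd x') * norm (snd v))"
    using b_bound[of m "fst x'" "fst v"] b_bound[of m "snd x'" "snd v"] by (simp add: mult.assoc)
  also have "\<dots> = \<kappa> m * \<alpha>\<^sub>0 * (norm (fst x') * norm (fst v) + norm (snd x') * norm (snd v))"
    by (simp add: distrib_left)
  also have "\<dots> \<le> \<kappa> m * \<alpha>\<^sub>0 * (norm x' * norm v)"
    using kappa_pos[of m] alpha0_pos by (intro mult_left_mono pair_cauchy_schwarz) auto
  finally show ?thesis by (simp add: x'_def norm_cscale mult_ac)
qed

lemma form_op_norm_le: "norm (map_prod (form_op (b m)) (form_op (b m)) x) \<le> \<alpha>\<^sub>0 * \<kappa> m * norm x"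
proof -
  have 1: "norm (form_op (b m) v) \<le> \<alpha>\<^sub>0 * \<kappa> m * norm v" for v
    by (rule norm_blinfun_bound)
      (use b_bound[of m v] kappa_pos[of m] alpha0_pos in \<open>auto simp: form_op_apply(1)[OF b_bilinear] mult_ac less_imp_le\<close>)
  have "norm (map_prod (form_op (b m)) (form_op (b m)) x)
      = sqrt ((norm (form_op (b m) (fst x)))\<^sup>2 + (norm (form_op (b m) (snd x)))\<^sup>2)"
    by (cases x) (simp add: norm_Pair)
  also have "\<dots> \<le> sqrt ((\<alpha>\<^sub>0 * \<kappa> m * norm (fst x))\<^sup>2 + (\<alpha>\<^sub>0 * \<kappa> m * norm (snd x))\<^sup>2)"
    by (intro real_sqrt_le_mono add_mono power_mono 1) auto
  also have "\<dots> = \<alpha>\<^sub>0 * \<kappa> m * norm x"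
    using alpha0_pos kappa_pos[of m]
    by (simp add: norm_prod_def power_mult_distrib distrib_left[symmetric] real_sqrt_mult)
  finally show ?thesis .
qed

lemma pert_term_norm_le:
  "norm (cscale c (map_prod (form_op (b m)) (form_op (b m)) x)) \<le> 2 * \<alpha>\<^sub>0 * norm x * (\<kappa> m * cmod c)"
proof -
  have "norm (cscale c (map_prod (form_op (b m)) (form_op (b m)) x))
      \<le> 2 * cmod c * (\<alpha>\<^sub>0 * \<kappa> m * norm x)"
    by (rule order_trans[OF norm_cscale_le]) (intro mult_left_mono form_op_norm_le; simp)
  then show ?thesis by (simp add: mult_ac)
qed

lemma pert_summable_norm:
  assumes "admissible w"
  shows "summable (\<lambda>m. norm (cscale (w m) (map_prod (form_op (b m)) (form_op (b m)) x)))"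
proof (rule summable_comparison_test)
  show "summable (\<lambda>m. 2 * \<alpha>\<^sub>0 * norm x * (\<kappa> m * cmod (w m)))"
    using assms unfolding admissible_def by (rule summable_mult)
  show "\<exists>N. \<forall>m\<ge>N. norm (norm (cscale (w m) (map_prod (form_op (b m)) (form_op (b m)) x)))
      \<le> 2 * \<alpha>\<^sub>0 * norm x * (\<kappa> m * cmod (w m))"
    using pert_term_norm_le by auto
qed

lemma pert_summable: "admissible w \<Longrightarrow> summable (\<lambda>m. cscale (w m) (map_prod (form_op (b m)) (form_op (b m)) x))"
  by (rule summable_norm_cancel) (rule pert_summable_norm)

lemma pert_norm_le:
  assumes "admissible w"
  shows "norm (pert w x) \<le> 2 * \<alpha>\<^sub>0 * weight w * norm x"
proof -
  have "norm (pert w x) \<le> (\<Sum>m. norm (cscale (w m) (map_prod (form_op (b m)) (form_op (b m)) x)))"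
    unfolding pert_def by (rule summable_norm) (rule pert_summable_norm[OF assms])
  also have "\<dots> \<le> (\<Sum>m. 2 * \<alpha>\<^sub>0 * norm x * (\<kappa> m * cmod (w m)))"
    using assms by (intro suminf_le pert_term_norm_le pert_summable_norm summable_mult) (auto simp: admissible_def)
  also have "\<dots> = 2 * \<alpha>\<^sub>0 * norm x * weight w"
    unfolding weight_def using assms by (intro suminf_mult) (simp add: admissible_def)
  finally show ?thesis by (simp add: mult_ac)
qed

lemma pert_bounded_linear:
  assumes "admissible w"
  shows "bounded_linear (pert w)"
proof (rule bounded_linear_intro[where K = "2 * \<alpha>\<^sub>0 * weight w"])
  let ?M = "\<lambda>m. map_prod (form_op (b m)) (form_op (b m))"
  have lin: "linear (?M m)" for m
    by (intro bounded_linear.linear bounded_linear_map_prod blinfun.bounded_linear_right)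
  show "pert w (x + y) = pert w x + pert w y" for x y
    unfolding pert_def linear_add[OF lin] cscale_add_right
    by (rule suminf_add[symmetric]) (intro pert_summable assms)+
  show "pert w (r *\<^sub>R x) = r *\<^sub>R pert w x" for r x
    unfolding pert_def linear_scale[OF lin] cscale_scaleR_right
    by (rule suminf_scaleR_right[symmetric]) (intro pert_summable assms)
  show "norm (pert w x) \<le> norm x * (2 * \<alpha>\<^sub>0 * weight w)" for x
    using pert_norm_le[OF assms, of x] by (simp add: mult_ac)
qed

lemma pert_pair_le:
  assumes "admissible w"
  shows "\<bar>dual_pairing (pert w x) v\<bar> \<le> \<alpha>\<^sub>0 * weight w * norm x * norm v"
proof -
  let ?t = "\<lambda>m. dual_pairing (cscale (w m) (map_prod (form_op (b m)) (form_op (b m)) x)) v"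
  have "dual_pairing (pert w x) v = (\<Sum>m. ?t m)"
    unfolding pert_def by (rule bounded_linear.suminf[OF dual_pairing_bounded_linear pert_summable[OF assms]])
  moreover have sm: "summable (\<lambda>m. \<alpha>\<^sub>0 * norm x * norm v * (\<kappa> m * cmod (w m)))"
    using assms unfolding admissible_def by (rule summable_mult)
  moreover have le: "norm (?t m) \<le> \<alpha>\<^sub>0 * norm x * norm v * (\<kappa> m * cmod (w m))" for m
    using form_op_pair_le[of "w m" m x v] by (simp add: mult_ac)
  ultimately have "\<bar>dual_pairing (pert w x) v\<bar> \<le> (\<Sum>m. \<alpha>\<^sub>0 * norm x * norm v * (\<kappa> m * cmod (w m)))"
    using norm_suminf_le[OF le sm] by simp
  also have "\<dots> = \<alpha>\<^sub>0 * norm x * norm v * weight w"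
    unfolding weight_def using assms by (intro suminf_mult) (simp add: admissible_def)
  finally show ?thesis by (simp add: mult_ac)
qed

lemma pert_diff:
  assumes "admissible z" "admissible w"
  shows "pert (\<lambda>m. z m - w m) x = pert z x - pert w x"
  unfolding pert_def cscale_diff_left
  by (rule suminf_diff[symmetric]) (intro pert_summable assms)+

lemma param_op_eq: "param_op b0 b z x = map_prod (form_op b0) (form_op b0) x + pert z x"
  by (simp add: param_op_def pert_def)

section \<open>The shifted operators from \<open>V\<close> to its dual\<close>

definition embed2 :: "'v \<times> 'v \<Rightarrow> ('v \<Rightarrow>\<^sub>L real) \<times> ('v \<Rightarrow>\<^sub>L real)" where
  "embed2 = map_prod (\<lambda>x. dual_embed \<iota> (\<iota> x)) (\<lambda>x. dual_embed \<iota> (\<iota> x))"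

definition S :: "(nat \<Rightarrow> complex) \<Rightarrow> complex \<Rightarrow> 'v \<times> 'v \<Rightarrow> ('v \<Rightarrow>\<^sub>L real) \<times> ('v \<Rightarrow>\<^sub>L real)" where
  "S z \<omega> = shifted_op \<iota> (param_op b0 b z) \<omega>"

lemma embed2_bounded_linear: "bounded_linear embed2"
  unfolding embed2_def
  by (intro bounded_linear_map_prod bounded_linear_compose[OF dual_embed_bounded_linear] blinfun.bounded_linear_right)

lemma S_eq: "S z \<omega> x = cscale \<omega> (embed2 x) - (map_prod (form_op b0) (form_op b0) x + pert z x)"
  by (simp add: S_def shifted_op_def embed2_def param_op_eq)

lemma S_bounded_linear:
  assumes "admissible z"
  shows "bounded_linear (S z \<omega>)"
  unfolding S_eq[abs_def]
  by (intro bounded_linear_sub bounded_linear_add bounded_linear_compose[OF cscale_bounded_linear embed2_bounded_linear]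
      bounded_linear_map_prod blinfun.bounded_linear_right pert_bounded_linear assms)

lemma S_diff:
  assumes "admissible z" "admissible z'"
  shows "S z \<omega> x - S z' \<omega>' x = cscale (\<omega> - \<omega>') (embed2 x) - pert (\<lambda>m. z m - z' m) x"
  by (simp add: S_eq pert_diff[OF assms] cscale_diff_left)

text \<open>Compactness is contributed by the factor from \<open>V\<close> to \<open>H\<close>, one
  component at a time; the factor from \<open>H\<close> to the dual is used only as a continuous
  map.\<close>

lemma embed2_compact:
  assumes "bounded (X :: ('v \<times> 'v) set)"
  shows "compact (closure (embed2 ` X))"
proof -
  define f where "f x = dual_embed \<iota> (\<iota> x)" for x
  have "compact (closure (\<iota> ` Y))" if "bounded Y" for Y
    using gelfand that by (auto simp: gelfand_triple_def dense_compact_embedding_def)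
  then have c: "compact (dual_embed \<iota> ` closure (\<iota> ` Y))" if "bounded Y" for Y
    using that compact_continuous_image[OF linear_continuous_on[OF dual_embed_bounded_linear]] by blast
  let ?C = "(dual_embed \<iota> ` closure (\<iota> ` fst ` X)) \<times> (dual_embed \<iota> ` closure (\<iota> ` snd ` X))"
  have "compact ?C" using assms by (intro compact_Times c bounded_fst bounded_snd)
  moreover have "embed2 ` X \<subseteq> ?C"
    unfolding embed2_def by (auto intro!: imageI subsetD[OF closure_subset]) force+
  moreover from this have "closure (embed2 ` X) \<subseteq> ?C"
    using \<open>compact ?C\<close> by (intro closure_minimal compact_imp_closed)
  ultimately show ?thesis using compact_Int_closed[of ?C "closure (embed2 ` X)"]
    by (simp add: Int_absorb1)
qed

section \<open>Real parameters in the box\<close>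

lemma param_box_admissible:
  assumes "y \<in> param_box"
  shows "admissible (\<lambda>m. of_real (y m))"
  unfolding admissible_def
proof (rule summable_comparison_test[OF _ kappa_summable])
  have "norm (\<kappa> m * cmod (of_real (y m))) \<le> \<kappa> m" for m
  proof -
    have "\<bar>y m\<bar> \<le> 1" using assms by (auto simp: param_box_def abs_le_iff)
    then show ?thesis using mult_left_mono[of "\<bar>y m\<bar>" 1 "\<kappa> m"] kappa_pos[of m] by (simp add: abs_mult)
  qed
  then show "\<exists>N. \<forall>m\<ge>N. norm (\<kappa> m * cmod (of_real (y m))) \<le> \<kappa> m" by blast
qed

lemma param_form_sum_norm_le:
  assumes "admissible (\<lambda>m. of_real (y m))"
  shows "summable (\<lambda>m. y m * b m v w)"
    "\<bar>\<Sum>m. y m * b m v w\<bar> \<le> \<alpha>\<^sub>0 * weight (\<lambda>m. of_real (y m)) * norm v * norm w"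
proof -
  have le: "norm (y m * b m v w) \<le> \<alpha>\<^sub>0 * norm v * norm w * (\<kappa> m * cmod (of_real (y m)))" for m
    using mult_left_mono[OF b_bound[of m v w], of "\<bar>y m\<bar>"] by (simp add: abs_mult mult_ac)
  have sm: "summable (\<lambda>m. \<alpha>\<^sub>0 * norm v * norm w * (\<kappa> m * cmod (of_real (y m))))"
    using assms unfolding admissible_def by (rule summable_mult)
  show s: "summable (\<lambda>m. y m * b m v w)"
    by (rule summable_comparison_test[OF _ sm]) (use le in blast)
  have "\<bar>\<Sum>m. y m * b m v w\<bar> \<le> (\<Sum>m. \<alpha>\<^sub>0 * norm v * norm w * (\<kappa> m * cmod (of_real (y m))))"
    using norm_suminf_le[OF le sm] by simp
  also have "\<dots> = \<alpha>\<^sub>0 * norm v * norm w * weight (\<lambda>m. of_real (y m))"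
    unfolding weight_def using assms by (intro suminf_mult) (simp add: admissible_def)
  finally show "\<bar>\<Sum>m. y m * b m v w\<bar> \<le> \<alpha>\<^sub>0 * weight (\<lambda>m. of_real (y m)) * norm v * norm w" by (simp add: mult_ac)
qed

lemma pert_real:
  assumes "admissible (\<lambda>m. of_real (y m))"
  shows "dual_pairing (pert (\<lambda>m. of_real (y m)) x) v
    = (\<Sum>m. y m * b m (fst x) (fst v)) + (\<Sum>m. y m * b m (snd x) (snd v))"
proof -
  have "dual_pairing (pert (\<lambda>m. of_real (y m)) x) v
      = (\<Sum>m. dual_pairing (cscale (of_real (y m)) (map_prod (form_op (b m)) (form_op (b m)) x)) v)"
    unfolding pert_def by (rule bounded_linear.suminf[OF dual_pairing_bounded_linear pert_summable[OF assms]])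
  also have "\<dots> = (\<Sum>m. y m * b m (fst x) (fst v) + y m * b m (snd x) (snd v))"
    by (simp add: cscale_of_real dual_pairing_def form_op_apply(1)[OF b_bilinear] blinfun.scaleR_left)
  finally show ?thesis using suminf_add[OF param_form_sum_norm_le(1)[OF assms] param_form_sum_norm_le(1)[OF assms]] by simp
qed

text \<open>The real part of \<open>\<omega> (x, v) - b(y; x, v)\<close>. At a real parameter the
  form has real coefficients, so the two components are coupled through \<open>Im \<omega>\<close>
  alone.\<close>

lemma S_real_pairing:
  assumes "admissible (\<lambda>m. of_real (y m))"
  shows "dual_pairing (S (\<lambda>m. of_real (y m)) \<omega> x) v =
    Re \<omega> * (\<iota> (fst x) \<bullet> \<iota> (fst v) + \<iota> (snd x) \<bullet> \<iota> (snd v))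
    + Im \<omega> * (\<iota> (fst x) \<bullet> \<iota> (snd v) - \<iota> (snd x) \<bullet> \<iota> (fst v))
    - param_form b0 b y (fst x) (fst v) - param_form b0 b y (snd x) (snd v)"
proof -
  note bl = dual_pairing_bounded_linear[of v, THEN bounded_linear.linear]
  show ?thesis unfolding S_eq linear_diff[OF bl] linear_add[OF bl] pert_real[OF assms]
    by (simp add: dual_pairing_def cscale_def embed2_def param_form_def form_op_apply(1)[OF b0_bilinear]
        blinfun.diff_left blinfun.add_left blinfun.scaleR_left algebra_simps)
qed

lemma param_form_bilinear:
  assumes "y \<in> param_box"
  shows "bounded_bilinear (param_form b0 b y)"
proof -
  interpret b0: bounded_bilinear b0 by (rule b0_bilinear)
  interpret b: bounded_bilinear "b m" for m by (rule b_bilinear)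
  note adm = param_box_admissible[OF assms]
  note sm = param_form_sum_norm_le(1)[OF adm]
  show ?thesis
  proof
    fix v v' w w' :: 'v and r :: real
    show "param_form b0 b y (v + v') w = param_form b0 b y v w + param_form b0 b y v' w"
      using suminf_add[OF sm[of v w] sm[of v' w]]
      by (simp add: param_form_def b0.add_left b.add_left distrib_left)
    show "param_form b0 b y v (w + w') = param_form b0 b y v w + param_form b0 b y v w'"
      using suminf_add[OF sm[of v w] sm[of v w']]
      by (simp add: param_form_def b0.add_right b.add_right distrib_left)
    show "param_form b0 b y (r *\<^sub>R v) w = r *\<^sub>R param_form b0 b y v w"
      using suminf_mult[OF sm[of v w], of r]
      by (simp add: param_form_def b0.scaleR_left b.scaleR_left distrib_left mult_ac)
    show "param_form b0 b y v (r *\<^sub>R w) = r *\<^sub>R param_form b0 b y v w"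
      using suminf_mult[OF sm[of v w], of r]
      by (simp add: param_form_def b0.scaleR_right b.scaleR_right distrib_left mult_ac)
  next
    obtain C where C: "\<And>v w. norm (b0 v w) \<le> norm v * norm w * C" using b0.bounded by blast
    have "norm (param_form b0 b y v w) \<le> norm v * norm w * (C + \<alpha>\<^sub>0 * weight (\<lambda>m. of_real (y m)))" for v w
      using C[of v w] param_form_sum_norm_le(2)[OF adm, of v w]
      by (simp add: param_form_def algebra_simps)
    then show "\<exists>C. \<forall>v w. norm (param_form b0 b y v w) \<le> norm v * norm w * C" by blast
  qed
qed

lemma param_form_diff:
  assumes "y \<in> param_box" "y' \<in> param_box"
  shows "\<bar>param_form b0 b y v v - param_form b0 b y' v v\<bar>
    \<le> \<alpha>\<^sub>0 * weight (\<lambda>m. of_real (y m) - of_real (y' m)) * (norm v)\<^sup>2"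
proof -
  note adm = param_box_admissible[OF assms(1)] param_box_admissible[OF assms(2)]
  have "param_form b0 b y v v - param_form b0 b y' v v = (\<Sum>m. (y m - y' m) * b m v v)"
    using suminf_diff[OF param_form_sum_norm_le(1)[OF adm(1)] param_form_sum_norm_le(1)[OF adm(2)], of v v v v]
    by (simp add: param_form_def left_diff_distrib)
  then show ?thesis using param_form_sum_norm_le(2)[of "\<lambda>m. y m - y' m" v v] admissible_diff[OF adm]
    by (simp add: power2_eq_square mult.assoc)
qed

lemma param_form_coercive:
  assumes "y \<in> param_box"
  shows "\<alpha> * (norm v)\<^sup>2 \<le> param_form b0 b y v v"
proof -
  note adm = param_box_admissible[OF assms]
  have "weight (\<lambda>m. of_real (y m)) \<le> K"
    unfolding weight_def K_def
  proof (rule suminf_le)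
    show "\<kappa> m * cmod (of_real (y m)) \<le> \<kappa> m" for m
    proof -
      have "\<bar>y m\<bar> \<le> 1" using assms by (auto simp: param_box_def abs_le_iff)
      then show ?thesis using mult_left_mono[of "\<bar>y m\<bar>" 1 "\<kappa> m"] kappa_pos[of m] by simp
    qed
  qed (use adm kappa_summable in \<open>auto simp: admissible_def\<close>)
  then have "\<alpha>\<^sub>0 * weight (\<lambda>m. of_real (y m)) * (norm v)\<^sup>2 \<le> \<alpha>\<^sub>0 * K * (norm v)\<^sup>2"
    using alpha0_pos by (intro mult_right_mono mult_left_mono) auto
  moreover have "\<bar>\<Sum>m. y m * b m v v\<bar> \<le> \<alpha>\<^sub>0 * weight (\<lambda>m. of_real (y m)) * (norm v)\<^sup>2"
    using param_form_sum_norm_le(2)[OF adm, of v v] by (simp add: power2_eq_square mult.assoc)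
  ultimately show ?thesis using b0_coercive[of v]
    by (simp add: param_form_def \<alpha>_def algebra_simps)
qed

end

section \<open>Resolvents of the perturbed operators\<close>

lemma dual_pairing_ext: "(\<And>v. dual_pairing f v = dual_pairing g v) \<Longrightarrow> f = g"
proof -
  assume h: "\<And>v. dual_pairing f v = dual_pairing g v"
  have "fst f v = fst g v" "snd f v = snd g v" for v
    using h[of "(v, 0)"] h[of "(0, v)"] by (auto simp: dual_pairing_def)
  then show "f = g" by (auto intro!: prod_eqI blinfun_eqI)
qed

text \<open>The resolvent identity \<open>inv A' - inv A = inv A' (A - A') inv A\<close>. Applying
  the first bound to the vector \<open>(A - A') (inv A f)\<close> gives the second, whose remainder
  is quadratic in \<open>d\<close>.\<close>

lemma inverse_expansion:
  fixes A A' :: "'a::real_normed_vector \<Rightarrow> 'b::real_normed_vector"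
  assumes A: "bounded_linear A" "surj A" and A': "bounded_linear A'" "surj A'" and "0 < c"
    and below: "\<And>x. c * norm x \<le> norm (A x)" and below': "\<And>x. c * norm x \<le> norm (A' x)"
    and diff: "\<And>x. norm (A x - A' x) \<le> d * norm x"
  shows "norm (inv A' f - inv A f) \<le> d / c\<^sup>2 * norm f"
    "norm (inv A' f - inv A f - inv A (A (inv A f) - A' (inv A f))) \<le> d\<^sup>2 / c ^ 3 * norm f"
proof -
  note B = bounded_below_bij[OF A(1) \<open>0 < c\<close> below A(2)]
  note B' = bounded_below_bij[OF A'(1) \<open>0 < c\<close> below' A'(2)]
  have AI: "A (inv A y) = y" "A' (inv A' y) = y" for y
    using A(2) A'(2) by (simp_all add: surj_f_inv_f)
  have IA: "inv A' (A' x) = x" for x using B'(1) by (simp add: bij_is_inj inv_f_f)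
  note lin' = bounded_linear.linear[OF B'(2)]
  have d: "0 \<le> d * norm x" for x :: 'a using diff[of x] norm_ge_zero order_trans by blast
  have id: "inv A' y - inv A y = inv A' (A (inv A y) - A' (inv A y))" for y
    by (simp add: linear_diff[OF lin'] IA AI)
  \<comment> \<open>The sign of \<open>d\<close> can be inferred only from a nonzero vector, hence
    the case distinction.\<close>
  have dA: "norm (A (inv A y) - A' (inv A y)) \<le> d / c * norm y" for y
  proof (cases "inv A y = 0")
    case True
    then have "y = 0" using AI(1)[of y] bounded_linear.linear[OF A(1)] by (metis linear_0)
    then show ?thesis using True linear_0[OF bounded_linear.linear[OF A(1)]] linear_0[OF bounded_linear.linear[OF A'(1)]] by simp
  next
    case False
    then have "0 \<le> d" using d[of "inv A y"] by (simp add: zero_le_mult_iff)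
    have "norm (A (inv A y) - A' (inv A y)) \<le> d * norm (inv A y)" by (rule diff)
    also have "\<dots> \<le> d * (norm y / c)" using B(3) \<open>0 \<le> d\<close> by (rule mult_left_mono)
    finally show ?thesis by simp
  qed
  have step: "norm (inv A' y - inv A y) \<le> d / c\<^sup>2 * norm y" for y
  proof -
    have "norm (inv A' y - inv A y) \<le> norm (A (inv A y) - A' (inv A y)) / c" unfolding id by (rule B'(3))
    also have "\<dots> \<le> d / c * norm y / c" using dA \<open>0 < c\<close> by (intro divide_right_mono) auto
    finally show ?thesis by (simp add: power2_eq_square)
  qed
  then show "norm (inv A' f - inv A f) \<le> d / c\<^sup>2 * norm f" .
  show "norm (inv A' f - inv A f - inv A (A (inv A f) - A' (inv A f))) \<le> d\<^sup>2 / c ^ 3 * norm f"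
  proof (cases "f = 0")
    case True
    then show ?thesis using linear_0 bounded_linear.linear A(1) A'(1) B(2) B'(2) by (metis (no_types, lifting) diff_self norm_zero mult_zero_right order_refl)
  next
    case False
    then have "inv A f \<noteq> 0" using AI(1)[of f] linear_0[OF bounded_linear.linear[OF A(1)]] by auto
    then have "0 \<le> d" using d[of "inv A f"] by (simp add: zero_le_mult_iff)
    have "norm (inv A' f - inv A f - inv A (A (inv A f) - A' (inv A f)))
        \<le> d / c\<^sup>2 * norm (A (inv A f) - A' (inv A f))"
      unfolding id[of f] by (rule step)
    also have "\<dots> \<le> d / c\<^sup>2 * (d / c * norm f)"
      using \<open>0 \<le> d\<close> by (intro mult_left_mono dA) auto
    finally show ?thesis by (simp add: power2_eq_square power3_eq_cube)
  qed
qed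

lemma compact_closure_image:
  fixes g :: "'a::metric_space \<Rightarrow> 'b::metric_space"
  assumes "compact (closure Y)" "continuous_on UNIV g"
  shows "compact (closure (g ` Y))"
proof -
  have c: "compact (g ` closure Y)"
    using assms compact_continuous_image continuous_on_subset by blast
  moreover have "closure (g ` Y) \<subseteq> g ` closure Y"
    by (intro closure_minimal compact_imp_closed[OF c] image_mono closure_subset)
  ultimately show ?thesis using compact_Int_closed[of "g ` closure Y" "closure (g ` Y)"] by (simp add: Int_absorb1)
qed

lemma has_field_derivative_if_quadratic_remainder:
  fixes f :: "complex \<Rightarrow> complex"
  assumes "0 < r" "\<And>w. cmod (w - z) < r \<Longrightarrow> cmod (f w - f z - D * (w - z)) \<le> C * (cmod (w - z))\<^sup>2"
  shows "(f has_field_derivative D) (at z)"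
proof -
  have "((\<lambda>w. (f w - f z) / (w - z) - D) \<longlongrightarrow> 0) (at z)"
  proof (rule Lim_null_comparison)
    show "\<forall>\<^sub>F w in at z. norm ((f w - f z) / (w - z) - D) \<le> C * cmod (w - z)"
      unfolding eventually_at
    proof (intro exI[of _ r] conjI ballI impI)
      fix w assume w: "w \<noteq> z \<and> dist w z < r"
      have "norm ((f w - f z) / (w - z) - D) = cmod (f w - f z - D * (w - z)) / cmod (w - z)"
        using w by (simp add: norm_divide[symmetric] diff_divide_distrib)
      also have "\<dots> \<le> C * (cmod (w - z))\<^sup>2 / cmod (w - z)"
        using assms(2)[of w] w by (intro divide_right_mono) (auto simp: dist_norm)
      finally show "norm ((f w - f z) / (w - z) - D) \<le> C * cmod (w - z)"
        using w by (simp add: power2_eq_square)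
    qed fact
    have "((\<lambda>w. C * cmod (w - z)) \<longlongrightarrow> C * cmod (z - z)) (at z)"
      by (intro tendsto_intros)
    then show "((\<lambda>w. C * cmod (w - z)) \<longlongrightarrow> 0) (at z)" by simp
  qed
  then show ?thesis unfolding has_field_derivative_iff by (simp add: LIM_zero_iff)
qed

section \<open>Lower bounds and surjectivity away from the eigenvalues\<close>

context affine_form
begin

lemma eigensystem:
  assumes "y \<in> param_box" "eigen_enumeration \<iota> (param_form b0 b y) \<mu> u"
  shows "coercive_eigensystem \<iota> (param_form b0 b y) \<alpha> \<mu> u"
proof (rule coercive_eigensystem.intro)
  show "dense_compact_embedding (blinfun_apply \<iota>)" using gelfand by (simp add: gelfand_triple_def)
  show "bounded_bilinear (param_form b0 b y)" by (rule param_form_bilinear[OF assms(1)])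
  show "param_form b0 b y v w = param_form b0 b y w v" for v w
    by (simp add: param_form_def b0_symmetric[of v w] b_symmetric[of _ v w])
qed (use assms param_form_coercive alpha_pos in auto)

text \<open>Turning the coefficients of \<open>x\<close> by unimodular factors leaves the energy
  unchanged, \<open>Q v = Q x\<close>, so coercivity and the arithmetic-geometric mean give
  \<open>\<alpha> * (norm x * norm v) \<le> Q x\<close>. Hence the perturbation contributes at most
  \<open>\<theta> * Q x\<close> to the pairing, against at least \<open>\<eta> * Q x\<close> from
  the unperturbed operator, and cancelling \<open>norm v\<close> gives the bound.\<close>

lemma S_lower_bound:
  assumes y: "y \<in> param_box" "eigen_enumeration \<iota> (param_form b0 b y) \<mu> u"
    and z: "admissible z" "weight (\<lambda>m. z m - of_real (y m)) \<le> \<theta> * (1 - K)"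
    and sep: "0 < \<eta>" "\<And>k. \<eta> * \<mu> k \<le> cmod (\<omega> - of_real (\<mu> k))"
  shows "(\<eta> - \<theta>) * \<alpha> * norm x \<le> norm (S z \<omega> x)"
proof -
  interpret E: coercive_eigensystem \<iota> "param_form b0 b y" \<alpha> \<mu> u by (rule eigensystem[OF y])
  let ?a = "param_form b0 b y" and ?y = "\<lambda>m. complex_of_real (y m)"
  note ady = param_box_admissible[OF y(1)]
  note adw = admissible_diff[OF z(1) ady]
  have ne: "\<omega> - of_real (\<mu> k) \<noteq> 0" for k
    using sep(2)[of k] mult_pos_pos[OF sep(1) E.eigenvalue_pos[of k]] by auto
  \<comment> \<open>Finite combinations come first, so that the test vector is an element of
    \<open>V\<close> without any convergence question; \<open>E.proj_tendsto\<close> then passes to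
    the limit.\<close>
  have fin: "(\<eta> - \<theta>) * \<alpha> * norm (\<Sum>k<n. p k *\<^sub>R u k, \<Sum>k<n. q k *\<^sub>R u k)
      \<le> norm (S z \<omega> (\<Sum>k<n. p k *\<^sub>R u k, \<Sum>k<n. q k *\<^sub>R u k))" for n p q
  proof -
    define x where "x = (\<Sum>k<n. p k *\<^sub>R u k, \<Sum>k<n. q k *\<^sub>R u k)"
    define c where "c k = Complex (p k) (q k)" for k
    define d where "d k = c k * sgn (\<omega> - of_real (\<mu> k))" for k
    define v where "v = (\<Sum>k<n. Re (d k) *\<^sub>R u k, \<Sum>k<n. Im (d k) *\<^sub>R u k)"
    define Q where "Q x = ?a (fst x) (fst x) + ?a (snd x) (snd x)" for x
    have cd: "cmod (d k) = cmod (c k)" for k using ne[of k] by (simp add: d_def norm_mult norm_sgn)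
    have cc: "(cmod (c k))\<^sup>2 = p k * p k + q k * q k" for k
      by (simp add: c_def cmod_power2) (simp add: power2_eq_square)
    have dd: "(cmod (d k))\<^sup>2 = Re (d k) * Re (d k) + Im (d k) * Im (d k)" for k
      by (simp add: cmod_power2) (simp add: power2_eq_square)
    have Qx: "Q x = (\<Sum>k<n. \<mu> k * (cmod (c k))\<^sup>2)"
      by (simp add: Q_def x_def E.form_combination sum.distrib[symmetric] cc distrib_left)
    have Qv: "Q v = Q x"
      unfolding Qx cd[symmetric]
      by (simp add: Q_def v_def E.form_combination sum.distrib[symmetric] dd distrib_left)
    have Q0: "Q x = 0" if "v = 0"
      unfolding Qv[symmetric] using that by (simp add: Q_def E.a.zero_left)
    have Q_ge: "\<alpha> * (norm w)\<^sup>2 \<le> Q w" for w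
      using E.coercive[of "fst w"] E.coercive[of "snd w"]
      by (simp add: Q_def norm_prod_def distrib_left)
    have prodQ: "\<alpha> * (norm x * norm v) \<le> Q x"
    proof -
      have "2 * (norm x * norm v) \<le> (norm x)\<^sup>2 + (norm v)\<^sup>2" using sum_squares_bound[of "norm x" "norm v"] by simp
      then have "\<alpha> * (2 * (norm x * norm v)) \<le> \<alpha> * ((norm x)\<^sup>2 + (norm v)\<^sup>2)"
        using alpha_pos by (intro mult_left_mono) auto
      then show ?thesis using Q_ge[of x] Q_ge[of v] Qv by (simp add: distrib_left)
    qed
    have "dual_pairing (S ?y \<omega> x) v = (\<Sum>k<n. cmod (\<omega> - of_real (\<mu> k)) * (cmod (c k))\<^sup>2)"
    proof -
      have "dual_pairing (S ?y \<omega> x) v = (\<Sum>k<n. Re ((\<omega> - of_real (\<mu> k)) * (c k * cnj (d k))))"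
        by (simp add: S_real_pairing[OF ady] x_def v_def E.form_combination E.inner_combination c_def
            sum_distrib_left sum.distrib[symmetric] sum_subtractf[symmetric] algebra_simps)
      moreover have "Re ((\<omega> - of_real (\<mu> k)) * (c k * cnj (d k))) = cmod (\<omega> - of_real (\<mu> k)) * (cmod (c k))\<^sup>2" for k
      proof -
        have "t * cnj (sgn t) = of_real (cmod t)" for t :: complex
          by (cases "t = 0") (simp_all add: sgn_eq complex_norm_square[symmetric] power2_eq_square)
        then have "(\<omega> - of_real (\<mu> k)) * (c k * cnj (d k)) = of_real (cmod (\<omega> - of_real (\<mu> k))) * (c k * cnj (c k))"
          by (simp add: d_def mult_ac)
        also have "c k * cnj (c k) = of_real ((cmod (c k))\<^sup>2)" by (simp only: complex_norm_square)
        finally show ?thesis by simp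
      qed
      ultimately show ?thesis by simp
    qed
    moreover have "\<eta> * Q x \<le> (\<Sum>k<n. cmod (\<omega> - of_real (\<mu> k)) * (cmod (c k))\<^sup>2)"
      unfolding Qx sum_distrib_left mult.assoc[symmetric]
      by (intro sum_mono mult_right_mono sep(2)) auto
    moreover have "dual_pairing (pert (\<lambda>m. z m - ?y m) x) v \<le> \<theta> * Q x"
    proof (cases "v = 0")
      case True
      then have "Q x = 0" by (rule Q0)
      then show ?thesis by (simp add: True dual_pairing_def)
    next
      case False
      have "weight (\<lambda>m. z m - ?y m) \<ge> 0" by (rule weight_nonneg[OF adw])
      then have "0 \<le> \<theta>" using z(2) K_bounds zero_le_mult_iff[of \<theta> "1 - K"] by linarith
      have "dual_pairing (pert (\<lambda>m. z m - ?y m) x) v \<le> \<alpha>\<^sub>0 * weight (\<lambda>m. z m - ?y m) * norm x * norm v"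
        using pert_pair_le[OF adw, of x v] by simp
      also have "\<dots> \<le> \<alpha>\<^sub>0 * (\<theta> * (1 - K)) * norm x * norm v"
        using z(2) alpha0_pos by (intro mult_right_mono mult_left_mono) auto
      also have "\<dots> = \<theta> * (\<alpha> * (norm x * norm v))" by (simp add: \<alpha>_def)
      also have "\<dots> \<le> \<theta> * Q x" by (rule mult_left_mono[OF prodQ \<open>0 \<le> \<theta>\<close>])
      finally show ?thesis .
    qed
    moreover have "S z \<omega> x = S ?y \<omega> x - pert (\<lambda>m. z m - ?y m) x"
      using S_diff[OF z(1) ady, of \<omega> x \<omega>] by (simp add: algebra_simps)
    ultimately have "(\<eta> - \<theta>) * Q x \<le> dual_pairing (S z \<omega> x) v"
      using linear_diff[OF bounded_linear.linear[OF dual_pairing_bounded_linear[of v]]]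
      by (simp add: left_diff_distrib)
    also have "\<dots> \<le> norm (S z \<omega> x) * norm v" using dual_pairing_le[of "S z \<omega> x" v] by simp
    finally have key: "(\<eta> - \<theta>) * Q x \<le> norm (S z \<omega> x) * norm v" .
    have "(\<eta> - \<theta>) * \<alpha> * norm x \<le> norm (S z \<omega> x)"
    proof (cases "\<eta> \<le> \<theta>")
      case True
      then have "(\<eta> - \<theta>) * \<alpha> * norm x \<le> 0" using alpha_pos by (simp add: mult_nonpos_nonneg)
      then show ?thesis using norm_ge_zero order_trans by blast
    next
      case False
      show ?thesis
      proof (cases "v = 0")
        case True
        then have "Q x = 0" by (rule Q0)
        then have "\<alpha> * (norm x)\<^sup>2 \<le> 0" using Q_ge[of x] by simp
        then have "x = 0" using alpha_pos by (simp add: mult_le_0_iff)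
        then show ?thesis by simp
      next
        case vne: False
        have "((\<eta> - \<theta>) * \<alpha> * norm x) * norm v = (\<eta> - \<theta>) * (\<alpha> * (norm x * norm v))" by simp
        also have "\<dots> \<le> (\<eta> - \<theta>) * Q x" using prodQ False by (intro mult_left_mono) auto
        also have "\<dots> \<le> norm (S z \<omega> x) * norm v" by (rule key)
        finally show ?thesis using vne by simp
      qed
    qed
    then show ?thesis by (simp add: x_def)
  qed
  have lim: "(\<lambda>n. (E.proj n (fst x), E.proj n (snd x))) \<longlonglongrightarrow> x"
    using tendsto_Pair[OF E.proj_tendsto[of "fst x"] E.proj_tendsto[of "snd x"]] by simp
  show ?thesis
  proof (rule LIMSEQ_le)
    show "(\<lambda>n. (\<eta> - \<theta>) * \<alpha> * norm (E.proj n (fst x), E.proj n (snd x))) \<longlonglongrightarrow> (\<eta> - \<theta>) * \<alpha> * norm x"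
      by (intro tendsto_mult tendsto_const tendsto_norm lim)
    show "(\<lambda>n. norm (S z \<omega> (E.proj n (fst x), E.proj n (snd x)))) \<longlonglongrightarrow> norm (S z \<omega> x)"
      by (intro tendsto_norm bounded_linear.tendsto[OF S_bounded_linear[OF z(1)]] lim)
    show "\<exists>N. \<forall>n\<ge>N. (\<eta> - \<theta>) * \<alpha> * norm (E.proj n (fst x), E.proj n (snd x))
        \<le> norm (S z \<omega> (E.proj n (fst x), E.proj n (snd x)))"
      unfolding E.proj_def by (intro exI[of _ 0] allI impI fin)
  qed
qed

lemma S_cscale:
  assumes "admissible z"
  shows "S z \<omega> (cscale c x) = cscale c (S z \<omega> x)"
proof -
  note lin = bounded_linear.linear[OF blinfun.bounded_linear_right]
  have "pert z (cscale c x) = cscale c (pert z x)"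
    unfolding pert_def cscale_map_prod[OF lin, symmetric]
    by (subst bounded_linear.suminf[OF cscale_bounded_linear pert_summable[OF assms]])
      (simp add: cscale_cscale mult.commute)
  moreover have "embed2 (cscale c x) = cscale c (embed2 x)"
    unfolding embed2_def
    by (rule cscale_map_prod[symmetric], rule bounded_linear.linear,
        rule bounded_linear_compose[OF dual_embed_bounded_linear blinfun.bounded_linear_right])
  ultimately show ?thesis
    by (simp add: S_eq cscale_add_right cscale_diff_right cscale_map_prod[OF lin] cscale_cscale mult.commute)
qed

lemma S_eigenvector:
  assumes y: "y \<in> param_box" "eigen_enumeration \<iota> (param_form b0 b y) \<mu> u"
  shows "S (\<lambda>m. of_real (y m)) \<omega> (u k, 0) = cscale (\<omega> - of_real (\<mu> k)) (dual_embed \<iota> (\<iota> (u k)), 0)"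
proof (rule dual_pairing_ext)
  interpret E: coercive_eigensystem \<iota> "param_form b0 b y" \<alpha> \<mu> u by (rule eigensystem[OF y])
  fix v
  show "dual_pairing (S (\<lambda>m. of_real (y m)) \<omega> (u k, 0)) v
      = dual_pairing (cscale (\<omega> - of_real (\<mu> k)) (dual_embed \<iota> (\<iota> (u k)), 0)) v"
    by (simp add: S_real_pairing[OF param_box_admissible[OF y(1)]] E.eigen_eq E.a.zero_left)
      (simp add: dual_pairing_def cscale_def blinfun.scaleR_left blinfun.diff_left algebra_simps)
qed

text \<open>The range is closed by the lower bound and contains the images of all eigenvectors.
  Completeness fills it up to \<open>V\<close>, and the two dense embeddings up to \<open>H\<close>
  and then to the whole dual.\<close>

lemma S_real_surj:
  assumes y: "y \<in> param_box" "eigen_enumeration \<iota> (param_form b0 b y) \<mu> u"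
    and sep: "0 < \<eta>" "\<And>k. \<eta> * \<mu> k \<le> cmod (\<omega> - of_real (\<mu> k))"
  shows "surj (S (\<lambda>m. of_real (y m)) \<omega>)"
proof -
  interpret E: coercive_eigensystem \<iota> "param_form b0 b y" \<alpha> \<mu> u by (rule eigensystem[OF y])
  let ?y = "\<lambda>m. complex_of_real (y m)"
  note ady = param_box_admissible[OF y(1)]
  have ne: "\<omega> - of_real (\<mu> k) \<noteq> 0" for k
    using sep(2)[of k] mult_pos_pos[OF sep(1) E.eigenvalue_pos[of k]] by auto
  define R where "R = range (S ?y \<omega>)"
  have below: "\<eta> * \<alpha> * norm x \<le> norm (S ?y \<omega> x)" for x
    using S_lower_bound[OF y ady, of 0 \<eta> \<omega> x] sep by (simp add: weight_def)
  have "closed R" unfolding R_def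
    by (rule bounded_below_closed_range[OF S_bounded_linear[OF ady] _ below]) (use sep alpha_pos in simp)
  have sub: "subspace R" unfolding R_def
    by (rule linear_subspace_image[OF bounded_linear.linear[OF S_bounded_linear[OF ady]] subspace_UNIV])
  \<comment> \<open>The scalars \<open>1\<close> and \<open>\<i>\<close> place a real functional in
    the first or second component, so real density arguments suffice.\<close>
  define T where "T c f = cscale c (f, 0 :: 'v \<Rightarrow>\<^sub>L real)" for c f
  have T: "bounded_linear (T c)" for c unfolding T_def
    by (intro bounded_linear_compose[OF cscale_bounded_linear] bounded_linear_Pair bounded_linear_ident bounded_linear_zero)
  have closed_preimage: "closed {x. f x \<in> R}" if "bounded_linear f" for f :: "'c::real_normed_vector \<Rightarrow> _"
    using continuous_closed_vimage[OF \<open>closed R\<close>, of f] linear_continuous_at[OF that] by (simp add: vimage_def)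
  have Tu: "T c (dual_embed \<iota> (\<iota> (u k))) \<in> R" for c k
  proof -
    have "S ?y \<omega> (cscale (c / (\<omega> - of_real (\<mu> k))) (u k, 0)) = T c (dual_embed \<iota> (\<iota> (u k)))"
      using ne[of k] by (simp add: S_cscale[OF ady] S_eigenvector[OF y] cscale_cscale T_def)
    then show ?thesis unfolding R_def by (metis rangeI)
  qed
  have lin: "bounded_linear (\<lambda>v. T c (dual_embed \<iota> (\<iota> v)))" for c
    by (intro bounded_linear_compose[OF T] bounded_linear_compose[OF dual_embed_bounded_linear] blinfun.bounded_linear_right)
  have Tv: "T c (dual_embed \<iota> (\<iota> v)) \<in> R" for c v
  proof (rule closed_sequentially[OF \<open>closed R\<close>])
    show "T c (dual_embed \<iota> (\<iota> (E.proj n v))) \<in> R" for n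
      unfolding E.proj_def linear_sum[OF bounded_linear.linear[OF lin]] linear_scale[OF bounded_linear.linear[OF lin]]
      by (intro subspace_sum[OF sub] subspace_scale[OF sub] Tu)
    show "(\<lambda>n. T c (dual_embed \<iota> (\<iota> (E.proj n v)))) \<longlonglongrightarrow> T c (dual_embed \<iota> (\<iota> v))"
      by (rule bounded_linear.tendsto[OF lin E.proj_tendsto])
  qed
  have Th: "T c (dual_embed \<iota> h) \<in> R" for c h
  proof -
    have "closure (range \<iota>) \<subseteq> {h. T c (dual_embed \<iota> h) \<in> R}"
      by (rule closure_minimal)
        (use Tv closed_preimage[OF bounded_linear_compose[OF T dual_embed_bounded_linear]] in auto)
    moreover have "closure (range \<iota>) = UNIV" using gelfand by (simp add: gelfand_triple_def dense_compact_embedding_def)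
    ultimately show ?thesis by blast
  qed
  have Tf: "T c f \<in> R" for c f
  proof -
    have "closure (range (dual_embed \<iota>)) \<subseteq> {f. T c f \<in> R}"
      by (rule closure_minimal) (use Th closed_preimage[OF T] in auto)
    moreover have "closure (range (dual_embed \<iota>)) = UNIV" using gelfand by (simp add: gelfand_triple_def dense_compact_embedding_def)
    ultimately show ?thesis by blast
  qed
  have "f \<in> R" for f
  proof -
    have "f = T 1 (fst f) + T \<i> (snd f)" by (cases f) (simp add: T_def cscale_def)
    then show ?thesis using subspace_add[OF sub Tf Tf] by metis
  qed
  then show ?thesis by (auto simp: R_def)
qed

text \<open>On the segment from the real point \<open>y\<close> to \<open>z\<close> the weighted
  distance to \<open>y\<close> never exceeds its value at \<open>z\<close>, so one lower bound
  serves the whole path.\<close>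

lemma S_surj:
  assumes y: "y \<in> param_box" "eigen_enumeration \<iota> (param_form b0 b y) \<mu> u"
    and z: "admissible z" "weight (\<lambda>m. z m - of_real (y m)) \<le> \<theta> * (1 - K)"
    and sep: "\<theta> < \<eta>" "\<And>k. \<eta> * \<mu> k \<le> cmod (\<omega> - of_real (\<mu> k))"
  shows "surj (S z \<omega>)"
proof -
  let ?y = "\<lambda>m. complex_of_real (y m)"
  note ady = param_box_admissible[OF y(1)]
  note adw = admissible_diff[OF z(1) ady]
  have "0 \<le> \<theta> * (1 - K)" using weight_nonneg[OF adw] z(2) by simp
  then have th: "0 \<le> \<theta>" using K_bounds zero_le_mult_iff[of \<theta> "1 - K"] by linarith
  then have eta: "0 < \<eta>" using sep(1) by simp
  define D where "D x = - pert (\<lambda>m. z m - ?y m) x" for x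
  have D: "bounded_linear D" unfolding D_def by (intro bounded_linear_minus pert_bounded_linear adw)
  have "surj (\<lambda>x. S ?y \<omega> x + D x)"
  proof (rule method_of_continuity[OF S_bounded_linear[OF ady] D S_real_surj[OF y eta sep(2)]])
    show "0 < (\<eta> - \<theta>) * \<alpha>" using sep(1) alpha_pos by simp
    fix t :: real and x assume t: "0 \<le> t" "t \<le> 1"
    \<comment> \<open>The point at time \<open>t\<close> of that segment, written as a difference
      because admissibility is available for differences and multiples.\<close>
    define zt where "zt m = ?y m - (- of_real t) * (z m - ?y m)" for m
    have adt: "admissible zt" unfolding zt_def by (intro admissible_diff[OF ady] admissible_scale adw)
    have dt: "zt m - ?y m = of_real t * (z m - ?y m)" for m by (simp add: zt_def)
    have wt: "weight (\<lambda>m. zt m - ?y m) = t * weight (\<lambda>m. z m - ?y m)"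
    proof -
      have "weight (\<lambda>m. zt m - ?y m) = (\<Sum>m. t * (\<kappa> m * cmod (z m - ?y m)))"
        unfolding weight_def dt using t by (simp add: norm_mult mult_ac)
      also have "\<dots> = t * weight (\<lambda>m. z m - ?y m)"
        unfolding weight_def using adw by (intro suminf_mult) (simp add: admissible_def)
      finally show ?thesis .
    qed
    have "weight (\<lambda>m. zt m - ?y m) \<le> 1 * weight (\<lambda>m. z m - ?y m)"
      unfolding wt using t weight_nonneg[OF adw] by (intro mult_right_mono) auto
    then have "weight (\<lambda>m. zt m - ?y m) \<le> \<theta> * (1 - K)" using z(2) by simp
    then have "(\<eta> - \<theta>) * \<alpha> * norm x \<le> norm (S zt \<omega> x)"
      by (rule S_lower_bound[OF y adt _ eta sep(2)])
    moreover have "pert (\<lambda>m. zt m - ?y m) x = t *\<^sub>R pert (\<lambda>m. z m - ?y m) x"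
    proof -
      have e: "cscale (of_real t * c) f = t *\<^sub>R cscale c f" for c and f :: "('v \<Rightarrow>\<^sub>L real) \<times> ('v \<Rightarrow>\<^sub>L real)"
        by (simp add: cscale_def algebra_simps)
      show ?thesis unfolding pert_def dt e by (rule suminf_scaleR_right[symmetric]) (rule pert_summable[OF adw])
    qed
    then have "S zt \<omega> x = S ?y \<omega> x + t *\<^sub>R D x"
      using S_diff[OF adt ady, of \<omega> x \<omega>] by (simp add: D_def algebra_simps)
    ultimately show "(\<eta> - \<theta>) * \<alpha> * norm x \<le> norm (S ?y \<omega> x + t *\<^sub>R D x)" by simp
  qed
  moreover have "S ?y \<omega> x + D x = S z \<omega> x" for x
    using S_diff[OF z(1) ady, of \<omega> x \<omega>] by (simp add: D_def algebra_simps)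
  ultimately show ?thesis by simp
qed

section \<open>Spectrum and resolvent\<close>

abbreviation spec :: "(nat \<Rightarrow> complex) \<Rightarrow> complex set" where
  "spec z \<equiv> spectrum \<iota> (param_op b0 b z)"

lemma not_in_spec_iff: "\<omega> \<notin> spec z \<longleftrightarrow> bij (S z \<omega>) \<and> bounded_linear (inv (S z \<omega>))"
  by (simp add: spectrum_def S_def)

lemma not_in_specI:
  assumes "admissible z" "surj (S z \<omega>)" "0 < c" "\<And>x. c * norm x \<le> norm (S z \<omega> x)"
  shows "\<omega> \<notin> spec z"
  unfolding not_in_spec_iff
  using bounded_below_bij[OF S_bounded_linear[OF assms(1)] assms(3,4,2)] by blast

lemma not_in_specE:
  assumes "\<omega> \<notin> spec z"
  obtains c where "0 < c" "surj (S z \<omega>)" "\<And>x. c * norm x \<le> norm (S z \<omega> x)"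
  using assms bounded_inverse_below[of "S z \<omega>"] unfolding not_in_spec_iff by (metis bij_is_surj)

text \<open>Composed with the inverse at one regular point, \<open>S z \<omega>\<close> becomes the
  identity minus a compact operator, to which the Fredholm alternative applies. The definition of
  \<open>spectral_projection\<close> asks for this inclusion on the enclosed part.\<close>

lemma spec_subset_eigenvalues:
  assumes z: "admissible z" and "\<omega>\<^sub>0 \<notin> spec z"
  shows "spec z \<subseteq> eigenvalues \<iota> (param_op b0 b z)"
proof (rule subsetI, rule ccontr)
  fix \<omega> assume om: "\<omega> \<in> spec z" "\<omega> \<notin> eigenvalues \<iota> (param_op b0 b z)"
  have inj: "S z \<omega> x = 0 \<Longrightarrow> x = 0" for x
    using om(2) unfolding eigenvalues_def S_def by blast
  define L where "L = inv (S z \<omega>\<^sub>0)"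
  have bij: "bij (S z \<omega>\<^sub>0)" and L: "bounded_linear L" using assms(2) unfolding not_in_spec_iff L_def by auto
  have LS: "L (S z \<omega>\<^sub>0 x) = x" for x unfolding L_def using bij by (simp add: bij_is_inj inv_f_f)
  have SL: "S z \<omega>\<^sub>0 (L f) = f" for f unfolding L_def using bij by (simp add: bij_is_surj surj_f_inv_f)
  define g where "g f = - L (cscale (\<omega> - \<omega>\<^sub>0) f)" for f
  have g: "bounded_linear g" unfolding g_def
    by (intro bounded_linear_minus bounded_linear_compose[OF L] cscale_bounded_linear)
  have comp: "compact (closure ((\<lambda>x. g (embed2 x)) ` X))" if "bounded X" for X
    using compact_closure_image[OF embed2_compact[OF that] linear_continuous_on[OF g]] by (simp add: image_image)
  have gl: "bounded_linear (\<lambda>x. g (embed2 x))" by (rule bounded_linear_compose[OF g embed2_bounded_linear])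
  have e: "x - g (embed2 x) = L (S z \<omega> x)" for x
  proof -
    have "S z \<omega> x = S z \<omega>\<^sub>0 x + cscale (\<omega> - \<omega>\<^sub>0) (embed2 x)" by (simp add: S_eq cscale_diff_left)
    then show ?thesis by (simp add: g_def linear_add[OF bounded_linear.linear[OF L]] LS)
  qed
  have inj': "x = 0" if "x - g (embed2 x) = 0" for x
  proof (rule inj)
    have "L (S z \<omega> x) = 0" using that e by simp
    then show "S z \<omega> x = 0" using SL[of "S z \<omega> x"] linear_0[OF bounded_linear.linear[OF S_bounded_linear[OF z]]] by simp
  qed
  have "surj (\<lambda>x. x - g (embed2 x))" by (rule fredholm_alternative[OF gl comp inj'])
  then have s: "surj (\<lambda>x. L (S z \<omega> x))" by (simp add: e)
  have surj: "surj (S z \<omega>)"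
  proof (unfold surj_def, rule allI)
    fix f
    obtain x where "L f = L (S z \<omega> x)" using s unfolding surj_def by blast
    then have "f = S z \<omega> x" by (metis SL)
    then show "\<exists>x. f = S z \<omega> x" ..
  qed
  obtain c where c: "0 < c" "\<And>x. c * norm x \<le> norm (x - g (embed2 x))"
    using fredholm_bounded_below[OF gl comp inj'] by blast
  obtain C where C: "0 < C" "\<And>f. norm (L f) \<le> norm f * C" using bounded_linear.pos_bounded[OF L] by blast
  have "(c / C) * norm x \<le> norm (S z \<omega> x)" for x
    using order_trans[OF c(2)[of x, unfolded e] C(2)] C(1) by (simp add: field_simps)
  then have "\<omega> \<notin> spec z" by (intro not_in_specI[OF z surj, of "c / C"]) (use c C in auto)
  with om(1) show False by simp
qed

lemma embed2_cscale_bound: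
  obtains C where "0 < C" "\<And>c x. norm (cscale c (embed2 x)) \<le> C * cmod c * norm x"
proof -
  obtain C where C: "0 < C" "\<And>x. norm (embed2 x) \<le> norm x * C"
    using bounded_linear.pos_bounded[OF embed2_bounded_linear] by blast
  have "norm (cscale c (embed2 x)) \<le> (2 * C) * cmod c * norm x" for c x
  proof -
    have "norm (cscale c (embed2 x)) \<le> 2 * cmod c * norm (embed2 x)" by (rule norm_cscale_le)
    also have "\<dots> \<le> 2 * cmod c * (norm x * C)" by (intro mult_left_mono C) auto
    finally show ?thesis by (simp add: mult_ac)
  qed
  then show thesis using C(1) by (intro that[of "2 * C"]) auto
qed

text \<open>A radius that uses up at most half of the lower bound at \<open>\<omega>\<close>. The
  constants are uniform in the disc, as continuity and differentiability of the resolvent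
  require.\<close>

lemma resolvent_neighbourhood:
  assumes z: "admissible z" and "\<omega> \<notin> spec z"
  obtains r c C where "0 < r" "0 < c" "0 < C"
    "\<And>\<omega>'. cmod (\<omega>' - \<omega>) < r \<Longrightarrow> surj (S z \<omega>')"
    "\<And>\<omega>' x. cmod (\<omega>' - \<omega>) < r \<Longrightarrow> c * norm x \<le> norm (S z \<omega>' x)"
    "\<And>\<omega>' \<omega>'' x. norm (S z \<omega>' x - S z \<omega>'' x) \<le> C * cmod (\<omega>' - \<omega>'') * norm x"
proof -
  obtain c where c: "0 < c" "surj (S z \<omega>)" "\<And>x. c * norm x \<le> norm (S z \<omega> x)"
    using not_in_specE[OF assms(2)] by blast
  obtain C where C: "0 < C" "\<And>c x. norm (cscale c (embed2 x)) \<le> C * cmod c * norm x"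
    using embed2_cscale_bound by blast
  have diff: "norm (S z \<omega>' x - S z \<omega>'' x) \<le> C * cmod (\<omega>' - \<omega>'') * norm x" for \<omega>' \<omega>'' x
    using C(2)[of "\<omega>' - \<omega>''" x] by (simp add: S_eq cscale_diff_left)
  have near: "norm (S z \<omega>' x - S z \<omega> x) \<le> c / 2 * norm x" if "cmod (\<omega>' - \<omega>) < c / (2 * C)" for \<omega>' x
  proof -
    have "C * cmod (\<omega>' - \<omega>) \<le> c / 2" using that C(1) by (simp add: field_simps)
    then show ?thesis using diff[of \<omega>' x \<omega>] by (meson mult_right_mono norm_ge_zero order_trans)
  qed
  show thesis
  proof (rule that[of "c / (2 * C)" "c / 2" C])
    fix \<omega>' assume w: "cmod (\<omega>' - \<omega>) < c / (2 * C)"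
    show "surj (S z \<omega>')"
      by (rule surj_perturb[OF S_bounded_linear[OF z] S_bounded_linear[OF z] c(2,3) near[OF w]]) (use c in auto)
    show "c / 2 * norm x \<le> norm (S z \<omega>' x)" for x
    proof -
      have "c * norm x \<le> norm (S z \<omega> x)" by (rule c)
      also have "\<dots> \<le> norm (S z \<omega>' x) + norm (S z \<omega>' x - S z \<omega> x)" by (metis norm_triangle_sub norm_minus_commute)
      also have "\<dots> \<le> norm (S z \<omega>' x) + c / 2 * norm x" using near[OF w] by simp
      finally show ?thesis by simp
    qed
  qed (use c C diff in auto)
qed

lemma open_resolvent_set:
  assumes "admissible z"
  shows "open (- spec z)"
proof (unfold open_dist, intro ballI)
  fix \<omega> assume "\<omega> \<in> - spec z"
  then obtain r c C where r: "0 < r" "0 < c"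
    "\<And>\<omega>'. cmod (\<omega>' - \<omega>) < r \<Longrightarrow> surj (S z \<omega>')"
    "\<And>\<omega>' x. cmod (\<omega>' - \<omega>) < r \<Longrightarrow> c * norm x \<le> norm (S z \<omega>' x)"
    using resolvent_neighbourhood[OF assms, of \<omega>] by (metis ComplD)
  have "\<omega>' \<in> - spec z" if "dist \<omega>' \<omega> < r" for \<omega>'
    using not_in_specI[OF assms, of \<omega>' c] r that by (simp add: dist_norm)
  with r(1) show "\<exists>e>0. \<forall>\<omega>'. dist \<omega>' \<omega> < e \<longrightarrow> \<omega>' \<in> - spec z" by blast
qed

lemma inv_S_cscale:
  assumes "admissible z" "\<omega> \<notin> spec z"
  shows "inv (S z \<omega>) (cscale c f) = cscale c (inv (S z \<omega>) f)"
proof -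
  have bij: "bij (S z \<omega>)" using assms(2) unfolding not_in_spec_iff by blast
  then have "S z \<omega> (cscale c (inv (S z \<omega>) f)) = cscale c f"
    by (simp add: S_cscale[OF assms(1)] bij_is_surj surj_f_inv_f)
  then show ?thesis by (metis bij bij_is_inj inv_f_f)
qed

text \<open>The right-hand side may vary with \<open>\<omega>\<close>, so that nested inverses such
  as those in \<open>resolvent_deriv\<close> are covered.\<close>

lemma continuous_on_inv_S:
  assumes z: "admissible z" and T: "T \<inter> spec z = {}" and f: "continuous_on T f"
  shows "continuous_on T (\<lambda>\<omega>. inv (S z \<omega>) (f \<omega>))"
  unfolding continuous_on_def
proof (rule ballI)
  fix \<omega> assume "\<omega> \<in> T"
  then have "\<omega> \<notin> spec z" using T by auto
  then obtain r c C where r: "0 < r" "0 < c" "0 < C"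
    "\<And>\<omega>'. cmod (\<omega>' - \<omega>) < r \<Longrightarrow> surj (S z \<omega>')"
    "\<And>\<omega>' x. cmod (\<omega>' - \<omega>) < r \<Longrightarrow> c * norm x \<le> norm (S z \<omega>' x)"
    "\<And>\<omega>' \<omega>'' x. norm (S z \<omega>' x - S z \<omega>'' x) \<le> C * cmod (\<omega>' - \<omega>'') * norm x"
    using resolvent_neighbourhood[OF z] by blast
  note bl = S_bounded_linear[OF z]
  have om: "cmod (\<omega> - \<omega>) < r" using r(1) by simp
  have le: "norm (inv (S z \<omega>') (f \<omega>') - inv (S z \<omega>) (f \<omega>))
      \<le> norm (f \<omega>' - f \<omega>) / c + C * cmod (\<omega> - \<omega>') / c\<^sup>2 * norm (f \<omega>)" if w: "cmod (\<omega>' - \<omega>) < r" for \<omega>'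
  proof -
    note B = bounded_below_bij[OF bl r(2) r(5)[OF w] r(4)[OF w]]
    have "inv (S z \<omega>') (f \<omega>') - inv (S z \<omega>) (f \<omega>)
        = inv (S z \<omega>') (f \<omega>' - f \<omega>) + (inv (S z \<omega>') (f \<omega>) - inv (S z \<omega>) (f \<omega>))"
      by (simp add: linear_diff[OF bounded_linear.linear[OF B(2)]])
    also have "norm \<dots> \<le> norm (f \<omega>' - f \<omega>) / c + C * cmod (\<omega> - \<omega>') / c\<^sup>2 * norm (f \<omega>)"
      by (intro norm_triangle_le add_mono B(3)
          inverse_expansion(1)[OF bl r(4)[OF om] bl r(4)[OF w] r(2) r(5)[OF om] r(5)[OF w] r(6)])
    finally show ?thesis .
  qed
  show "((\<lambda>\<omega>'. inv (S z \<omega>') (f \<omega>')) \<longlongrightarrow> inv (S z \<omega>) (f \<omega>)) (at \<omega> within T)"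
  proof (rule LIM_zero_cancel, rule Lim_null_comparison)
    have "\<forall>\<^sub>F \<omega>' in at \<omega> within T. cmod (\<omega>' - \<omega>) < r"
      unfolding eventually_at using r(1) by (auto simp: dist_norm)
    then show "\<forall>\<^sub>F \<omega>' in at \<omega> within T. norm (inv (S z \<omega>') (f \<omega>') - inv (S z \<omega>) (f \<omega>))
      \<le> norm (f \<omega>' - f \<omega>) / c + C * cmod (\<omega> - \<omega>') / c\<^sup>2 * norm (f \<omega>)"
      by (rule eventually_mono) (rule le)
    have "(f \<longlongrightarrow> f \<omega>) (at \<omega> within T)" using f \<open>\<omega> \<in> T\<close> by (simp add: continuous_on_def)
    then have "((\<lambda>\<omega>'. norm (f \<omega>' - f \<omega>) / c + C * cmod (\<omega> - \<omega>') / c\<^sup>2 * norm (f \<omega>)) \<longlongrightarrow>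
        norm (f \<omega> - f \<omega>) / c + C * cmod (\<omega> - \<omega>) / c\<^sup>2 * norm (f \<omega>)) (at \<omega> within T)"
      using r(2) by (intro tendsto_intros) auto
    then show "((\<lambda>\<omega>'. norm (f \<omega>' - f \<omega>) / c + C * cmod (\<omega> - \<omega>') / c\<^sup>2 * norm (f \<omega>)) \<longlongrightarrow> 0) (at \<omega> within T)"
      by simp
  qed
qed

section \<open>Matrix elements of the resolvent\<close>

definition test_functional :: "'h \<times> 'h \<Rightarrow> 'v \<times> 'v \<Rightarrow> complex" where
  "test_functional g x = cinner (map_prod \<iota> \<iota> x) g"

lemma test_functional_bounded_linear: "bounded_linear (test_functional g)"
  unfolding test_functional_def
  by (intro bounded_linear_compose[OF cinner_bounded_linear_left] bounded_linear_map_prod blinfun.bounded_linear_right)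

lemma test_functional_cscale: "test_functional g (cscale c x) = c * test_functional g x"
  by (simp add: test_functional_def cinner_cscale_left
      cscale_map_prod[OF bounded_linear.linear[OF blinfun.bounded_linear_right], symmetric])

text \<open>Scalar matrix elements make Cauchy's theorem for \<open>contour_integral\<close>
  applicable to the vector-valued Riesz integral.\<close>

definition resolvent_coeff :: "(nat \<Rightarrow> complex) \<Rightarrow> 'h \<times> 'h \<Rightarrow> 'h \<times> 'h \<Rightarrow> complex \<Rightarrow> complex" where
  "resolvent_coeff z h g \<omega> = cinner (resolvent \<iota> (param_op b0 b z) \<omega> h) g"

lemma resolvent_coeff_eq:
  "resolvent_coeff z h g \<omega> = test_functional g (inv (S z \<omega>) (map_prod (dual_embed \<iota>) (dual_embed \<iota>) h))"
  by (simp add: resolvent_coeff_def resolvent_def S_def test_functional_def)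

lemma continuous_on_resolvent:
  assumes z: "admissible z" and T: "T \<inter> spec z = {}"
  shows "continuous_on T (\<lambda>\<omega>. resolvent \<iota> (param_op b0 b z) \<omega> h)"
proof -
  have "continuous_on T (\<lambda>\<omega>. map_prod \<iota> \<iota> (inv (S z \<omega>) (map_prod (dual_embed \<iota>) (dual_embed \<iota>) h)))"
    by (intro bounded_linear.continuous_on[OF bounded_linear_map_prod[OF blinfun.bounded_linear_right blinfun.bounded_linear_right]]
        continuous_on_inv_S z T continuous_intros)
  then show ?thesis by (simp add: resolvent_def[abs_def] S_def)
qed

text \<open>The second bound of \<open>inverse_expansion\<close> with a perturbation linear in
  \<open>\<omega> - \<omega>'\<close>. The derivative \<open>D\<close> is minus the matrix element
  of the squared resolvent.\<close>

lemma resolvent_coeff_holomorphic: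
  assumes z: "admissible z"
  shows "resolvent_coeff z h g holomorphic_on - spec z"
proof (subst holomorphic_on_open[OF open_resolvent_set[OF z]], intro ballI)
  fix \<omega> assume "\<omega> \<in> - spec z"
  then have om: "\<omega> \<notin> spec z" by simp
  then obtain r c C where r: "0 < r" "0 < c" "0 < C"
    "\<And>\<omega>'. cmod (\<omega>' - \<omega>) < r \<Longrightarrow> surj (S z \<omega>')"
    "\<And>\<omega>' x. cmod (\<omega>' - \<omega>) < r \<Longrightarrow> c * norm x \<le> norm (S z \<omega>' x)"
    "\<And>\<omega>' \<omega>'' x. norm (S z \<omega>' x - S z \<omega>'' x) \<le> C * cmod (\<omega>' - \<omega>'') * norm x"
    using resolvent_neighbourhood[OF z] by blast
  note bl = S_bounded_linear[OF z]
  have om0: "cmod (\<omega> - \<omega>) < r" using r(1) by simp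
  define f where "f = map_prod (dual_embed \<iota>) (dual_embed \<iota>) h"
  define D where "D = - test_functional g (inv (S z \<omega>) (embed2 (inv (S z \<omega>) f)))"
  obtain L where L: "0 < L" "\<And>x. norm (test_functional g x) \<le> norm x * L"
    using bounded_linear.pos_bounded[OF test_functional_bounded_linear] by blast
  note tl = bounded_linear.linear[OF test_functional_bounded_linear[of g]]
  have "(resolvent_coeff z h g has_field_derivative D) (at \<omega>)"
  proof (rule has_field_derivative_if_quadratic_remainder[OF r(1)])
    fix \<omega>' assume w: "cmod (\<omega>' - \<omega>) < r"
    have "S z \<omega> (inv (S z \<omega>) f) - S z \<omega>' (inv (S z \<omega>) f) = cscale (\<omega> - \<omega>') (embed2 (inv (S z \<omega>) f))"
      by (simp add: S_eq cscale_diff_left)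
    then have "inv (S z \<omega>) (S z \<omega> (inv (S z \<omega>) f) - S z \<omega>' (inv (S z \<omega>) f))
        = cscale (\<omega> - \<omega>') (inv (S z \<omega>) (embed2 (inv (S z \<omega>) f)))"
      using inv_S_cscale[OF z om] by simp
    then have "resolvent_coeff z h g \<omega>' - resolvent_coeff z h g \<omega> - D * (\<omega>' - \<omega>)
      = test_functional g (inv (S z \<omega>') f - inv (S z \<omega>) f - inv (S z \<omega>) (S z \<omega> (inv (S z \<omega>) f) - S z \<omega>' (inv (S z \<omega>) f)))"
      by (simp add: linear_diff[OF tl] test_functional_cscale resolvent_coeff_eq f_def[symmetric] D_def)
        (simp add: algebra_simps)
    also have "cmod \<dots> \<le> ((C * cmod (\<omega> - \<omega>'))\<^sup>2 / c ^ 3 * norm f) * L"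
      by (rule order_trans[OF L(2)], rule mult_right_mono,
          rule inverse_expansion(2)[OF bl r(4)[OF om0] bl r(4)[OF w] r(2) r(5)[OF om0] r(5)[OF w] r(6)])
        (use L in simp)
    finally show "cmod (resolvent_coeff z h g \<omega>' - resolvent_coeff z h g \<omega> - D * (\<omega>' - \<omega>))
        \<le> (C\<^sup>2 / c ^ 3 * norm f * L) * (cmod (\<omega>' - \<omega>))\<^sup>2"
      by (simp add: power_mult_distrib norm_minus_commute mult_ac)
  qed
  then show "\<exists>D. (resolvent_coeff z h g has_field_derivative D) (at \<omega>)" ..
qed

end

section \<open>Circles with a real diameter\<close>

definition diameter_circle :: "real \<Rightarrow> real \<Rightarrow> real \<Rightarrow> complex" where
  "diameter_circle s t = circlepath (of_real ((s + t) / 2)) ((t - s) / 2)"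

lemma path_image_diameter_circle:
  "s \<le> t \<Longrightarrow> path_image (diameter_circle s t) = sphere (of_real ((s + t) / 2)) ((t - s) / 2)"
  by (simp add: diameter_circle_def)

lemma inside_diameter_circle:
  assumes "s \<le> t"
  shows "inside (path_image (diameter_circle s t)) = ball (of_real ((s + t) / 2)) ((t - s) / 2)"
  unfolding path_image_diameter_circle[OF assms]
  using inside_frontier_eq_interior[of "cball (complex_of_real ((s + t) / 2)) ((t - s) / 2)"] by simp

text \<open>No point of the circle is closer to a real \<open>x\<close> than the nearer end of the
  diameter, by triangle inequalities through the centre. The three alternatives place
  \<open>x\<close> to the left, to the right or between the ends.\<close>

lemma diameter_circle_distance:
  assumes "\<omega> \<in> path_image (diameter_circle s t)" "s \<le> t"
    and "x + e \<le> s \<or> t + e \<le> x \<or> (s + e \<le> x \<and> x + e \<le> t)"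
  shows "e \<le> cmod (\<omega> - of_real x)"
proof -
  let ?c = "complex_of_real ((s + t) / 2)"
  have R: "2 * cmod (\<omega> - ?c) = t - s"
    using assms(1) unfolding path_image_diameter_circle[OF assms(2)] by (simp add: dist_norm norm_minus_commute)
  have "cmod (?c - of_real x) = \<bar>(s + t) / 2 - x\<bar>"
    unfolding of_real_diff[symmetric] by (rule norm_of_real)
  then have X: "2 * cmod (?c - of_real x) = \<bar>s + t - 2 * x\<bar>" by (simp add: abs_if field_simps)
  have "cmod (\<omega> - ?c) \<le> cmod (\<omega> - of_real x) + cmod (?c - of_real x)"
    "cmod (?c - of_real x) \<le> cmod (\<omega> - of_real x) + cmod (\<omega> - ?c)"
    using norm_triangle_ineq4[of "\<omega> - of_real x" "?c - of_real x"]
      norm_triangle_ineq4[of "\<omega> - of_real x" "\<omega> - ?c"] by simp_all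
  with R X have "t - s \<le> 2 * cmod (\<omega> - of_real x) + \<bar>s + t - 2 * x\<bar>"
    "\<bar>s + t - 2 * x\<bar> \<le> 2 * cmod (\<omega> - of_real x) + (t - s)" by linarith+
  with assms(2,3) show ?thesis by linarith
qed

text \<open>The parametrisation is affine in the ends of the diameter, so a linear homotopy between
  two such circles runs through circles of the same kind.\<close>

lemma diameter_circle_interpolate:
  "(1 - v) *\<^sub>R diameter_circle s t x + v *\<^sub>R diameter_circle s' t' x
    = diameter_circle ((1 - v) * s + v * s') ((1 - v) * t + v * t') x"
  by (simp add: diameter_circle_def circlepath scaleR_conv_of_real) (simp add: field_simps)

lemma midpoint_distance:
  fixes s t x :: real
  shows "\<bar>(s + t) / 2 - x\<bar> < (t - s) / 2 \<longleftrightarrow> s < x \<and> x < t"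
    "\<bar>(s + t) / 2 - x\<bar> \<le> (t - s) / 2 \<longleftrightarrow> s \<le> x \<and> x \<le> t"
  by (auto simp: abs_less_iff abs_le_iff field_simps)

lemma of_real_in_inside_iff:
  assumes "s \<le> t"
  shows "of_real x \<in> inside (path_image (diameter_circle s t)) \<longleftrightarrow> s < x \<and> x < t"
proof -
  have "dist (complex_of_real ((s + t) / 2)) (of_real x) = \<bar>(s + t) / 2 - x\<bar>"
    unfolding dist_norm of_real_diff[symmetric] by (rule norm_of_real)
  then show ?thesis unfolding inside_diameter_circle[OF assms] mem_ball by (simp only: midpoint_distance)
qed

lemma inside_diameter_circle_Re:
  assumes "s \<le> t" "\<omega> \<in> inside (path_image (diameter_circle s t))"
  shows "s < Re \<omega>" "Re \<omega> < t"
proof -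
  have "cmod (of_real ((s + t) / 2) - \<omega>) < (t - s) / 2"
    using assms(2) unfolding inside_diameter_circle[OF assms(1)] mem_ball dist_norm .
  then have "\<bar>Re (of_real ((s + t) / 2) - \<omega>)\<bar> < (t - s) / 2"
    using abs_Re_le_cmod order_le_less_trans by blast
  then have "\<bar>(s + t) / 2 - Re \<omega>\<bar> < (t - s) / 2"
    unfolding minus_complex.simps Re_complex_of_real .
  then show "s < Re \<omega>" "Re \<omega> < t" by (simp_all only: midpoint_distance)
qed

lemma winding_number_diameter_circle:
  assumes "s < t" "x \<noteq> s" "x \<noteq> t"
  shows "winding_number (diameter_circle s t) (of_real x) = (if s < x \<and> x < t then 1 else 0)"
proof -
  let ?c = "complex_of_real ((s + t) / 2)"
  have d: "cmod (?c - of_real x) = \<bar>(s + t) / 2 - x\<bar>"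
    unfolding of_real_diff[symmetric] by (rule norm_of_real)
  show ?thesis
  proof (cases "s < x \<and> x < t")
    case True
    then have "cmod (?c - of_real x) < (t - s) / 2" unfolding d by (simp only: midpoint_distance)
    then have "cmod (of_real x - ?c) < (t - s) / 2" by (simp only: norm_minus_commute)
    then show ?thesis using winding_number_circlepath True by (simp add: diameter_circle_def)
  next
    case False
    then have "of_real x \<notin> cball ?c ((t - s) / 2)"
      using assms unfolding mem_cball dist_norm d midpoint_distance by auto
    moreover have "path_image (diameter_circle s t) \<subseteq> cball ?c ((t - s) / 2)"
      using assms by (auto simp: path_image_diameter_circle)
    ultimately have "winding_number (diameter_circle s t) (of_real x) = 0"
      by (intro winding_number_zero_outside[OF _ convex_cball]) (auto simp: diameter_circle_def)
    with False show ?thesis by auto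
  qed
qed

text \<open>Continuity makes the integrand integrable, and a bounded linear functional then passes
  under the integral.\<close>

lemma cinner_vec_contour_integral:
  fixes f :: "complex \<Rightarrow> 'a::{real_inner, banach} \<times> 'a"
  assumes f: "continuous_on (path_image (circlepath c r)) f"
  shows "cinner (vec_contour_integral (circlepath c r) f) g = contour_integral (circlepath c r) (\<lambda>\<omega>. cinner (f \<omega>) g)"
proof -
  let ?\<gamma> = "circlepath c r"
  define F where "F t = cscale (vector_derivative ?\<gamma> (at t within {0..1})) (f (?\<gamma> t))" for t
  have "continuous_on {0..1} (\<lambda>t. f (?\<gamma> t))"
    by (rule continuous_on_compose2[OF f])
      (auto simp: path_image_def simp del: path_image_circlepath intro: path_circlepath[unfolded path_def])
  moreover have "continuous_on {0..1} (\<lambda>t. 2 * of_real pi * \<i> * of_real r * exp (2 * of_real pi * \<i> * of_real t))"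
    by (intro continuous_intros)
  ultimately have "continuous_on {0..1} (\<lambda>t. cscale (2 * of_real pi * \<i> * of_real r * exp (2 * of_real pi * \<i> * of_real t)) (f (?\<gamma> t)))"
    unfolding cscale_def by (intro continuous_intros)
  then have "continuous_on {0..1} F"
    by (rule continuous_on_eq) (simp add: F_def vector_derivative_circlepath01)
  then have int: "F integrable_on {0..1}" by (rule integrable_continuous_interval)
  have "((\<lambda>t. cinner (F t) g) has_integral cinner (integral {0..1} F) g) {0..1}"
    using has_integral_linear[OF integrable_integral[OF int] cinner_bounded_linear_left[of g]] by (simp add: o_def)
  then have "((\<lambda>\<omega>. cinner (f \<omega>) g) has_contour_integral cinner (integral {0..1} F) g) ?\<gamma>"
    unfolding has_contour_integral_def by (simp add: F_def cinner_cscale_left mult.commute)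
  then show ?thesis unfolding vec_contour_integral_def F_def by (simp add: contour_integral_unique)
qed

section \<open>Maximal runs of a finite index set\<close>

text \<open>Index 0 needs its own clause because \<open>0 - 1 = 0\<close> for natural
  numbers.\<close>

definition run_starts :: "nat set \<Rightarrow> nat set" where
  "run_starts J = {i \<in> J. i = 0 \<or> i - 1 \<notin> J}"

definition run_end :: "nat set \<Rightarrow> nat \<Rightarrow> nat" where
  "run_end J i = (LEAST j. i \<le> j \<and> Suc j \<notin> J)"

lemma run_end:
  assumes "finite J" "i \<in> J"
  shows "i \<le> run_end J i" "Suc (run_end J i) \<notin> J" "{i..run_end J i} \<subseteq> J"
proof -
  have "Suc (Max J) \<notin> J" using Max_ge[OF assms(1), of "Suc (Max J)"] by auto
  then have "i \<le> Max J \<and> Suc (Max J) \<notin> J" using assms by simp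
  then have *: "i \<le> run_end J i \<and> Suc (run_end J i) \<notin> J"
    unfolding run_end_def by (rule LeastI)
  then show "i \<le> run_end J i" "Suc (run_end J i) \<notin> J" by auto
  have "k \<in> J" if "i \<le> k" "k \<le> run_end J i" for k
    using that
  proof (induction k rule: dec_induct)
    case (step n)
    then have "n < (LEAST j. i \<le> j \<and> Suc j \<notin> J)" by (simp add: run_end_def)
    then have "\<not> (i \<le> n \<and> Suc n \<notin> J)" by (rule not_less_Least)
    then show ?case using step by simp
  qed (use assms in simp)
  then show "{i..run_end J i} \<subseteq> J" by auto
qed

text \<open>The predecessor of a start is outside \<open>J\<close>, hence beyond the earlier run. So
  an eigenvalue outside the group lies between two neighbouring circles.\<close>

lemma run_starts_separated:
  assumes J: "finite J" and i: "i \<in> run_starts J" "i' \<in> run_starts J" "i < i'"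
  shows "Suc (run_end J i) \<le> i' - 1"
proof -
  have iJ: "i \<in> J" "i' \<in> J" "i' - 1 \<notin> J" using i by (auto simp: run_starts_def)
  note e = run_end[OF J iJ(1)]
  have "\<not> i' \<le> run_end J i"
  proof
    assume "i' \<le> run_end J i"
    then have "i' - 1 \<in> {i..run_end J i}" using i(3) by auto
    then show False using e(3) iJ(3) by blast
  qed
  moreover have "i' \<noteq> Suc (run_end J i)" using e(2) iJ(2) by auto
  ultimately show ?thesis by simp
qed

lemma run_exists:
  assumes J: "finite J" and "k \<in> J"
  shows "\<exists>i\<in>run_starts J. i \<le> k \<and> k \<le> run_end J i"
  using assms(2)
proof (induction k)
  case 0
  then show ?case using run_end(1)[OF J, of 0] by (auto simp: run_starts_def)
next
  case (Suc k)
  show ?case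
  proof (cases "k \<in> J")
    case True
    then obtain i where i: "i \<in> run_starts J" "i \<le> k" "k \<le> run_end J i" using Suc.IH by blast
    then have "run_end J i \<noteq> k" using run_end(2)[OF J, of i] Suc.prems by (auto simp: run_starts_def)
    then show ?thesis using i by (intro bexI[of _ i]) auto
  next
    case False
    then show ?thesis using Suc.prems run_end(1)[OF J, of "Suc k"] by (auto simp: run_starts_def)
  qed
qed

text \<open>The runs partition \<open>J\<close>. At real points this adds up the winding numbers of
  all circles around one eigenvalue.\<close>

lemma sum_run_indicator:
  assumes J: "finite J"
  shows "(\<Sum>i\<in>run_starts J. if i \<le> k \<and> k \<le> run_end J i then 1 else 0) = (if k \<in> J then 1 else (0::complex))"
proof (cases "k \<in> J")
  case True
  then obtain i where i: "i \<in> run_starts J" "i \<le> k" "k \<le> run_end J i" using run_exists[OF J] by blast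
  have unique: "i' = i" if "i' \<in> run_starts J" "i' \<le> k" "k \<le> run_end J i'" for i'
    using run_starts_separated[OF J i(1) that(1)] run_starts_separated[OF J that(1) i(1)] i that by linarith
  have "finite (run_starts J)" using J by (simp add: run_starts_def)
  have "(if i' \<le> k \<and> k \<le> run_end J i' then 1 else 0) = (if i' = i then 1 else (0::complex))"
    if "i' \<in> run_starts J" for i'
    using unique[OF that] i(2,3) by (cases "i' = i") auto
  then have "(\<Sum>i'\<in>run_starts J. if i' \<le> k \<and> k \<le> run_end J i' then 1 else 0)
      = (\<Sum>i'\<in>run_starts J. if i' = i then 1 else (0::complex))"
    by (rule sum.cong[OF refl])
  also have "\<dots> = 1" using i(1) \<open>finite (run_starts J)\<close> by simp
  finally show ?thesis using True by simp
next
  case False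
  then have "\<not> (i \<le> k \<and> k \<le> run_end J i)" if "i \<in> run_starts J" for i
    using run_end(3)[OF J, of i] that by (auto simp: run_starts_def)
  then have "(\<Sum>i\<in>run_starts J. if i \<le> k \<and> k \<le> run_end J i then 1 else 0) = (0::complex)"
    by (intro sum.neutral) auto
  with False show ?thesis by simp
qed

section \<open>Contours around isolated eigenvalues\<close>

locale isolated_eigenspaces = affine_form \<iota> b0 b \<alpha>\<^sub>0 \<kappa>
  for \<iota> :: "'v::{real_inner, banach} \<Rightarrow>\<^sub>L 'h::{real_inner, banach}" and b0 b \<alpha>\<^sub>0 \<kappa> +
  fixes \<mu> :: "(nat \<Rightarrow> real) \<Rightarrow> nat \<Rightarrow> real" and u :: "(nat \<Rightarrow> real) \<Rightarrow> nat \<Rightarrow> 'v"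
    and J :: "nat set" and \<delta> :: real
  assumes enumeration: "y \<in> param_box \<Longrightarrow> eigen_enumeration \<iota> (param_form b0 b y) (\<mu> y) (u y)"
    and finite_J: "finite J" and delta_pos: "0 < \<delta>" and isolated: "isolated_with \<mu> J \<delta>"
begin

text \<open>Equal to \<open>1 / (2 * (1 + 1 / \<delta>))\<close>, the factor that appears in the
  radii \<open>\<tau>\<close>.\<close>

definition \<eta> where "\<eta> = \<delta> / (2 * (1 + \<delta>))"

lemma eta_bounds: "0 < \<eta>" "\<eta> < 1"
  using delta_pos by (auto simp: \<eta>_def field_simps)

lemma eigensystem_at: "y \<in> param_box \<Longrightarrow> coercive_eigensystem \<iota> (param_form b0 b y) \<alpha> (\<mu> y) (u y)"
  by (rule eigensystem[OF _ enumeration])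

lemma mu_pos: "y \<in> param_box \<Longrightarrow> 0 < \<mu> y k"
  using coercive_eigensystem.eigenvalue_pos[OF eigensystem_at] .

lemma mu_mono: "y \<in> param_box \<Longrightarrow> k \<le> l \<Longrightarrow> \<mu> y k \<le> \<mu> y l"
  using coercive_eigensystem.mono_eigenvalues[OF eigensystem_at] by (simp add: monoD)

lemma mu_gap:
  assumes "y \<in> param_box" "j \<in> J" "k \<notin> J"
  shows "\<delta> * \<mu> y j \<le> \<bar>\<mu> y j - \<mu> y k\<bar>"
proof -
  have "\<mu> y j \<le> Max (\<mu> y ` J)" using finite_J assms(2) by simp
  then have "\<delta> * \<mu> y j \<le> \<delta> * Max (\<mu> y ` J)" using delta_pos by (intro mult_left_mono) auto
  also have "\<dots> \<le> setdist (\<mu> y ` J) (\<mu> y ` (- J))" using isolated assms(1) by (simp add: isolated_with_def)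
  also have "\<dots> \<le> dist (\<mu> y j) (\<mu> y k)" using assms by (intro setdist_le_dist) auto
  finally show ?thesis by (simp add: dist_real_def)
qed

text \<open>For \<open>i = 0\<close> there is no eigenvalue below the run and \<open>0\<close> takes its place.\<close>

definition lower :: "(nat \<Rightarrow> real) \<Rightarrow> nat \<Rightarrow> real" where
  "lower \<nu> i = ((if i = 0 then 0 else (1 + \<eta>) * \<nu> (i - 1)) + (1 - \<eta>) * \<nu> i) / 2"

definition upper :: "(nat \<Rightarrow> real) \<Rightarrow> nat \<Rightarrow> real" where
  "upper \<nu> i = ((1 + \<eta>) * \<nu> (run_end J i) + (1 - \<eta>) * \<nu> (Suc (run_end J i))) / 2"

text \<open>The circle avoids the bands \<open>[(1 - \<eta>) \<nu> k, (1 + \<eta>) \<nu> k]\<close>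
  of the neighbouring eigenvalues. The conditions are open and convex in the ends \<open>s\<close>
  and \<open>t\<close>: openness gives stability, convexity gives homotopies.\<close>

definition encloses_run :: "(nat \<Rightarrow> real) \<Rightarrow> nat \<Rightarrow> real \<Rightarrow> real \<Rightarrow> bool" where
  "encloses_run \<nu> i s t \<longleftrightarrow>
     (if i = 0 then 0 else (1 + \<eta>) * \<nu> (i - 1)) < s \<and> s < (1 - \<eta>) * \<nu> i \<and>
     (1 + \<eta>) * \<nu> (run_end J i) < t \<and> t < (1 - \<eta>) * \<nu> (Suc (run_end J i))"

lemma encloses_run_lower_upper:
  assumes y: "y \<in> param_box" and i: "i \<in> run_starts J"
  shows "encloses_run (\<mu> y) i (lower (\<mu> y) i) (upper (\<mu> y) i)"
proof -
  have iJ: "i \<in> J" using i by (simp add: run_starts_def)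
  note e = run_end[OF finite_J iJ]
  \<comment> \<open>Rewriting \<open>\<delta>\<close> this way leaves slack
    \<open>3 * \<eta> * \<delta>\<close> below the run and \<open>\<eta> * \<delta>\<close> above
    it, relative to the eigenvalue of the run.\<close>
  have eta: "\<eta> * (2 + 2 * \<delta>) = \<delta>" using delta_pos by (simp add: \<eta>_def field_simps)
  have ed: "0 < \<eta> * \<delta>" using eta_bounds delta_pos by simp
  have low: "(if i = 0 then 0 else (1 + \<eta>) * \<mu> y (i - 1)) < (1 - \<eta>) * \<mu> y i"
  proof (cases "i = 0")
    case True
    then show ?thesis using mu_pos[OF y] eta_bounds by simp
  next
    case False
    then have n: "i - 1 \<notin> J" using i by (simp add: run_starts_def)
    have "\<mu> y (i - 1) \<le> \<mu> y i" by (rule mu_mono[OF y]) simp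
    with mu_gap[OF y iJ n] have "\<mu> y (i - 1) \<le> (1 - \<delta>) * \<mu> y i" by (simp add: algebra_simps)
    then have "(1 + \<eta>) * \<mu> y (i - 1) \<le> (1 + \<eta>) * ((1 - \<delta>) * \<mu> y i)" using eta_bounds by (intro mult_left_mono) auto
    also have "\<dots> = ((1 + \<eta>) * (1 - \<delta>)) * \<mu> y i" by simp
    also have "\<dots> < (1 - \<eta>) * \<mu> y i"
      using eta ed mu_pos[OF y, of i] by (intro mult_strict_right_mono) (simp_all add: algebra_simps)
    finally show ?thesis using False by simp
  qed
  let ?j = "run_end J i"
  have jJ: "?j \<in> J" using e by auto
  have "\<mu> y ?j \<le> \<mu> y (Suc ?j)" by (rule mu_mono[OF y]) simp
  with mu_gap[OF y jJ e(2)] have "(1 + \<delta>) * \<mu> y ?j \<le> \<mu> y (Suc ?j)" by (simp add: algebra_simps)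
  then have "(1 - \<eta>) * ((1 + \<delta>) * \<mu> y ?j) \<le> (1 - \<eta>) * \<mu> y (Suc ?j)" using eta_bounds by (intro mult_left_mono) auto
  moreover have "(1 + \<eta>) * \<mu> y ?j < ((1 - \<eta>) * (1 + \<delta>)) * \<mu> y ?j"
    using eta ed eta_bounds mu_pos[OF y, of ?j] by (intro mult_strict_right_mono) (simp_all add: algebra_simps)
  ultimately have up: "(1 + \<eta>) * \<mu> y ?j < (1 - \<eta>) * \<mu> y (Suc ?j)" by simp
  have "a < (a + b) / 2 \<and> (a + b) / 2 < b" if "a < b" for a b :: real
    using that by (simp add: field_simps)
  from this[OF low] this[OF up] show ?thesis unfolding encloses_run_def lower_def upper_def by blast
qed

lemma encloses_run_less:
  assumes y: "y \<in> param_box" and i: "i \<in> run_starts J" and "encloses_run (\<mu> y) i s t"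
  shows "0 < s" "s < \<mu> y i" "\<mu> y (run_end J i) < t" "s < t"
proof -
  have iJ: "i \<in> J" using i by (simp add: run_starts_def)
  have "0 \<le> (if i = 0 then 0 else (1 + \<eta>) * \<mu> y (i - 1))"
    using mu_pos[OF y, of "i - 1"] eta_bounds by (simp add: less_imp_le)
  then show "0 < s" using assms(3) by (simp add: encloses_run_def)
  show s: "s < \<mu> y i" using assms(3) mult_pos_pos[OF eta_bounds(1) mu_pos[OF y, of i]]
    by (simp add: encloses_run_def algebra_simps)
  show t: "\<mu> y (run_end J i) < t"
    using assms(3) mult_pos_pos[OF eta_bounds(1) mu_pos[OF y, of "run_end J i"]]
    by (simp add: encloses_run_def algebra_simps)
  show "s < t" using s t mu_mono[OF y run_end(1)[OF finite_J iJ]] by simp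
qed

text \<open>Monotonicity extends the conditions at the four boundary indices of the run to every
  \<open>k\<close>.\<close>

lemma encloses_run_cases:
  assumes y: "y \<in> param_box" and i: "i \<in> run_starts J" and "encloses_run (\<mu> y) i s t"
  shows "\<mu> y k + \<eta> * \<mu> y k \<le> s \<and> k < i \<or> t + \<eta> * \<mu> y k \<le> \<mu> y k \<and> run_end J i < k
    \<or> (s + \<eta> * \<mu> y k \<le> \<mu> y k \<and> \<mu> y k + \<eta> * \<mu> y k \<le> t \<and> i \<le> k \<and> k \<le> run_end J i)"
proof -
  have e: "0 \<le> 1 + \<eta>" "0 \<le> 1 - \<eta>" using eta_bounds by auto
  consider "k < i" | "run_end J i < k" | "i \<le> k" "k \<le> run_end J i" by linarith
  then show ?thesis
  proof cases
    case 1
    have "(1 + \<eta>) * \<mu> y k \<le> (1 + \<eta>) * \<mu> y (i - 1)" using e 1 by (intro mult_left_mono mu_mono[OF y]) auto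
    then show ?thesis using assms(3) 1 by (simp add: encloses_run_def algebra_simps)
  next
    case 2
    have "(1 - \<eta>) * \<mu> y (Suc (run_end J i)) \<le> (1 - \<eta>) * \<mu> y k" using e 2 by (intro mult_left_mono mu_mono[OF y]) auto
    then show ?thesis using assms(3) 2 by (simp add: encloses_run_def algebra_simps)
  next
    case 3
    have "(1 - \<eta>) * \<mu> y i \<le> (1 - \<eta>) * \<mu> y k" "(1 + \<eta>) * \<mu> y k \<le> (1 + \<eta>) * \<mu> y (run_end J i)"
      using e 3 by (auto intro!: mult_left_mono mu_mono[OF y])
    then show ?thesis using assms(3) 3 by (simp add: encloses_run_def algebra_simps)
  qed
qed

lemma encloses_run_separation:
  assumes y: "y \<in> param_box" and i: "i \<in> run_starts J" and enc: "encloses_run (\<mu> y) i s t"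
    and om: "\<omega> \<in> path_image (diameter_circle s t)"
  shows "\<eta> * \<mu> y k \<le> cmod (\<omega> - of_real (\<mu> y k))"
  using encloses_run_cases[OF y i enc, of k] encloses_run_less(4)[OF y i enc]
  by (intro diameter_circle_distance[OF om]) auto

lemma circle_regular:
  assumes y: "y \<in> param_box" and i: "i \<in> run_starts J" and enc: "encloses_run (\<mu> y) i s t"
    and om: "\<omega> \<in> path_image (diameter_circle s t)"
    and z: "admissible z" "weight (\<lambda>m. z m - of_real (y m)) \<le> \<theta> * (1 - K)" "\<theta> < \<eta>"
  shows "surj (S z \<omega>)" "(\<eta> - \<theta>) * \<alpha> * norm x \<le> norm (S z \<omega> x)" "\<omega> \<notin> spec z"
proof -
  note sep = encloses_run_separation[OF y i enc om]
  show s: "surj (S z \<omega>)"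
    by (rule S_surj[OF y enumeration[OF y] z sep])
  show "(\<eta> - \<theta>) * \<alpha> * norm x \<le> norm (S z \<omega> x)" for x
    by (rule S_lower_bound[OF y enumeration[OF y] z(1,2) eta_bounds(1) sep])
  then show "\<omega> \<notin> spec z"
    using z(3) alpha_pos by (intro not_in_specI[OF z(1) s, of "(\<eta> - \<theta>) * \<alpha>"]) auto
qed

text \<open>Admissible pairs of ends form a convex set, so the linear homotopy consists of circles
  that all enclose the run and stay in the resolvent set, where the matrix element is
  holomorphic.\<close>

lemma contour_integral_independent:
  assumes y: "y \<in> param_box" and i: "i \<in> run_starts J"
    and enc: "encloses_run (\<mu> y) i s t" "encloses_run (\<mu> y) i s' t'"
    and z: "admissible z" "weight (\<lambda>m. z m - of_real (y m)) \<le> \<theta> * (1 - K)" "\<theta> < \<eta>"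
  shows "contour_integral (diameter_circle s t) (resolvent_coeff z h g)
       = contour_integral (diameter_circle s' t') (resolvent_coeff z h g)"
proof (rule Cauchy_theorem_homotopic_loops[OF _ open_resolvent_set[OF z(1)] resolvent_coeff_holomorphic[OF z(1)]])
  show "homotopic_loops (- spec z) (diameter_circle s t) (diameter_circle s' t')"
  proof (rule homotopic_loops_linear)
    fix x :: real assume x: "x \<in> {0..1}"
    show "closed_segment (diameter_circle s t x) (diameter_circle s' t' x) \<subseteq> - spec z"
    proof
      fix \<omega> assume "\<omega> \<in> closed_segment (diameter_circle s t x) (diameter_circle s' t' x)"
      then obtain v where v: "0 \<le> v" "v \<le> 1"
        "\<omega> = diameter_circle ((1 - v) * s + v * s') ((1 - v) * t + v * t') x"
        unfolding closed_segment_def by (auto simp: diameter_circle_interpolate)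
      \<comment> \<open>A convex combination of two points of the interval between \<open>a\<close>
        and \<open>c\<close> remains strictly inside; the lower bound is the upper one after a
        change of sign.\<close>
      have conv: "a < (1 - v) * b + v * b' \<and> (1 - v) * b + v * b' < c" if "a < b" "a < b'" "b < c" "b' < c" for a b b' c :: real
        using convex_bound_lt[of b c b' "1 - v" v] convex_bound_lt[of "- b" "- a" "- b'" "1 - v" v] that v
        by (simp add: algebra_simps)
      have "encloses_run (\<mu> y) i ((1 - v) * s + v * s') ((1 - v) * t + v * t')"
        using enc conv unfolding encloses_run_def by blast
      moreover have "\<omega> \<in> path_image (diameter_circle ((1 - v) * s + v * s') ((1 - v) * t + v * t'))"
        using x v(3) by (auto simp: path_image_def)
      ultimately show "\<omega> \<in> - spec z" using circle_regular(3)[OF y i _ _ z] by simp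
    qed
  qed (simp_all add: diameter_circle_def)
qed (simp_all add: diameter_circle_def)

section \<open>The family of contours attached to a real parameter\<close>

definition contours :: "(nat \<Rightarrow> real) \<Rightarrow> (real \<Rightarrow> complex) set" where
  "contours y = (\<lambda>i. diameter_circle (lower (\<mu> y) i) (upper (\<mu> y) i)) ` run_starts J"

lemma finite_run_starts: "finite (run_starts J)"
  using finite_J by (simp add: run_starts_def)

text \<open>The eigenvalues with indices \<open>Suc (run_end J i)\<close> and \<open>i' - 1\<close>,
  possibly the same one, lie between the two circles.\<close>

lemma upper_less_lower:
  assumes y: "y \<in> param_box" and i: "i \<in> run_starts J" "i' \<in> run_starts J" "i < i'"
  shows "upper (\<mu> y) i < lower (\<mu> y) i'"
proof -
  have "upper (\<mu> y) i < (1 - \<eta>) * \<mu> y (Suc (run_end J i))"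
    using encloses_run_lower_upper[OF y i(1)] by (simp add: encloses_run_def)
  also have "\<dots> \<le> 1 * \<mu> y (Suc (run_end J i))"
    using eta_bounds mu_pos[OF y] by (intro mult_right_mono) (auto simp: less_imp_le)
  also have "\<dots> \<le> 1 * \<mu> y (i' - 1)" using run_starts_separated[OF finite_J i] by (simp add: mu_mono[OF y])
  also have "\<dots> \<le> (1 + \<eta>) * \<mu> y (i' - 1)"
    using eta_bounds mu_pos[OF y] by (intro mult_right_mono) (auto simp: less_imp_le)
  also have "\<dots> < lower (\<mu> y) i'" using encloses_run_lower_upper[OF y i(2)] i(3) by (simp add: encloses_run_def)
  finally show ?thesis .
qed

lemma lower_less_upper:
  assumes "y \<in> param_box" "i \<in> run_starts J"
  shows "lower (\<mu> y) i < upper (\<mu> y) i"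
  using encloses_run_less(4)[OF assms encloses_run_lower_upper[OF assms]] .

lemma contours_disjoint:
  assumes y: "y \<in> param_box" and i: "i \<in> run_starts J" "i' \<in> run_starts J" "i \<noteq> i'"
  shows "inside (path_image (diameter_circle (lower (\<mu> y) i) (upper (\<mu> y) i))) \<inter>
    inside (path_image (diameter_circle (lower (\<mu> y) i') (upper (\<mu> y) i'))) = {}"
proof -
  have "upper (\<mu> y) i < lower (\<mu> y) i' \<or> upper (\<mu> y) i' < lower (\<mu> y) i"
    using upper_less_lower[OF y] i by (meson nat_neq_iff)
  then show ?thesis
    using inside_diameter_circle_Re[OF less_imp_le[OF lower_less_upper[OF y i(1)]]]
      inside_diameter_circle_Re[OF less_imp_le[OF lower_less_upper[OF y i(2)]]] by fastforce
qed

text \<open>The contours form a set, in which coinciding circles would be counted once. Their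
  insides are disjoint and nonempty, so none coincide.\<close>

lemma contours_inj:
  assumes y: "y \<in> param_box"
  shows "inj_on (\<lambda>i. diameter_circle (lower (\<mu> y) i) (upper (\<mu> y) i)) (run_starts J)"
proof (rule inj_onI, rule ccontr)
  fix i i' assume i: "i \<in> run_starts J" "i' \<in> run_starts J" "i \<noteq> i'"
    and eq: "diameter_circle (lower (\<mu> y) i) (upper (\<mu> y) i) = diameter_circle (lower (\<mu> y) i') (upper (\<mu> y) i')"
  have "of_real ((lower (\<mu> y) i + upper (\<mu> y) i) / 2) \<in> inside (path_image (diameter_circle (lower (\<mu> y) i) (upper (\<mu> y) i)))"
    using lower_less_upper[OF y i(1)] by (subst of_real_in_inside_iff) auto
  with contours_disjoint[OF y i] eq show False by auto
qed

lemma sum_contours: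
  assumes "y \<in> param_box"
  shows "(\<Sum>\<gamma>\<in>contours y. f \<gamma>) = (\<Sum>i\<in>run_starts J. f (diameter_circle (lower (\<mu> y) i) (upper (\<mu> y) i)))"
  unfolding contours_def using sum.reindex[OF contours_inj[OF assms]] by simp

lemma cinner_riesz_projection:
  assumes y: "y \<in> param_box"
    and z: "admissible z" "weight (\<lambda>m. z m - of_real (y m)) \<le> \<theta> * (1 - K)" "\<theta> < \<eta>"
  shows "cinner (riesz_projection \<iota> (param_op b0 b z) (contours y) h) g = 1 / (2 * of_real pi * \<i>) *
    (\<Sum>i\<in>run_starts J. contour_integral (diameter_circle (lower (\<mu> y) i) (upper (\<mu> y) i)) (resolvent_coeff z h g))"
proof -
  have "cinner (vec_contour_integral (diameter_circle (lower (\<mu> y) i) (upper (\<mu> y) i)) (\<lambda>\<omega>. resolvent \<iota> (param_op b0 b z) \<omega> h)) g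
      = contour_integral (diameter_circle (lower (\<mu> y) i) (upper (\<mu> y) i)) (resolvent_coeff z h g)" if i: "i \<in> run_starts J" for i
    unfolding resolvent_coeff_def[abs_def] diameter_circle_def
  proof (rule cinner_vec_contour_integral, rule continuous_on_resolvent[OF z(1)])
    show "path_image (circlepath (complex_of_real ((lower (\<mu> y) i + upper (\<mu> y) i) / 2)) ((upper (\<mu> y) i - lower (\<mu> y) i) / 2)) \<inter> spec z = {}"
      using circle_regular(3)[OF y i encloses_run_lower_upper[OF y i] _ z] unfolding diameter_circle_def by blast
  qed
  then show ?thesis
    unfolding riesz_projection_def cinner_cscale_left sum_contours[OF y]
      linear_sum[OF bounded_linear.linear[OF cinner_bounded_linear_left]]
    by (intro arg_cong2[of _ _ _ _ "(*)"] sum.cong) auto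
qed

lemma contours_enclosing:
  assumes y: "y \<in> param_box"
    and z: "admissible z" "weight (\<lambda>m. z m - of_real (y m)) \<le> \<theta> * (1 - K)" "\<theta> < \<eta>"
  shows "spectral_projection \<iota> (param_op b0 b z) (riesz_projection \<iota> (param_op b0 b z) (contours y))"
proof -
  \<comment> \<open>At complex \<open>z\<close> no individual eigenvalue is followed: the enclosed
    group is whatever part of the spectrum lies inside.\<close>
  define T where "T = spec z \<inter> (\<Union>\<gamma>\<in>contours y. inside (path_image \<gamma>))"
  have sub: "T \<subseteq> eigenvalues \<iota> (param_op b0 b z)"
  proof (cases "run_starts J = {}")
    case True
    then show ?thesis by (simp add: T_def contours_def)
  next
    case False
    then obtain i where i: "i \<in> run_starts J" by blast
    \<comment> \<open>The starting point of any contour is a regular point to feed into the Fredholm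
      argument. Without contours the enclosed set is empty.\<close>
    have "diameter_circle (lower (\<mu> y) i) (upper (\<mu> y) i) 0 \<notin> spec z"
      by (rule circle_regular(3)[OF y i encloses_run_lower_upper[OF y i] _ z]) (auto simp: path_image_def)
    then show ?thesis using spec_subset_eigenvalues[OF z(1)] by (auto simp: T_def)
  qed
  have "curves_enclosing (contours y) (spec z) T"
    unfolding curves_enclosing_def
  proof (intro conjI ballI)
    show "finite (contours y)" by (simp add: contours_def finite_run_starts)
    show "disjoint_family_on (\<lambda>\<gamma>. inside (path_image \<gamma>)) (contours y)"
      unfolding disjoint_family_on_def contours_def using contours_disjoint[OF y] by (auto simp: Int_commute)
    fix \<gamma> assume "\<gamma> \<in> contours y"
    then obtain i where i: "i \<in> run_starts J" "\<gamma> = diameter_circle (lower (\<mu> y) i) (upper (\<mu> y) i)"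
      by (auto simp: contours_def)
    note lu = lower_less_upper[OF y i(1)]
    show "valid_path \<gamma>" "pathfinish \<gamma> = pathstart \<gamma>" by (simp_all add: i(2) diameter_circle_def)
    show "simple_path \<gamma>" using lu by (simp add: i(2) diameter_circle_def simple_path_circlepath)
    show "path_image \<gamma> \<inter> spec z = {}"
      using circle_regular(3)[OF y i(1) encloses_run_lower_upper[OF y i(1)] _ z] i(2) by blast
    fix w assume "w \<in> inside (path_image \<gamma>)"
    then show "winding_number \<gamma> w = 1"
      unfolding i(2) inside_diameter_circle[OF less_imp_le[OF lu]]
      by (simp add: diameter_circle_def winding_number_circlepath dist_norm norm_minus_commute)
  qed (simp add: T_def)
  with sub show ?thesis unfolding spectral_projection_def by blast
qed

section \<open>The Riesz projection at real parameters\<close>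

lemma resolvent_coeff_real:
  assumes y: "y \<in> param_box" and om: "\<omega> \<notin> spec (\<lambda>m. of_real (y m))"
  shows "(\<omega> - of_real (\<mu> y k)) * resolvent_coeff (\<lambda>m. of_real (y m)) h (\<iota> (u y k), 0) \<omega> = cinner h (\<iota> (u y k), 0)"
proof -
  interpret E: coercive_eigensystem \<iota> "param_form b0 b y" \<alpha> "\<mu> y" "u y" by (rule eigensystem_at[OF y])
  let ?y = "\<lambda>m. complex_of_real (y m)"
  define x where "x = inv (S ?y \<omega>) (map_prod (dual_embed \<iota>) (dual_embed \<iota>) h)"
  have Sx: "S ?y \<omega> x = map_prod (dual_embed \<iota>) (dual_embed \<iota>) h"
    using om unfolding not_in_spec_iff x_def by (simp add: bij_is_surj surj_f_inv_f)
  \<comment> \<open>Two test vectors are needed because \<open>dual_pairing\<close> records only a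
    real part. Symmetry of the form moves the operator onto the eigenvector.\<close>
  have "dual_pairing (S ?y \<omega> x) (u y k, 0) = fst h \<bullet> \<iota> (u y k)"
    "dual_pairing (S ?y \<omega> x) (0, u y k) = snd h \<bullet> \<iota> (u y k)"
    unfolding Sx by (simp_all add: dual_pairing_def)
  then show ?thesis
    unfolding S_real_pairing[OF param_box_admissible[OF y]]
    by (simp add: resolvent_coeff_eq x_def[symmetric] test_functional_def cinner_def complex_eq_iff
        E.eigen_eq' E.a.zero_right algebra_simps)
qed

text \<open>Tested against \<open>u y k\<close>, the resolvent is a constant times
  \<open>1 / (\<omega> - \<mu> y k)\<close>, so each circle contributes its winding number about
  \<open>\<mu> y k\<close>.\<close>

lemma riesz_projection_real_coeff:
  assumes y: "y \<in> param_box"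
  shows "cinner (riesz_projection \<iota> (param_op b0 b (\<lambda>m. of_real (y m))) (contours y) h) (\<iota> (u y k), 0)
    = (if k \<in> J then cinner h (\<iota> (u y k), 0) else 0)"
proof -
  let ?y = "\<lambda>m. complex_of_real (y m)"
  have z: "admissible ?y" "weight (\<lambda>m. ?y m - of_real (y m)) \<le> 0 * (1 - K)" "0 < \<eta>"
    using param_box_admissible[OF y] eta_bounds by (auto simp: weight_def)
  let ?C = "cinner h (\<iota> (u y k), 0)"
  have int: "contour_integral (diameter_circle (lower (\<mu> y) i) (upper (\<mu> y) i)) (resolvent_coeff ?y h (\<iota> (u y k), 0))
      = (if i \<le> k \<and> k \<le> run_end J i then 1 else 0) * (2 * of_real pi * \<i> * ?C)" if i: "i \<in> run_starts J" for i
  proof -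
    note enc = encloses_run_lower_upper[OF y i]
    let ?s = "lower (\<mu> y) i" and ?t = "upper (\<mu> y) i"
    have lu: "?s < ?t" by (rule lower_less_upper[OF y i])
    have em: "0 < \<eta> * \<mu> y k" using eta_bounds mu_pos[OF y] by simp
    have eq: "resolvent_coeff ?y h (\<iota> (u y k), 0) \<omega> = ?C * (1 / (\<omega> - of_real (\<mu> y k)))"
      if "\<omega> \<in> path_image (diameter_circle ?s ?t)" for \<omega>
    proof -
      have "\<omega> \<noteq> of_real (\<mu> y k)" using encloses_run_separation[OF y i enc that, of k] em by auto
      then show ?thesis using resolvent_coeff_real[OF y circle_regular(3)[OF y i enc that z], of k h]
        by (simp add: field_simps)
    qed
    have notin: "of_real (\<mu> y k) \<notin> path_image (diameter_circle ?s ?t)"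
      using encloses_run_separation[OF y i enc, of "of_real (\<mu> y k)" k] em by auto
    have "contour_integral (diameter_circle ?s ?t) (resolvent_coeff ?y h (\<iota> (u y k), 0))
        = contour_integral (diameter_circle ?s ?t) (\<lambda>\<omega>. ?C * (1 / (\<omega> - of_real (\<mu> y k))))"
      by (rule contour_integral_cong) (use eq in auto)
    also have "\<dots> = ?C * contour_integral (diameter_circle ?s ?t) (\<lambda>\<omega>. 1 / (\<omega> - of_real (\<mu> y k)))"
      by (rule contour_integral_lmul) (rule contour_integrable_inversediff[OF _ notin], simp add: diameter_circle_def)
    also have "contour_integral (diameter_circle ?s ?t) (\<lambda>\<omega>. 1 / (\<omega> - of_real (\<mu> y k)))
        = 2 * of_real pi * \<i> * winding_number (diameter_circle ?s ?t) (of_real (\<mu> y k))"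
      using winding_number_valid_path[OF _ notin] by (simp add: diameter_circle_def)
    also have "winding_number (diameter_circle ?s ?t) (of_real (\<mu> y k)) = (if i \<le> k \<and> k \<le> run_end J i then 1 else 0)"
      using encloses_run_cases[OF y i enc, of k] em lu
      by (subst winding_number_diameter_circle[OF lu]) auto
    finally show ?thesis by simp
  qed
  have "cinner (riesz_projection \<iota> (param_op b0 b ?y) (contours y) h) (\<iota> (u y k), 0)
      = 1 / (2 * of_real pi * \<i>) * ((\<Sum>i\<in>run_starts J. if i \<le> k \<and> k \<le> run_end J i then 1 else 0) * (2 * of_real pi * \<i> * ?C))"
    unfolding cinner_riesz_projection[OF y z] sum_distrib_right
    by (intro arg_cong2[of _ _ _ _ "(*)"] sum.cong refl int)
  then show ?thesis unfolding sum_run_indicator[OF finite_J] by simp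
qed

lemma riesz_projection_real:
  assumes y: "y \<in> param_box"
  shows "orth_projection_onto ((\<iota> ` span (u y ` J)) \<times> (\<iota> ` span (u y ` J)))
    (riesz_projection \<iota> (param_op b0 b (\<lambda>m. of_real (y m))) (contours y))"
  unfolding orth_projection_onto_def
proof (intro allI conjI ballI)
  interpret E: coercive_eigensystem \<iota> "param_form b0 b y" \<alpha> "\<mu> y" "u y" by (rule eigensystem_at[OF y])
  fix h
  define X where "X = riesz_projection \<iota> (param_op b0 b (\<lambda>m. of_real (y m))) (contours y) h"
  define Q where "Q a = (\<Sum>k\<in>J. (a \<bullet> \<iota> (u y k)) *\<^sub>R u y k)" for a :: 'h
  have Qk: "\<iota> (Q a) \<bullet> \<iota> (u y k) = (if k \<in> J then a \<bullet> \<iota> (u y k) else 0)" for a k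
    using finite_J by (simp add: Q_def blinfun.sum_right blinfun.scaleR_right inner_sum_left E.orthonormal if_distrib sum.delta cong: if_cong)
  have Xk: "fst X \<bullet> \<iota> (u y k) = (if k \<in> J then fst h \<bullet> \<iota> (u y k) else 0)"
    "snd X \<bullet> \<iota> (u y k) = (if k \<in> J then snd h \<bullet> \<iota> (u y k) else 0)" for k
    using riesz_projection_real_coeff[OF y, of h k] by (auto simp: X_def[symmetric] cinner_def complex_eq_iff split: if_splits)
  \<comment> \<open>By completeness, agreement of all coefficients against the \<open>u y k\<close>
    already forces equality in \<open>H\<close>.\<close>
  have "fst X - \<iota> (Q (fst h)) = 0" "snd X - \<iota> (Q (snd h)) = 0"
    by (rule E.eigenvectors_total; simp add: inner_diff_left Qk Xk)+
  then have X: "X = (\<iota> (Q (fst h)), \<iota> (Q (snd h)))" by (simp add: prod_eq_iff)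
  have Qs: "Q a \<in> span (u y ` J)" for a unfolding Q_def by (intro span_sum span_scale span_base) auto
  show "X \<in> (\<iota> ` span (u y ` J)) \<times> (\<iota> ` span (u y ` J))" using X Qs by simp
  have orth: "(a - \<iota> (Q a)) \<bullet> \<iota> v = 0" if "v \<in> span (u y ` J)" for a v
    using that
  proof (induction rule: span_induct_alt)
    case (step c w v)
    then show ?case by (auto simp: blinfun.add_right blinfun.scaleR_right inner_add_right inner_diff_left Qk)
  qed simp
  fix w assume "w \<in> (\<iota> ` span (u y ` J)) \<times> (\<iota> ` span (u y ` J))"
  then obtain v v' where v: "w = (\<iota> v, \<iota> v')" "v \<in> span (u y ` J)" "v' \<in> span (u y ` J)" by auto
  show "cinner (h - X) w = 0"
    by (simp add: X v(1) cinner_def complex_eq_iff orth[OF v(2)] orth[OF v(3)])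
qed

end

section \<open>Analytic dependence on the parameters\<close>

text \<open>The nearest point of the box, coordinate by coordinate. It is 1-Lipschitz, which keeps
  the contours chosen for nearby \<open>z\<close> comparable.\<close>

definition box_clamp :: "(nat \<Rightarrow> complex) \<Rightarrow> nat \<Rightarrow> real" where
  "box_clamp z m = max (- 1) (min 1 (Re (z m)))"

lemma box_clamp_in_box: "box_clamp z \<in> param_box"
  by (auto simp: param_box_def box_clamp_def)

lemma box_clamp_real: "y \<in> param_box \<Longrightarrow> box_clamp (\<lambda>m. of_real (y m)) = y"
  by (auto simp: param_box_def box_clamp_def fun_eq_iff max_def min_def intro: order.antisym)

lemma box_clamp_lipschitz: "\<bar>box_clamp z m - box_clamp w m\<bar> \<le> cmod (z m - w m)"
proof -
  have "\<bar>box_clamp z m - box_clamp w m\<bar> \<le> \<bar>Re (z m) - Re (w m)\<bar>" by (auto simp: box_clamp_def max_def min_def)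
  also have "\<dots> \<le> cmod (z m - w m)" using abs_Re_le_cmod[of "z m - w m"] by simp
  finally show ?thesis .
qed

lemma box_clamp_nearest: "cmod (z m - of_real (box_clamp z m)) \<le> infdist (z m) (of_real ` {-1..1})"
proof -
  have "cmod (z m - of_real (box_clamp z m)) \<le> dist (z m) (of_real x)" if "x \<in> {-1..1}" for x :: real
  proof -
    have "\<bar>Re (z m) - box_clamp z m\<bar> \<le> \<bar>Re (z m) - x\<bar>" using that by (auto simp: box_clamp_def max_def min_def)
    then have "(Re (z m) - box_clamp z m)\<^sup>2 \<le> (Re (z m) - x)\<^sup>2" by (simp add: abs_le_square_iff)
    then show ?thesis by (simp add: dist_norm cmod_def)
  qed
  then show ?thesis by (auto simp: infdist_def intro!: cINF_greatest)
qed

section \<open>First-order expansion in the parameters\<close>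

context affine_form
begin

text \<open>The partial derivative of \<open>resolvent_coeff\<close> with respect to the coordinate
  \<open>m\<close>. Its sign is positive because \<open>S z \<omega>\<close> contains
  \<open>- B(z)\<close>.\<close>

definition resolvent_deriv :: "(nat \<Rightarrow> complex) \<Rightarrow> 'h \<times> 'h \<Rightarrow> 'h \<times> 'h \<Rightarrow> nat \<Rightarrow> complex \<Rightarrow> complex" where
  "resolvent_deriv z h g m \<omega> = test_functional g (inv (S z \<omega>) (map_prod (form_op (b m)) (form_op (b m))
     (inv (S z \<omega>) (map_prod (dual_embed \<iota>) (dual_embed \<iota>) h))))"

lemma continuous_on_resolvent_coeff:
  assumes "admissible z" "T \<inter> spec z = {}"
  shows "continuous_on T (resolvent_coeff z h g)" "continuous_on T (resolvent_deriv z h g m)"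
proof -
  show "continuous_on T (resolvent_coeff z h g)"
    unfolding resolvent_coeff_eq[abs_def]
    by (intro bounded_linear.continuous_on[OF test_functional_bounded_linear] continuous_on_inv_S assms continuous_intros)
  show "continuous_on T (resolvent_deriv z h g m)"
    unfolding resolvent_deriv_def[abs_def]
    by (intro bounded_linear.continuous_on[OF test_functional_bounded_linear] continuous_on_inv_S assms
        bounded_linear.continuous_on[OF bounded_linear_map_prod[OF blinfun.bounded_linear_right blinfun.bounded_linear_right]]
        continuous_intros)
qed

lemma pert_finite:
  assumes "finite M" "\<And>m. m \<notin> M \<Longrightarrow> w m = 0"
  shows "pert w x = (\<Sum>m\<in>M. cscale (w m) (map_prod (form_op (b m)) (form_op (b m)) x))"
  unfolding pert_def by (rule suminf_finite[OF assms(1)]) (simp add: assms(2))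

lemma weight_finite:
  assumes "finite M" "\<And>m. m \<notin> M \<Longrightarrow> w m = 0"
  shows "weight w = (\<Sum>m\<in>M. \<kappa> m * cmod (w m))"
  unfolding weight_def by (rule suminf_finite[OF assms(1)]) (simp add: assms(2))

text \<open>Both claims come from \<open>inverse_expansion\<close>, the difference of the operators
  being \<open>pert (\<lambda>m. w m - z m)\<close>. If only finitely many coordinates change, this
  series is a finite sum and the linear term splits into partial derivatives.\<close>

lemma resolvent_coeff_expansion:
  fixes h :: "'h \<times> 'h"
  assumes z: "admissible z" "surj (S z \<omega>)" "\<And>x. c * norm x \<le> norm (S z \<omega> x)"
    and w: "admissible w" "surj (S w \<omega>)" "\<And>x. c * norm x \<le> norm (S w \<omega> x)"
    and c: "0 < c" and L: "0 \<le> L" "\<And>x. norm (test_functional g x) \<le> norm x * L"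
  defines "f \<equiv> map_prod (dual_embed \<iota>) (dual_embed \<iota>) h"
  shows "cmod (resolvent_coeff w h g \<omega> - resolvent_coeff z h g \<omega>)
      \<le> (2 * \<alpha>\<^sub>0 / c\<^sup>2 * norm f * L) * weight (\<lambda>m. w m - z m)"
    and "finite M \<Longrightarrow> (\<And>m. m \<notin> M \<Longrightarrow> w m = z m) \<Longrightarrow>
      cmod (resolvent_coeff w h g \<omega> - resolvent_coeff z h g \<omega> - (\<Sum>m\<in>M. resolvent_deriv z h g m \<omega> * (w m - z m)))
      \<le> ((2 * \<alpha>\<^sub>0)\<^sup>2 / c ^ 3 * norm f * L) * (weight (\<lambda>m. w m - z m))\<^sup>2"
proof -
  note adw = admissible_diff[OF w(1) z(1)]
  let ?W = "weight (\<lambda>m. w m - z m)"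
  note tl = bounded_linear.linear[OF test_functional_bounded_linear[of g]]
  have D: "S z \<omega> x - S w \<omega> x = pert (\<lambda>m. w m - z m) x" for x
    by (simp add: S_eq pert_diff[OF w(1) z(1)])
  have Dn: "norm (S z \<omega> x - S w \<omega> x) \<le> (2 * \<alpha>\<^sub>0 * ?W) * norm x" for x
    unfolding D by (rule pert_norm_le[OF adw])
  note ie = inverse_expansion[OF S_bounded_linear[OF z(1)] z(2) S_bounded_linear[OF w(1)] w(2) c z(3) w(3) Dn, of f]
  have "cmod (resolvent_coeff w h g \<omega> - resolvent_coeff z h g \<omega>)
      \<le> norm (inv (S w \<omega>) f - inv (S z \<omega>) f) * L"
    unfolding resolvent_coeff_eq f_def linear_diff[OF tl, symmetric] by (rule L(2))
  also have "\<dots> \<le> (2 * \<alpha>\<^sub>0 * ?W / c\<^sup>2 * norm f) * L" using ie(1) L(1) by (rule mult_right_mono)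
  finally show "cmod (resolvent_coeff w h g \<omega> - resolvent_coeff z h g \<omega>) \<le> (2 * \<alpha>\<^sub>0 / c\<^sup>2 * norm f * L) * ?W"
    by (simp add: mult_ac)
  assume M: "finite M" "\<And>m. m \<notin> M \<Longrightarrow> w m = z m"
  have om: "\<omega> \<notin> spec z" by (rule not_in_specI[OF z(1,2) c z(3)])
  have li: "linear (inv (S z \<omega>))"
    using om unfolding not_in_spec_iff by (simp add: bounded_linear.linear)
  have pf: "pert (\<lambda>m. w m - z m) x = (\<Sum>m\<in>M. cscale (w m - z m) (map_prod (form_op (b m)) (form_op (b m)) x))" for x
    by (rule pert_finite[OF M(1)]) (simp add: M(2))
  have "test_functional g (inv (S z \<omega>) (S z \<omega> (inv (S z \<omega>) f) - S w \<omega> (inv (S z \<omega>) f)))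
      = (\<Sum>m\<in>M. resolvent_deriv z h g m \<omega> * (w m - z m))"
    unfolding D pf linear_sum[OF li]
      inv_S_cscale[OF z(1) om] linear_sum[OF tl] test_functional_cscale
    by (simp add: resolvent_deriv_def f_def mult.commute)
  then have "resolvent_coeff w h g \<omega> - resolvent_coeff z h g \<omega> - (\<Sum>m\<in>M. resolvent_deriv z h g m \<omega> * (w m - z m))
    = test_functional g (inv (S w \<omega>) f - inv (S z \<omega>) f - inv (S z \<omega>) (S z \<omega> (inv (S z \<omega>) f) - S w \<omega> (inv (S z \<omega>) f)))"
    by (simp only: linear_diff[OF tl] resolvent_coeff_eq f_def)
  also have "cmod \<dots> \<le> ((2 * \<alpha>\<^sub>0 * ?W)\<^sup>2 / c ^ 3 * norm f) * L"
    by (rule order_trans[OF L(2)]) (rule mult_right_mono[OF ie(2) L(1)])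
  finally show "cmod (resolvent_coeff w h g \<omega> - resolvent_coeff z h g \<omega> - (\<Sum>m\<in>M. resolvent_deriv z h g m \<omega> * (w m - z m)))
      \<le> ((2 * \<alpha>\<^sub>0)\<^sup>2 / c ^ 3 * norm f * L) * ?W\<^sup>2"
    by (simp add: power_mult_distrib mult_ac)
qed

text \<open>The lower bound \<open>c\<close> is uniform on the circle, so integrating the pointwise
  expansion multiplies its remainder by the length \<open>2 * pi * r\<close>.\<close>

lemma contour_integral_expansion:
  fixes h :: "'h \<times> 'h"
  assumes z: "admissible z" "\<And>\<omega>. \<omega> \<in> sphere p r \<Longrightarrow> surj (S z \<omega>)"
      "\<And>\<omega> x. \<omega> \<in> sphere p r \<Longrightarrow> c * norm x \<le> norm (S z \<omega> x)"
    and w: "admissible w" "\<And>\<omega>. \<omega> \<in> sphere p r \<Longrightarrow> surj (S w \<omega>)"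
      "\<And>\<omega> x. \<omega> \<in> sphere p r \<Longrightarrow> c * norm x \<le> norm (S w \<omega> x)"
    and c: "0 < c" and L: "0 \<le> L" "\<And>x. norm (test_functional g x) \<le> norm x * L" and r: "0 < r"
  defines "f \<equiv> map_prod (dual_embed \<iota>) (dual_embed \<iota>) h"
  shows "cmod (contour_integral (circlepath p r) (resolvent_coeff w h g) - contour_integral (circlepath p r) (resolvent_coeff z h g))
      \<le> (2 * \<alpha>\<^sub>0 / c\<^sup>2 * norm f * L) * weight (\<lambda>m. w m - z m) * (2 * pi * r)"
    and "finite M \<Longrightarrow> (\<And>m. m \<notin> M \<Longrightarrow> w m = z m) \<Longrightarrow>
      cmod (contour_integral (circlepath p r) (resolvent_coeff w h g) - contour_integral (circlepath p r) (resolvent_coeff z h g)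
        - (\<Sum>m\<in>M. contour_integral (circlepath p r) (resolvent_deriv z h g m) * (w m - z m)))
      \<le> ((2 * \<alpha>\<^sub>0)\<^sup>2 / c ^ 3 * norm f * L) * (weight (\<lambda>m. w m - z m))\<^sup>2 * (2 * pi * r)"
proof -
  let ?\<gamma> = "circlepath p r"
  have sz: "sphere p r \<inter> spec z = {}" using not_in_specI[OF z(1) z(2) c z(3)] by blast
  have sw: "sphere p r \<inter> spec w = {}" using not_in_specI[OF w(1) w(2) c w(3)] by blast
  have int: "F contour_integrable_on ?\<gamma>" if "continuous_on (sphere p r) F" for F
    by (rule contour_integrable_continuous_circlepath) (use that r in simp)
  note Iz = has_contour_integral_integral[OF int[OF continuous_on_resolvent_coeff(1)[OF z(1) sz, of h g]]]
  note Iw = has_contour_integral_integral[OF int[OF continuous_on_resolvent_coeff(1)[OF w(1) sw, of h g]]]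
  note Id = has_contour_integral_integral[OF int[OF continuous_on_resolvent_coeff(2)[OF z(1) sz, of h g]]]
  have sph: "\<omega> \<in> sphere p r" if "norm (\<omega> - p) = r" for \<omega> using that by (simp add: dist_norm norm_minus_commute)
  note W0 = weight_nonneg[OF admissible_diff[OF w(1) z(1)]]
  show "cmod (contour_integral ?\<gamma> (resolvent_coeff w h g) - contour_integral ?\<gamma> (resolvent_coeff z h g))
      \<le> (2 * \<alpha>\<^sub>0 / c\<^sup>2 * norm f * L) * weight (\<lambda>m. w m - z m) * (2 * pi * r)"
    by (rule has_contour_integral_bound_circlepath[OF has_contour_integral_diff[OF Iw Iz] _ r])
      (use W0 alpha0_pos L(1) c in \<open>simp; fail\<close>,
       unfold f_def, intro resolvent_coeff_expansion(1)[OF z(1) z(2) z(3) w(1) w(2) w(3) c L] sph)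
  assume M: "finite M" "\<And>m. m \<notin> M \<Longrightarrow> w m = z m"
  have Is: "((\<lambda>\<omega>. \<Sum>m\<in>M. resolvent_deriv z h g m \<omega> * (w m - z m)) has_contour_integral
      (\<Sum>m\<in>M. contour_integral ?\<gamma> (resolvent_deriv z h g m) * (w m - z m))) ?\<gamma>"
    by (intro has_contour_integral_sum[OF M(1)] has_contour_integral_rmul Id)
  show "cmod (contour_integral ?\<gamma> (resolvent_coeff w h g) - contour_integral ?\<gamma> (resolvent_coeff z h g)
        - (\<Sum>m\<in>M. contour_integral ?\<gamma> (resolvent_deriv z h g m) * (w m - z m)))
      \<le> ((2 * \<alpha>\<^sub>0)\<^sup>2 / c ^ 3 * norm f * L) * (weight (\<lambda>m. w m - z m))\<^sup>2 * (2 * pi * r)"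
    by (rule has_contour_integral_bound_circlepath[OF has_contour_integral_diff[OF has_contour_integral_diff[OF Iw Iz] Is] _ r])
      (use L(1) c in \<open>simp; fail\<close>,
       unfold f_def, intro resolvent_coeff_expansion(2)[OF z(1) z(2) z(3) w(1) w(2) w(3) c L M] sph)
qed

text \<open>An infinite weighted sum of coordinates is not continuous in the product topology
  without further control. On \<open>E\<close> the majorant \<open>N\<close> makes its partial sums
  converge uniformly.\<close>

lemma continuous_on_weight:
  assumes N: "summable (\<lambda>m. \<kappa> m * N m)" and E: "\<forall>z\<in>E. \<forall>m. cmod (z m) \<le> N m" and z0: "z\<^sub>0 \<in> E"
  shows "continuous_on E (\<lambda>z. weight (\<lambda>m. z m - z\<^sub>0 m))"
  unfolding weight_def
proof (rule uniform_limit_theorem)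
  have bound: "norm (\<kappa> m * cmod (z m - z\<^sub>0 m)) \<le> 2 * (\<kappa> m * N m)" if "z \<in> E" for m z
  proof -
    have "cmod (z m - z\<^sub>0 m) \<le> N m + N m"
      using norm_triangle_ineq4[of "z m" "z\<^sub>0 m"] E z0 that by (metis add_mono order_trans)
    then have "\<kappa> m * cmod (z m - z\<^sub>0 m) \<le> \<kappa> m * (N m + N m)" using kappa_pos[of m] by (intro mult_left_mono) auto
    then show ?thesis using kappa_pos[of m] by (simp add: abs_mult algebra_simps)
  qed
  show "uniform_limit E (\<lambda>n z. \<Sum>m<n. \<kappa> m * cmod (z m - z\<^sub>0 m)) (\<lambda>z. \<Sum>m. \<kappa> m * cmod (z m - z\<^sub>0 m)) sequentially"
    by (rule Weierstrass_m_test[OF _ summable_mult[OF N]]) (rule bound)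
  have "continuous_on E (\<lambda>z. z m)" for m :: nat and E :: "(nat \<Rightarrow> complex) set"
    by (rule continuous_on_subset[OF continuous_on_product_coordinates]) simp
  then show "\<forall>\<^sub>F n in sequentially. continuous_on E (\<lambda>z. \<Sum>m<n. \<kappa> m * cmod (z m - z\<^sub>0 m))"
    by (intro always_eventually allI continuous_intros)
qed simp

text \<open>The weighted distance mediates between the two halves of the definition: on
  \<open>E\<close> it is continuous for the product topology, and in finitely many variables it is
  at most the sum of the increments, since each \<open>\<kappa> m\<close> is at most 1. A single
  sequence \<open>a\<close> serves all finite sets \<open>M\<close>.\<close>

lemma complex_analytic_seqI:
  assumes N: "summable (\<lambda>m. \<kappa> m * N m)" and E: "\<forall>z\<in>E. \<forall>m. cmod (z m) \<le> N m"
    and local: "\<And>z. z \<in> E \<Longrightarrow> \<exists>r>0. \<exists>C\<ge>0. \<exists>a. \<forall>w\<in>E. weight (\<lambda>m. w m - z m) < r \<longrightarrow>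
      cmod (f w - f z) \<le> C * weight (\<lambda>m. w m - z m) \<and>
      (\<forall>M. finite M \<longrightarrow> (\<forall>m. m \<notin> M \<longrightarrow> w m = z m) \<longrightarrow>
        cmod (f w - f z - (\<Sum>m\<in>M. a m * (w m - z m))) \<le> C * (weight (\<lambda>m. w m - z m))\<^sup>2)"
  shows "complex_analytic_seq E f"
  unfolding complex_analytic_seq_def
proof (intro conjI allI impI ballI)
  show "continuous_on E f"
    unfolding continuous_on_def
  proof (rule ballI)
    fix z assume z: "z \<in> E"
    obtain r C where r: "0 < r" "0 \<le> C"
      "\<And>w. w \<in> E \<Longrightarrow> weight (\<lambda>m. w m - z m) < r \<Longrightarrow> cmod (f w - f z) \<le> C * weight (\<lambda>m. w m - z m)"
      using local[OF z] by metis
    have "((\<lambda>w. weight (\<lambda>m. w m - z m)) \<longlongrightarrow> weight (\<lambda>m. z m - z m)) (at z within E)"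
      using continuous_on_weight[OF N E z] z unfolding continuous_on_def by (rule bspec)
    then have lim: "((\<lambda>w. weight (\<lambda>m. w m - z m)) \<longlongrightarrow> 0) (at z within E)" by (simp add: weight_def)
    show "(f \<longlongrightarrow> f z) (at z within E)"
    proof (rule LIM_zero_cancel, rule Lim_null_comparison)
      have "\<forall>\<^sub>F w in at z within E. w \<in> E" by (simp add: eventually_at_filter)
      then show "\<forall>\<^sub>F w in at z within E. norm (f w - f z) \<le> C * weight (\<lambda>m. w m - z m)"
        using order_tendstoD(2)[OF lim r(1)] by eventually_elim (rule r(3))
      show "((\<lambda>w. C * weight (\<lambda>m. w m - z m)) \<longlongrightarrow> 0) (at z within E)"
        using tendsto_mult[OF tendsto_const lim, of C] by simp
    qed
  qed
  fix M :: "nat set" and z assume M: "finite M" and z: "z \<in> E"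
  obtain r C a where r: "0 < r" "0 \<le> C" and "\<forall>w\<in>E. weight (\<lambda>m. w m - z m) < r \<longrightarrow>
      cmod (f w - f z) \<le> C * weight (\<lambda>m. w m - z m) \<and>
      (\<forall>M. finite M \<longrightarrow> (\<forall>m. m \<notin> M \<longrightarrow> w m = z m) \<longrightarrow>
        cmod (f w - f z - (\<Sum>m\<in>M. a m * (w m - z m))) \<le> C * (weight (\<lambda>m. w m - z m))\<^sup>2)"
    using local[OF z] by blast
  then have remainder: "cmod (f w - f z - (\<Sum>m\<in>M. a m * (w m - z m))) \<le> C * (weight (\<lambda>m. w m - z m))\<^sup>2"
    if "w \<in> E" "weight (\<lambda>m. w m - z m) < r" "\<forall>m. m \<notin> M \<longrightarrow> w m = z m" for w
    using that M by blast
  show "\<exists>a. \<forall>e>0. \<exists>d>0. \<forall>w\<in>E. (\<forall>m. m \<notin> M \<longrightarrow> w m = z m) \<longrightarrow> (\<forall>m\<in>M. cmod (w m - z m) < d) \<longrightarrow>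
        cmod (f w - f z - (\<Sum>m\<in>M. a m * (w m - z m))) \<le> e * (\<Sum>m\<in>M. cmod (w m - z m))"
  proof (intro exI[of _ a] allI impI)
    fix e :: real assume "e > 0"
    \<comment> \<open>With total increment below \<open>q\<close> the expansion is valid and the
      quadratic remainder is at most \<open>C * q \<le> e\<close> times the increment. The
      denominator \<open>C + 1\<close> allows \<open>C = 0\<close>.\<close>
    define q where "q = min r (e / (C + 1))"
    have q: "0 < q" "q \<le> r" "C * q \<le> e"
    proof -
      show "0 < q" "q \<le> r" using r \<open>e > 0\<close> by (auto simp: q_def)
      have "C * q \<le> C * (e / (C + 1))" using r(2) by (intro mult_left_mono) (auto simp: q_def)
      also have "\<dots> \<le> e" using r(2) \<open>e > 0\<close> by (simp add: field_simps)
      finally show "C * q \<le> e" .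
    qed
    \<comment> \<open>An equal share of \<open>q\<close> for every coordinate; the added 1 allows an
      empty \<open>M\<close> and makes the total strictly smaller than \<open>q\<close>.\<close>
    define d where "d = q / (real (card M) + 1)"
    have "0 < d" using q by (simp add: d_def)
    show "\<exists>d>0. \<forall>w\<in>E. (\<forall>m. m \<notin> M \<longrightarrow> w m = z m) \<longrightarrow> (\<forall>m\<in>M. cmod (w m - z m) < d) \<longrightarrow>
        cmod (f w - f z - (\<Sum>m\<in>M. a m * (w m - z m))) \<le> e * (\<Sum>m\<in>M. cmod (w m - z m))"
    proof (intro exI[of _ d] conjI ballI impI)
      show "0 < d" by fact
      fix w assume w: "w \<in> E" "\<forall>m. m \<notin> M \<longrightarrow> w m = z m" "\<forall>m\<in>M. cmod (w m - z m) < d"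
      let ?s = "\<Sum>m\<in>M. cmod (w m - z m)" and ?W = "weight (\<lambda>m. w m - z m)"
      have W: "?W = (\<Sum>m\<in>M. \<kappa> m * cmod (w m - z m))" using M w(2) by (intro weight_finite) auto
      have k1: "\<kappa> m \<le> 1" for m
        using sum_le_suminf[OF kappa_summable, of "{m}"] kappa_pos kappa_less by (simp add: less_imp_le)
      have Ws: "?W \<le> ?s" unfolding W using k1 by (intro sum_mono mult_left_le_one_le) (auto simp: less_imp_le[OF kappa_pos])
      have W0: "0 \<le> ?W" unfolding W by (intro sum_nonneg mult_nonneg_nonneg) (auto simp: less_imp_le[OF kappa_pos])
      have "?s \<le> real (card M) * d" using w(3) by (intro sum_bounded_above) (auto intro: less_imp_le)
      also have "\<dots> < q" using q(1) by (simp add: d_def field_simps)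
      finally have sq: "?s < q" .
      have "cmod (f w - f z - (\<Sum>m\<in>M. a m * (w m - z m))) \<le> C * ?W\<^sup>2"
        using remainder[OF w(1) _ w(2)] Ws sq q(2) by simp
      also have "\<dots> = (C * ?W) * ?W" by (simp add: power2_eq_square)
      also have "\<dots> \<le> (C * q) * ?s" using r(2) Ws sq W0 by (intro mult_mono mult_left_mono) auto
      also have "\<dots> \<le> e * ?s" using q(3) by (intro mult_right_mono sum_nonneg) auto
      finally show "cmod (f w - f z - (\<Sum>m\<in>M. a m * (w m - z m))) \<le> e * ?s" .
    qed
  qed
qed

end

section \<open>Stability of the contours and assembly of the extension\<close>

context isolated_eigenspaces
begin

text \<open>Relative to either form the two forms differ by at most a factor \<open>1 + q\<close>,
  where \<open>q\<close> is the weighted distance over \<open>1 - K\<close>, so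
  \<open>eigenvalue_perturbation\<close> applies in both directions. The factor 2 appears when
  \<open>\<mu> y k\<close> is replaced by \<open>\<mu> y\<^sub>0 k\<close> with
  \<open>q \<le> 1\<close>.\<close>

lemma eigenvalue_lipschitz:
  assumes y: "y \<in> param_box" "y\<^sub>0 \<in> param_box"
    and W: "weight (\<lambda>m. of_real (y m) - of_real (y\<^sub>0 m)) \<le> 1 - K"
  shows "\<bar>\<mu> y k - \<mu> y\<^sub>0 k\<bar> \<le> 2 * weight (\<lambda>m. of_real (y m) - of_real (y\<^sub>0 m)) / (1 - K) * \<mu> y\<^sub>0 k"
proof -
  let ?W = "weight (\<lambda>m. complex_of_real (y m) - of_real (y\<^sub>0 m))"
  define q where "q = ?W / (1 - K)"
  have sym: "weight (\<lambda>m. complex_of_real (y\<^sub>0 m) - of_real (y m)) = ?W"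
    unfolding weight_def by (simp add: norm_minus_commute)
  have "0 \<le> ?W" using y by (intro weight_nonneg admissible_diff param_box_admissible)
  then have q: "0 \<le> q" "q \<le> 1" using W K_bounds by (auto simp: q_def)
  have le: "param_form b0 b y1 v v \<le> (1 + q) * param_form b0 b y2 v v"
    if y12: "y1 \<in> param_box" "y2 \<in> param_box" "weight (\<lambda>m. complex_of_real (y1 m) - of_real (y2 m)) = ?W" for y1 y2 v
  proof -
    have "\<alpha>\<^sub>0 * ?W * (norm v)\<^sup>2 = q * (\<alpha> * (norm v)\<^sup>2)" using K_bounds by (simp add: q_def \<alpha>_def)
    also have "\<dots> \<le> q * param_form b0 b y2 v v" by (rule mult_left_mono[OF param_form_coercive[OF y12(2)] q(1)])
    finally show ?thesis using param_form_diff[OF y12(1,2), of v] unfolding y12(3) by (simp add: algebra_simps)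
  qed
  have up: "\<mu> y k \<le> (1 + q) * \<mu> y\<^sub>0 k"
    by (rule eigenvalue_perturbation[OF eigensystem_at[OF y(2)] eigensystem_at[OF y(1)]])
      (use le y q in auto)
  have "\<mu> y\<^sub>0 k \<le> (1 + q) * \<mu> y k"
    by (rule eigenvalue_perturbation[OF eigensystem_at[OF y(1)] eigensystem_at[OF y(2)]])
      (use le y q sym in auto)
  then have "\<mu> y\<^sub>0 k - \<mu> y k \<le> q * \<mu> y k" by (simp add: algebra_simps)
  also have "\<dots> \<le> q * ((1 + q) * \<mu> y\<^sub>0 k)" by (rule mult_left_mono[OF up q(1)])
  also have "\<dots> \<le> q * (2 * \<mu> y\<^sub>0 k)" using q mu_pos[OF y(2), of k] by (intro mult_left_mono mult_right_mono) auto
  finally have "\<mu> y\<^sub>0 k - \<mu> y k \<le> 2 * q * \<mu> y\<^sub>0 k" by simp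
  moreover have "\<mu> y k - \<mu> y\<^sub>0 k \<le> 2 * q * \<mu> y\<^sub>0 k"
  proof -
    have "\<mu> y k - \<mu> y\<^sub>0 k \<le> q * \<mu> y\<^sub>0 k" using up by (simp add: algebra_simps)
    also have "\<dots> \<le> 2 * q * \<mu> y\<^sub>0 k" using q mu_pos[OF y(2), of k] by simp
    finally show ?thesis .
  qed
  ultimately show ?thesis by (simp add: q_def abs_le_iff)
qed

text \<open>The circle built from the eigenvalues at \<open>y\<close> is judged against those at
  \<open>y\<^sub>0\<close>. This is what lets \<open>contour_integral_independent\<close> exchange
  it for the circle of \<open>y\<^sub>0\<close>.\<close>

lemma encloses_run_nearby:
  assumes y0: "y\<^sub>0 \<in> param_box" and i: "i \<in> run_starts J"
  shows "\<exists>r>0. \<forall>y\<in>param_box. weight (\<lambda>m. of_real (y m) - of_real (y\<^sub>0 m)) < r \<longrightarrow>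
    encloses_run (\<mu> y\<^sub>0) i (lower (\<mu> y) i) (upper (\<mu> y) i)"
proof -
  define A where "A y = (if i = 0 then 0 else (1 + \<eta>) * \<mu> y (i - 1))" for y
  define B where "B y = (1 - \<eta>) * \<mu> y i" for y
  define C where "C y = (1 + \<eta>) * \<mu> y (run_end J i)" for y
  define D where "D y = (1 - \<eta>) * \<mu> y (Suc (run_end J i))" for y
  have lower: "2 * lower (\<mu> y) i = A y + B y" and upper: "2 * upper (\<mu> y) i = C y + D y" for y
    by (simp_all add: lower_def upper_def A_def B_def C_def D_def)
  have enc: "encloses_run (\<mu> y\<^sub>0) i s t \<longleftrightarrow> A y\<^sub>0 < s \<and> s < B y\<^sub>0 \<and> C y\<^sub>0 < t \<and> t < D y\<^sub>0" for s t
    unfolding encloses_run_def A_def B_def C_def D_def by simp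
  have gap: "A y\<^sub>0 < B y\<^sub>0" "C y\<^sub>0 < D y\<^sub>0"
    using encloses_run_lower_upper[OF y0 i] unfolding enc by linarith+
  \<comment> \<open>At \<open>y\<^sub>0\<close> each end of the diameter is at least
    \<open>2 * e\<close> away from both sides of its gap, being the midpoint, and it moves by less
    than \<open>2 * e\<close>.\<close>
  define e where "e = min (B y\<^sub>0 - A y\<^sub>0) (D y\<^sub>0 - C y\<^sub>0) / 4"
  have e: "0 < e" "4 * e \<le> B y\<^sub>0 - A y\<^sub>0" "4 * e \<le> D y\<^sub>0 - C y\<^sub>0" using gap by (auto simp: e_def)
  \<comment> \<open>The eigenvalue estimate is relative. Only indices up to
    \<open>Suc (run_end J i)\<close> occur, so their largest eigenvalue converts it into an absolute
    one.\<close>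
  define M where "M = \<mu> y\<^sub>0 (Suc (run_end J i))"
  have M: "0 < M" unfolding M_def by (rule mu_pos[OF y0])
  define r where "r = min (1 - K) (e * (1 - K) / (2 * M))"
  have "0 < r" using e M K_bounds by (simp add: r_def)
  moreover have "encloses_run (\<mu> y\<^sub>0) i (lower (\<mu> y) i) (upper (\<mu> y) i)"
    if y: "y \<in> param_box" and W: "weight (\<lambda>m. of_real (y m) - of_real (y\<^sub>0 m)) < r" for y
  proof -
    let ?W = "weight (\<lambda>m. complex_of_real (y m) - of_real (y\<^sub>0 m))"
    have W0: "0 \<le> ?W" using y y0 by (intro weight_nonneg admissible_diff param_box_admissible)
    have W1: "?W \<le> 1 - K" "?W < e * (1 - K) / (2 * M)" using W by (auto simp: r_def)
    have diff: "\<bar>\<mu> y k - \<mu> y\<^sub>0 k\<bar> < e" if "k \<le> Suc (run_end J i)" for k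
    proof -
      have "\<bar>\<mu> y k - \<mu> y\<^sub>0 k\<bar> \<le> 2 * ?W / (1 - K) * \<mu> y\<^sub>0 k" by (rule eigenvalue_lipschitz[OF y y0 W1(1)])
      also have "\<dots> \<le> 2 * ?W / (1 - K) * M"
        unfolding M_def using W0 K_bounds by (intro mult_left_mono mu_mono[OF y0 that]) auto
      also have "\<dots> < e" using W1(2) M K_bounds by (simp add: field_simps)
      finally show ?thesis .
    qed
    have scale: "\<bar>q * x - q * x'\<bar> < 2 * e" if "0 \<le> q" "q \<le> 2" "\<bar>x - x'\<bar> < e" for q x x' :: real
    proof -
      have "\<bar>q * x - q * x'\<bar> = q * \<bar>x - x'\<bar>" using that(1) by (simp add: right_diff_distrib[symmetric] abs_mult)
      also have "\<dots> \<le> 2 * \<bar>x - x'\<bar>" using that(2) by (intro mult_right_mono) auto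
      finally show ?thesis using that(3) by simp
    qed
    have j: "i \<le> run_end J i" using run_end(1)[OF finite_J] i by (simp add: run_starts_def)
    have eta: "0 \<le> 1 + \<eta>" "1 + \<eta> \<le> 2" "0 \<le> 1 - \<eta>" "1 - \<eta> \<le> 2" using eta_bounds by auto
    have "\<bar>A y - A y\<^sub>0\<bar> < 2 * e" unfolding A_def using scale[OF eta(1,2) diff[of "i - 1"]] j e(1) by simp
    moreover have "\<bar>B y - B y\<^sub>0\<bar> < 2 * e" unfolding B_def using scale[OF eta(3,4) diff[of i]] j by simp
    moreover have "\<bar>C y - C y\<^sub>0\<bar> < 2 * e" unfolding C_def using scale[OF eta(1,2) diff[of "run_end J i"]] by simp
    moreover have "\<bar>D y - D y\<^sub>0\<bar> < 2 * e" unfolding D_def using scale[OF eta(3,4) diff[of "Suc (run_end J i)"]] by simp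
    ultimately show ?thesis unfolding enc using lower[of y] upper[of y] e(2,3) by linarith
  qed
  ultimately show ?thesis by blast
qed

lemma encloses_runs_nearby:
  assumes y0: "y\<^sub>0 \<in> param_box"
  obtains r where "0 < r" "\<And>y i. y \<in> param_box \<Longrightarrow> weight (\<lambda>m. of_real (y m) - of_real (y\<^sub>0 m)) < r \<Longrightarrow>
    i \<in> run_starts J \<Longrightarrow> encloses_run (\<mu> y\<^sub>0) i (lower (\<mu> y) i) (upper (\<mu> y) i)"
proof -
  obtain q where q: "\<And>i. i \<in> run_starts J \<Longrightarrow> 0 < q i \<and> (\<forall>y\<in>param_box. weight (\<lambda>m. of_real (y m) - of_real (y\<^sub>0 m)) < q i \<longrightarrow>
    encloses_run (\<mu> y\<^sub>0) i (lower (\<mu> y) i) (upper (\<mu> y) i))"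
    using encloses_run_nearby[OF y0] by metis
  \<comment> \<open>The inserted 1 keeps the minimum defined and positive if there are no
    runs.\<close>
  define r where "r = Min (insert 1 (q ` run_starts J))"
  have fin: "finite (insert 1 (q ` run_starts J))" using finite_run_starts by simp
  have "0 < r" unfolding r_def using fin q by (subst Min_gr_iff) auto
  moreover have "r \<le> q i" if "i \<in> run_starts J" for i unfolding r_def using fin that by (intro Min_le) auto
  ultimately show thesis using q by (intro that[of r]) (meson order_less_le_trans)+
qed

lemma analytic_extension:
  assumes N: "summable (\<lambda>m. \<kappa> m * N m)" "\<forall>z\<in>E. \<forall>m. cmod (z m) \<le> N m"
    and E: "\<And>z. z \<in> E \<Longrightarrow> weight (\<lambda>m. z m - of_real (box_clamp z m)) \<le> \<theta> * (1 - K)" and "\<theta> < \<eta>"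
  shows "has_analytic_extension \<iota> (param_op b0 b) (\<lambda>y. span (u y ` J)) E"
proof -
  have adm: "admissible z" if "z \<in> E" for z
    unfolding admissible_def
  proof (rule summable_comparison_test[OF _ N(1)])
    have "norm (\<kappa> m * cmod (z m)) \<le> \<kappa> m * N m" for m
      using N(2) that kappa_pos[of m] by (simp add: abs_mult)
    then show "\<exists>n. \<forall>m\<ge>n. norm (\<kappa> m * cmod (z m)) \<le> \<kappa> m * N m" by blast
  qed
  define P where "P z = riesz_projection \<iota> (param_op b0 b z) (contours (box_clamp z))" for z
  have analytic: "complex_analytic_seq E (\<lambda>z. cinner (P z h) g)" for h g
  proof (rule complex_analytic_seqI[OF N])
    fix z assume z: "z \<in> E"
    let ?y = "box_clamp z"
    note y = box_clamp_in_box[of z]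
    \<comment> \<open>Halfway between \<open>\<theta>\<close> and \<open>\<eta>\<close>: points
      \<open>w\<close> near \<open>z\<close> are measured from the box point of \<open>z\<close>
      instead of their own, and this costs a little more than \<open>\<theta>\<close>.\<close>
    define \<theta>' where "\<theta>' = (\<theta> + \<eta>) / 2"
    have th: "\<theta> < \<theta>'" "\<theta>' < \<eta>" using \<open>\<theta> < \<eta>\<close> by (auto simp: \<theta>'_def field_simps)
    define c where "c = (\<eta> - \<theta>') * \<alpha>"
    have c: "0 < c" using th alpha_pos by (simp add: c_def)
    obtain L where L: "0 < L" "\<And>x. norm (test_functional g x) \<le> norm x * L"
      using bounded_linear.pos_bounded[OF test_functional_bounded_linear] by blast
    obtain r1 where r1: "0 < r1" "\<And>y i. y \<in> param_box \<Longrightarrow> weight (\<lambda>m. of_real (y m) - of_real (?y m)) < r1 \<Longrightarrow>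
      i \<in> run_starts J \<Longrightarrow> encloses_run (\<mu> ?y) i (lower (\<mu> y) i) (upper (\<mu> y) i)"
      using encloses_runs_nearby[OF y] by blast
    \<comment> \<open>The first entry keeps the circles of nearby box points valid at
      \<open>?y\<close>, the second pays for the passage from \<open>\<theta>\<close> to
      \<open>\<theta>'\<close>.\<close>
    define r where "r = min r1 ((\<theta>' - \<theta>) * (1 - K))"
    have r: "0 < r" using r1 th K_bounds by (simp add: r_def)
    define p where "p i = complex_of_real ((lower (\<mu> ?y) i + upper (\<mu> ?y) i) / 2)" for i
    define R where "R i = (upper (\<mu> ?y) i - lower (\<mu> ?y) i) / 2" for i
    have R: "0 < R i" if "i \<in> run_starts J" for i using lower_less_upper[OF y that] by (simp add: R_def)
    have circ: "diameter_circle (lower (\<mu> ?y) i) (upper (\<mu> ?y) i) = circlepath (p i) (R i)" for i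
      by (simp only: diameter_circle_def p_def R_def)
    have near: "weight (\<lambda>m. w m - of_real (?y m)) \<le> \<theta>' * (1 - K)"
      if w: "w \<in> E" "weight (\<lambda>m. w m - z m) < r" for w
    proof -
      have "weight (\<lambda>m. w m - of_real (?y m)) \<le> weight (\<lambda>m. w m - z m) + weight (\<lambda>m. z m - of_real (?y m))"
        by (intro weight_triangle admissible_diff adm w z param_box_admissible y)
      also have "\<dots> \<le> (\<theta>' - \<theta>) * (1 - K) + \<theta> * (1 - K)" using w(2) E[OF z] by (simp add: r_def)
      finally show ?thesis by (simp add: algebra_simps)
    qed
    \<comment> \<open>The contour of \<open>P w\<close> varies with \<open>w\<close>; here it is
      frozen at the one belonging to \<open>z\<close>, so that only the integrand still depends on
      \<open>w\<close>.\<close>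
    have eq: "cinner (P w h) g = 1 / (2 * of_real pi * \<i>) *
        (\<Sum>i\<in>run_starts J. contour_integral (circlepath (p i) (R i)) (resolvent_coeff w h g))"
      if w: "w \<in> E" "weight (\<lambda>m. w m - z m) < r" for w
    proof -
      have "weight (\<lambda>m. complex_of_real (box_clamp w m) - of_real (?y m)) \<le> weight (\<lambda>m. w m - z m)"
        unfolding weight_def of_real_diff[symmetric] norm_of_real
        using admissible_diff[OF adm[OF w(1)] adm[OF z]]
          admissible_diff[OF param_box_admissible[OF box_clamp_in_box[of w]] param_box_admissible[OF y]]
        by (intro suminf_le mult_left_mono box_clamp_lipschitz less_imp_le[OF kappa_pos])
          (simp_all add: admissible_def of_real_diff[symmetric] del: of_real_diff)
      then have W: "weight (\<lambda>m. complex_of_real (box_clamp w m) - of_real (?y m)) < r1" using w(2) by (simp add: r_def)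
      have "contour_integral (diameter_circle (lower (\<mu> (box_clamp w)) i) (upper (\<mu> (box_clamp w)) i)) (resolvent_coeff w h g)
          = contour_integral (circlepath (p i) (R i)) (resolvent_coeff w h g)" if i: "i \<in> run_starts J" for i
        unfolding circ[symmetric]
        by (rule contour_integral_independent[OF y i r1(2)[OF box_clamp_in_box W i] encloses_run_lower_upper[OF y i]
              adm[OF w(1)] near[OF w] th(2)])
      then show ?thesis
        unfolding P_def cinner_riesz_projection[OF box_clamp_in_box adm[OF w(1)] E[OF w(1)] \<open>\<theta> < \<eta>\<close>]
        by (intro arg_cong2[of _ _ _ _ "(*)"] sum.cong) auto
    qed
    have zz: "weight (\<lambda>m. z m - z m) < r" using r by (simp add: weight_def)
    have regular: "surj (S w \<omega>)" "c * norm x \<le> norm (S w \<omega> x)"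
      if w: "w \<in> E" "weight (\<lambda>m. w m - z m) < r" and i: "i \<in> run_starts J" and om: "\<omega> \<in> sphere (p i) (R i)" for w i \<omega> x
    proof -
      have om': "\<omega> \<in> path_image (diameter_circle (lower (\<mu> ?y) i) (upper (\<mu> ?y) i))"
        unfolding circ using om R[OF i] by simp
      show "surj (S w \<omega>)" "c * norm x \<le> norm (S w \<omega> x)"
        unfolding c_def
        using circle_regular(1,2)[OF y i encloses_run_lower_upper[OF y i] om' adm[OF w(1)] near[OF w] th(2)] by auto
    qed
    define f where "f = map_prod (dual_embed \<iota>) (dual_embed \<iota>) h"
    define C\<^sub>1 where "C\<^sub>1 = 2 * \<alpha>\<^sub>0 / c\<^sup>2 * norm f * L"
    define C\<^sub>2 where "C\<^sub>2 = (2 * \<alpha>\<^sub>0)\<^sup>2 / c ^ 3 * norm f * L"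
    define \<rho> where "\<rho> = (\<Sum>i\<in>run_starts J. R i)"
    have "0 \<le> \<rho>" unfolding \<rho>_def by (intro sum_nonneg less_imp_le R)
    then have C: "0 \<le> C\<^sub>1" "0 \<le> C\<^sub>2" "0 \<le> \<rho>" using alpha0_pos c L(1)
      by (auto simp: C\<^sub>1_def C\<^sub>2_def)
    define a where "a m = 1 / (2 * of_real pi * \<i>) *
      (\<Sum>i\<in>run_starts J. contour_integral (circlepath (p i) (R i)) (resolvent_deriv z h g m))" for m
    \<comment> \<open>The prefactor cancels the \<open>2 * pi\<close> of every circle length,
      leaving the sum \<open>\<rho>\<close> of the radii.\<close>
    have total: "cmod (1 / (2 * of_real pi * \<i>) * (\<Sum>i\<in>run_starts J. q i)) \<le> B * \<rho>"
      if "\<And>i. i \<in> run_starts J \<Longrightarrow> cmod (q i) \<le> B * (2 * pi * R i)" for q B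
    proof -
      have "cmod (\<Sum>i\<in>run_starts J. q i) \<le> (\<Sum>i\<in>run_starts J. B * (2 * pi * R i))"
        by (rule sum_norm_le) (rule that)
      also have "\<dots> = 2 * pi * (B * \<rho>)" by (simp add: \<rho>_def sum_distrib_left mult_ac)
      finally show ?thesis by (simp add: norm_mult norm_divide field_simps)
    qed
    show "\<exists>r>0. \<exists>C\<ge>0. \<exists>a. \<forall>w\<in>E. weight (\<lambda>m. w m - z m) < r \<longrightarrow>
      cmod (cinner (P w h) g - cinner (P z h) g) \<le> C * weight (\<lambda>m. w m - z m) \<and>
      (\<forall>M. finite M \<longrightarrow> (\<forall>m. m \<notin> M \<longrightarrow> w m = z m) \<longrightarrow>
        cmod (cinner (P w h) g - cinner (P z h) g - (\<Sum>m\<in>M. a m * (w m - z m))) \<le> C * (weight (\<lambda>m. w m - z m))\<^sup>2)"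
    proof (rule exI[of _ r], intro conjI r, rule exI[of _ "(C\<^sub>1 + C\<^sub>2) * \<rho>"], intro conjI,
        use C in simp, rule exI[of _ a], intro ballI impI conjI allI)
      fix w assume w: "w \<in> E" "weight (\<lambda>m. w m - z m) < r"
      let ?W = "weight (\<lambda>m. w m - z m)"
      have W0: "0 \<le> ?W" by (intro weight_nonneg admissible_diff adm w z)
      let ?I = "\<lambda>F i. contour_integral (circlepath (p i) (R i)) F"
      have first: "cmod (?I (resolvent_coeff w h g) i - ?I (resolvent_coeff z h g) i) \<le> C\<^sub>1 * ?W * (2 * pi * R i)"
        and second: "finite M \<Longrightarrow> (\<And>m. m \<notin> M \<Longrightarrow> w m = z m) \<Longrightarrow>
          cmod (?I (resolvent_coeff w h g) i - ?I (resolvent_coeff z h g) i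
            - (\<Sum>m\<in>M. ?I (resolvent_deriv z h g m) i * (w m - z m))) \<le> C\<^sub>2 * ?W\<^sup>2 * (2 * pi * R i)"
        if i: "i \<in> run_starts J" for i M
        unfolding C\<^sub>1_def C\<^sub>2_def f_def
        by (rule contour_integral_expansion[OF adm[OF z] regular(1)[OF z zz i] regular(2)[OF z zz i]
          adm[OF w(1)] regular(1)[OF w i] regular(2)[OF w i] c less_imp_le[OF L(1)] L(2) R[OF i]]; assumption)+
      have "cmod (cinner (P w h) g - cinner (P z h) g) \<le> (C\<^sub>1 * ?W) * \<rho>"
        unfolding eq[OF w] eq[OF z zz] right_diff_distrib[symmetric] sum_subtractf[symmetric]
        by (rule total) (rule first)
      also have "\<dots> \<le> (C\<^sub>1 + C\<^sub>2) * \<rho> * ?W" using C W0 by (simp add: algebra_simps)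
      finally show "cmod (cinner (P w h) g - cinner (P z h) g) \<le> (C\<^sub>1 + C\<^sub>2) * \<rho> * ?W" .
      fix M :: "nat set" assume M: "finite M" "\<forall>m. m \<notin> M \<longrightarrow> w m = z m"
      have as: "(\<Sum>m\<in>M. a m * (w m - z m)) = 1 / (2 * of_real pi * \<i>) *
          (\<Sum>i\<in>run_starts J. \<Sum>m\<in>M. contour_integral (circlepath (p i) (R i)) (resolvent_deriv z h g m) * (w m - z m))"
        unfolding a_def sum.swap[of _ "run_starts J"] sum_distrib_left sum_distrib_right by (simp add: mult.assoc)
      have "cmod (cinner (P w h) g - cinner (P z h) g - (\<Sum>m\<in>M. a m * (w m - z m))) \<le> (C\<^sub>2 * ?W\<^sup>2) * \<rho>"
        unfolding eq[OF w] eq[OF z zz] as right_diff_distrib[symmetric] sum_subtractf[symmetric]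
        by (rule total) (rule second, use M in auto)
      also have "\<dots> \<le> (C\<^sub>1 + C\<^sub>2) * \<rho> * ?W\<^sup>2" using C by (simp add: algebra_simps)
      finally show "cmod (cinner (P w h) g - cinner (P z h) g - (\<Sum>m\<in>M. a m * (w m - z m))) \<le> (C\<^sub>1 + C\<^sub>2) * \<rho> * ?W\<^sup>2" .
    qed
  qed
  have "spectral_projection \<iota> (param_op b0 b z) (P z)" if "z \<in> E" for z
    unfolding P_def by (rule contours_enclosing[OF box_clamp_in_box adm[OF that] E[OF that] \<open>\<theta> < \<eta>\<close>])
  moreover have "orth_projection_onto ((\<iota> ` span (u y ` J)) \<times> (\<iota> ` span (u y ` J))) (P (\<lambda>m. of_real (y m)))"
    if "y \<in> param_box" for y
    unfolding P_def box_clamp_real[OF that] by (rule riesz_projection_real[OF that])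
  ultimately show ?thesis unfolding has_analytic_extension_def using analytic by blast
qed

end

theorem theorem1:
  fixes \<iota> :: "'v::{real_inner, banach} \<Rightarrow>\<^sub>L 'h::{real_inner, banach}"
    and b0 :: "'v \<Rightarrow> 'v \<Rightarrow> real" and b :: "nat \<Rightarrow> 'v \<Rightarrow> 'v \<Rightarrow> real"
    and \<alpha>\<^sub>0 p \<delta> \<epsilon> :: real and \<kappa> \<tau> :: "nat \<Rightarrow> real"
    and \<mu> :: "(nat \<Rightarrow> real) \<Rightarrow> nat \<Rightarrow> real" and u :: "(nat \<Rightarrow> real) \<Rightarrow> nat \<Rightarrow> 'v"
    and J :: "nat set"
  assumes "separable_space (euclidean :: 'v topology)" "separable_space (euclidean :: 'h topology)"
    and "gelfand_triple \<iota>"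
    and "bounded_bilinear b0" "\<And>v w. b0 v w = b0 w v"
    and "\<And>m. bounded_bilinear (b m)" "\<And>m v w. b m v w = b m w v"
    and "\<alpha>\<^sub>0 > 0" "\<And>v. b0 v v \<ge> \<alpha>\<^sub>0 * (norm v)\<^sup>2"
    and "\<And>m. \<kappa> m > 0" "summable \<kappa>" "(\<Sum>m. \<kappa> m) < 1"
    and "\<And>m v w. \<bar>b m v w\<bar> \<le> \<kappa> m * \<alpha>\<^sub>0 * norm v * norm w"
    and "\<And>y. y \<in> param_box \<Longrightarrow> eigen_enumeration \<iota> (param_form b0 b y) (\<mu> y) (u y)"
    and "0 < p" "p \<le> 1" "summable (\<lambda>m. \<kappa> m powr p)"
    and "finite J" "\<delta> > 0" "isolated_with \<mu> J \<delta>"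
    and "0 < \<epsilon>" "\<epsilon> < 1"
    and "\<And>m. \<tau> m = (1 - \<epsilon>) * (1 - (\<Sum>n. \<kappa> n)) * \<kappa> m powr (p - 1) /
                      (2 * (\<Sum>n. \<kappa> n powr p) * (1 + 1 / \<delta>))"
  shows "has_analytic_extension \<iota> (param_op b0 b) (\<lambda>y. span (u y ` J)) (ext_region \<tau>)"
proof -
  interpret isolated_eigenspaces \<iota> b0 b \<alpha>\<^sub>0 \<kappa> \<mu> u J \<delta>
    by (intro isolated_eigenspaces.intro affine_form.intro isolated_eigenspaces_axioms.intro) (use assms in auto)
  let ?Z = "\<Sum>n. \<kappa> n powr p"
  \<comment> \<open>The size of the perturbation relative to the form, uniform over the region. The
    factor \<open>1 - \<epsilon>\<close> keeps it strictly below the margin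
    \<open>\<eta>\<close>.\<close>
  define \<theta> where "\<theta> = (1 - \<epsilon>) * \<eta>"
  have "\<kappa> n \<noteq> 0" for n using assms(10)[of n] by simp
  then have Z: "0 < ?Z" using assms(17) by (intro suminf_pos) auto
  have eta: "\<eta> = 1 / (2 * (1 + 1 / \<delta>))" using \<open>\<delta> > 0\<close> by (simp add: \<eta>_def field_simps)
  \<comment> \<open>The exponent \<open>p - 1\<close> combines with the weight to
    \<open>\<kappa> m powr p\<close>; division by \<open>?Z\<close> then makes the weighted sum of
    the radii exactly \<open>\<theta> * (1 - K)\<close>.\<close>
  have kt: "\<kappa> m * \<tau> m = \<theta> * (1 - K) / ?Z * \<kappa> m powr p" for m
  proof -
    have "\<kappa> m * \<kappa> m powr (p - 1) = \<kappa> m powr p" using kappa_pos[of m] by (simp add: powr_mult_base)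
    then show ?thesis unfolding assms(23) \<theta>_def eta K_def by (simp add: field_simps)
  qed
  have kt_summable: "summable (\<lambda>m. \<kappa> m * \<tau> m)" unfolding kt by (rule summable_mult[OF assms(17)])
  have kt_sum: "(\<Sum>m. \<kappa> m * \<tau> m) = \<theta> * (1 - K)"
    unfolding kt suminf_mult[OF assms(17)] using Z by simp
  have near: "cmod (z m - of_real (box_clamp z m)) \<le> \<tau> m" if "z \<in> ext_region \<tau>" for z m
  proof -
    have "infdist (z m) (of_real ` {-1..1}) < \<tau> m" using that by (simp add: ext_region_def)
    then show ?thesis using box_clamp_nearest[of z m] by linarith
  qed
  show ?thesis
  proof (rule analytic_extension)
    \<comment> \<open>Each coordinate lies within \<open>\<tau> m\<close> of the unit interval, so
      \<open>1 + \<tau> m\<close> is the majorant needed for continuity in the product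
      topology.\<close>
    show "summable (\<lambda>m. \<kappa> m * (1 + \<tau> m))"
      unfolding distrib_left using summable_add[OF kappa_summable kt_summable] by simp
    show "\<theta> < \<eta>" using eta_bounds assms(21) by (simp add: \<theta>_def)
    show "\<forall>z\<in>ext_region \<tau>. \<forall>m. cmod (z m) \<le> 1 + \<tau> m"
    proof (intro ballI allI)
      fix z m assume z: "z \<in> ext_region \<tau>"
      have "cmod (z m) \<le> \<bar>box_clamp z m\<bar> + cmod (z m - of_real (box_clamp z m))"
        using norm_triangle_sub[of "z m" "of_real (box_clamp z m)"] by simp
      moreover have "\<bar>box_clamp z m\<bar> \<le> 1" by (auto simp: box_clamp_def)
      ultimately show "cmod (z m) \<le> 1 + \<tau> m" using near[OF z, of m] by linarith
    qed
    fix z assume z: "z \<in> ext_region \<tau>"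
    have le: "\<kappa> m * cmod (z m - of_real (box_clamp z m)) \<le> \<kappa> m * \<tau> m" for m
      using near[OF z] kappa_pos[of m] by simp
    have "summable (\<lambda>m. \<kappa> m * cmod (z m - of_real (box_clamp z m)))"
      by (rule summable_comparison_test[OF _ kt_summable])
        (use le kappa_pos in \<open>auto simp: abs_mult less_imp_le\<close>)
    then show "weight (\<lambda>m. z m - of_real (box_clamp z m)) \<le> \<theta> * (1 - K)"
      unfolding weight_def kt_sum[symmetric] by (intro suminf_le le kt_summable)
  qed
qed

end
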